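(* Let $S$ be a symplectic leaf (embedded, of positive codimension) of a Poisson manifold $(M,\Psi)$ with normal bundle $E$, and let $\mathcal{P}=\mathcal{P}^\Sigma$ be its infinitesimal Poisson algebra associated to a transversal $\Sigma$, with Poisson triple $([\,,\,]_{\mathrm{fib}},\mathcal{D},\mathcal{K})$. Suppose that the isotropy $\mathfrak{g}$ of $S$ is a perfect Lie algebra, $\mathfrak{g}=[\mathfrak{g},\mathfrak{g}]$. Then the first cohomology of $\mathcal{P}$ is of the form $$\mathscr{H}^1(\mathcal{P})\simeq\mathrm{H}^1_{\partial_{\mathcal{D}}}(\Gamma^*_{\mathcal{P}})\oplus\frac{\mathfrak{M}(\mathcal{P})}{\mathscr{C}(\mathcal{P})+\mathrm{Inn}(E^*,[\,,\,]_{\mathrm{fib}})}$$ (isomorphism of real vector spaces), where: - $\mathfrak{M}(\mathcal{P})$ is the Lie algebra of all $\mathscr{L}\in\mathrm{PDer}(E^*,[\,,\,]_{\mathrm{fib}})$, with associated vector field $\ell$, for which there exists $\theta\in\mathfrak{X}(S)\otimes\Gamma E^*$ such that for all $f,g\in C^\infty(S)$ $$\mathcal{D}_{df}\circ\mathscr{L}-\mathscr{L}\circ\mathcal{D}_{df}+\mathcal{D}_{d\ell(f)}=[\theta(f),\cdot]_{\mathrm{fib}},$$ $$\mathscr{L}(\mathcal{K}(df,dg))-\mathcal{K}(d\ell(f),dg)-\mathcal{K}(df,d\ell(g))=-(d_{\mathcal{D}}\theta)(f,g);$$ - $\mathscr{C}(\mathcal{P})=\{\mathcal{D}_{df}\mid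 f\in C^\infty(S)\}$ is the $\mathbb{R}$-submodule of Lie derivations induced by $\mathcal{D}$; - $\mathrm{Inn}(E^*,[\,,\,]_{\mathrm{fib}})=\{[\eta,\cdot]_{\mathrm{fib}}\mid\eta\in\Gamma E^*\}$ is the Lie ideal of inner derivations.
   Context: Geometric setting: $(M,\Psi)$ is a smooth Poisson manifold, $S\subset M$ an embedded symplectic leaf of positive codimension, $\psi$ the induced nondegenerate Poisson bivector field on $S$ with bracket $\{\,,\,\}_\psi$, $E=T_SM/TS$ the normal bundle ($T_SM=TM|_S$), $E^*$ its dual, identified with the annihilator $(TS)^\circ\subset T^*_SM$. Fix a subbundle (transversal) $\Sigma\subset T_SM$ with $T_SM=TS\oplus\Sigma$; this gives $T^*_SM=\Sigma^\circ\oplus(TS)^\circ\simeq T^*S\oplus E^*$. The cotangent Lie algebroid of $(M,\Psi)$ (bracket with $[dF,dG]=d\{F,G\}_M$) restricts to a Lie algebroid structure on $T^*_SM$ with bracket $[\,,\,]_S$. For $\eta,\xi\in\Gamma E^*$ and $\alpha,\beta\in\Gamma T^*S\simeq\Gamma\Sigma^\circ$, the Poisson triple is: $[\eta,\xi]_{\mathrm{fib}}=[\eta,\xi]_S$; $\mathcal{D}_\alpha\eta=$ the $E^*$-component of $[\alpha,\eta]_S$; $\mathcal{K}(\alpha,\beta)=$ the $E^*$-component of $[\alpha,\beta]_S$. Then $\mathcal{D}$ is a contravariant connection: $C^\infty(S)$-linear in $\alpha$, $\mathcal{D}_\alpha(f\eta)=f\mathcal{D}_\alpha\eta+(\psi^\natural\alpha)(f)\eta$.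 The infinitesimal Poisson algebra $\mathcal{P}=\mathcal{P}^\Sigma$ is the real vector space $C^\infty(S)\oplus\Gamma E^*$ with product $(f\oplus\eta)(g\oplus\xi)=fg\oplus(f\xi+g\eta)$ and bracket $\{f\oplus\eta,g\oplus\xi\}=\{f,g\}_\psi\oplus(\mathcal{D}_{df}\xi-\mathcal{D}_{dg}\eta+[\eta,\xi]_{\mathrm{fib}}+\mathcal{K}(df,dg))$ (it is isomorphic to $C^\infty(M)/I^2(S)$, $I(S)$ the vanishing ideal of $S$). $\mathscr{H}^1(\mathcal{P})=\mathrm{Poiss}(\mathcal{P})/\mathrm{Ham}(\mathcal{P})$, where $\mathrm{Poiss}(\mathcal{P})$ is the set of $\mathbb{R}$-linear derivations of both product and bracket and $\mathrm{Ham}(\mathcal{P})$ the set of derivations $\{\pi,\cdot\}$, $\pi\in\mathcal{P}$. $(E^*,[\,,\,]_{\mathrm{fib}})$ is a locally trivial bundle of Lie algebras; its typical fiber $\mathfrak{g}$ is the isotropy of $S$. $\Gamma^k$ is the space of $\mathbb{R}$-multilinear skew-symmetric maps $C^\infty(S)^k\to Z(\Gamma E^* )$ that are derivations in each argument ($Z(\Gamma E^* )$ the center of $(\Gamma E^*,[\,,\,]_{\mathrm{fib}})$, $\Gamma^0=Z(\Gamma E^* )$), with differential $(\partial_{\mathcal{D}}Q)(f_0,\dots,f_k)=\sum_i(-1)^i\mathcal{D}_{df_i}(Q(\dots,\widehat{f_i},\dots))+\sum_{i<j}(-1)^{i+j}Q(\{f_i,f_j\}_\psi,f_0,\dots,\widehat{f_i},\dots,\widehat{f_j},\dots,f_k)$;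 $\mathrm{H}^1_{\partial_{\mathcal{D}}}(\Gamma^*_{\mathcal{P}})$ is its first cohomology. $\mathrm{PDer}(E^*,[\,,\,]_{\mathrm{fib}})$ is the set of $\mathbb{R}$-linear $\mathscr{L}:\Gamma E^*\to\Gamma E^*$ for which there is a vector field $\ell$ on $S$ that is Poisson ($\ell\{f,g\}_\psi=\{\ell f,g\}_\psi+\{f,\ell g\}_\psi$) with $\mathscr{L}(f\eta)=f\mathscr{L}\eta+\ell(f)\eta$, and with $\mathscr{L}[\eta,\xi]_{\mathrm{fib}}=[\mathscr{L}\eta,\xi]_{\mathrm{fib}}+[\eta,\mathscr{L}\xi]_{\mathrm{fib}}$. Elements $\theta\in\mathfrak{X}(S)\otimes\Gamma E^*$ ($E^*$-valued vector fields) act as $\Gamma E^*$-valued derivations $f\mapsto\theta(f)$ of $C^\infty(S)$, and $(d_{\mathcal{D}}\theta)(f,g)=\mathcal{D}_{df}\theta(g)-\mathcal{D}_{dg}\theta(f)-\theta(\{f,g\}_\psi)$. *)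

theory Defs
  imports "HOL-Analysis.Analysis" "HOL-Library.Function_Algebras"
begin

section \<open>Real vector spaces, quotients, isomorphisms\<close>

text \<open>Functions into a real vector space form a real vector space; the additive structure (and the
  pointwise product of functions) is the one of \<^theory>\<open>HOL-Library.Function_Algebras\<close>.\<close>

instantiation "fun" :: (type, real_vector) real_vector
begin

definition scaleR_fun :: "real \<Rightarrow> ('a \<Rightarrow> 'b) \<Rightarrow> 'a \<Rightarrow> 'b" where
  "scaleR_fun r f = (\<lambda>x. r *\<^sub>R f x)"

instance
  by standard (auto simp: scaleR_fun_def fun_eq_iff scaleR_add_right scaleR_add_left)

end

text \<open>A linear map whose domain is a subspace \<open>V\<close> is represented by the unique function that
  extends it by \<open>0\<close> outside \<open>V\<close>. In this way tangent vectors, covectors, derivations, etc. are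
  determined by their values on \<open>V\<close>, and the sets of them are subspaces of a type of functions.\<close>

definition lin_on :: "'a::real_vector set \<Rightarrow> ('a \<Rightarrow> 'b::real_vector) \<Rightarrow> bool" where
  "lin_on V a \<longleftrightarrow>
     (\<forall>x\<in>V. \<forall>y\<in>V. a (x + y) = a x + a y) \<and>
     (\<forall>r. \<forall>x\<in>V. a (r *\<^sub>R x) = r *\<^sub>R a x) \<and>
     (\<forall>x. x \<notin> V \<longrightarrow> a x = 0)"

definition restr :: "'a set \<Rightarrow> ('a \<Rightarrow> 'b::zero) \<Rightarrow> 'a \<Rightarrow> 'b" where
  "restr V a = (\<lambda>x. if x \<in> V then a x else 0)"

record 'a rvs =
  rvs_carrier :: "'a set"
  rvs_add :: "'a \<Rightarrow> 'a \<Rightarrow> 'a"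
  rvs_scale :: "real \<Rightarrow> 'a \<Rightarrow> 'a"

text \<open>The quotient \<open>V / W\<close> of a subspace \<open>V\<close> by a subspace \<open>W\<close> of \<open>V\<close>. The summand \<open>w\<close> in the
  scalar multiplication only matters for \<open>r = 0\<close>.\<close>

definition quotient_rvs :: "'a::real_vector set \<Rightarrow> 'a set \<Rightarrow> 'a set rvs" where
  "quotient_rvs V W =
     \<lparr> rvs_carrier = {{v + w |w. w \<in> W} |v. v \<in> V},
       rvs_add = (\<lambda>X Y. {x + y |x y. x \<in> X \<and> y \<in> Y}),
       rvs_scale = (\<lambda>r X. {r *\<^sub>R x + w |x w. x \<in> X \<and> w \<in> W}) \<rparr>"

definition dsum_rvs :: "'a rvs \<Rightarrow> 'b rvs \<Rightarrow> ('a \<times> 'b) rvs" where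
  "dsum_rvs X Y =
     \<lparr> rvs_carrier = rvs_carrier X \<times> rvs_carrier Y,
       rvs_add = (\<lambda>p q. (rvs_add X (fst p) (fst q), rvs_add Y (snd p) (snd q))),
       rvs_scale = (\<lambda>r p. (rvs_scale X r (fst p), rvs_scale Y r (snd p))) \<rparr>"

definition rvs_isomorphic :: "'a rvs \<Rightarrow> 'b rvs \<Rightarrow> bool" where
  "rvs_isomorphic X Y \<longleftrightarrow>
     (\<exists>h. bij_betw h (rvs_carrier X) (rvs_carrier Y) \<and>
          (\<forall>x\<in>rvs_carrier X. \<forall>y\<in>rvs_carrier X. h (rvs_add X x y) = rvs_add Y (h x) (h y)) \<and>
          (\<forall>r. \<forall>x\<in>rvs_carrier X. h (rvs_scale X r x) = rvs_scale Y r (h x)))"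


section \<open>Smooth manifolds\<close>

text \<open>\<open>Ck_on k U f\<close>: \<open>f\<close> is of class \<open>C\<^sup>k\<close> on the open set \<open>U\<close>.\<close>

primrec Ck_on :: "nat \<Rightarrow> 'a::real_normed_vector set \<Rightarrow> ('a \<Rightarrow> 'b::real_normed_vector) \<Rightarrow> bool" where
  "Ck_on 0 U f \<longleftrightarrow> continuous_on U f"
| "Ck_on (Suc k) U f \<longleftrightarrow>
     (\<forall>x\<in>U. f differentiable (at x)) \<and> (\<forall>v. Ck_on k U (\<lambda>x. frechet_derivative f (at x) v))"

definition smooth_on :: "'a::real_normed_vector set \<Rightarrow> ('a \<Rightarrow> 'b::real_normed_vector) \<Rightarrow> bool" where
  "smooth_on U f \<longleftrightarrow> (\<forall>k. Ck_on k U f)"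

text \<open>The manifold \<open>M\<close> is the whole type \<open>'m\<close>, which is required to be Hausdorff and second
  countable; its smooth structure is given by an atlas of charts with values in \<open>'e\<close>, so that
  \<open>dim M = DIM('e)\<close>.\<close>

type_synonym ('m, 'e) chart = "'m set \<times> ('m \<Rightarrow> 'e)"
type_synonym ('m, 'e) atlas = "('m, 'e) chart set"

definition is_chart :: "('m::topological_space, 'e::euclidean_space) chart \<Rightarrow> bool" where
  "is_chart = (\<lambda>(U, \<phi>). open U \<and> open (\<phi> ` U) \<and> inj_on \<phi> U \<and>
                          homeomorphism U (\<phi> ` U) \<phi> (inv_into U \<phi>))"

definition compatible :: "('m::topological_space, 'e::euclidean_space) chart \<Rightarrow> ('m, 'e) chart \<Rightarrow> bool" where
  "compatible = (\<lambda>(U, \<phi>) (V, \<kappa>).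
     smooth_on (\<phi> ` (U \<inter> V)) (\<kappa> \<circ> inv_into U \<phi>) \<and> smooth_on (\<kappa> ` (U \<inter> V)) (\<phi> \<circ> inv_into V \<kappa>))"

definition smooth_atlas ::
  "('m::{t2_space, second_countable_topology}, 'e::euclidean_space) atlas \<Rightarrow> bool" where
  "smooth_atlas \<A> \<longleftrightarrow> (\<Union>(U, \<phi>)\<in>\<A>. U) = UNIV \<and> (\<forall>c\<in>\<A>. is_chart c) \<and> (\<forall>c\<in>\<A>. \<forall>d\<in>\<A>. compatible c d)"

text \<open>A tangent vector at \<open>p\<close> is a derivation at \<open>p\<close> of the algebra of smooth functions; covectors are
  linear functionals on the tangent space; covector fields are sections.\<close>

type_synonym 'm tvec = "('m \<Rightarrow> real) \<Rightarrow> real"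
type_synonym 'm covec = "'m tvec \<Rightarrow> real"
type_synonym 'm vfield = "'m \<Rightarrow> 'm tvec"
type_synonym 'm covfield = "'m \<Rightarrow> 'm covec"

context
  fixes \<A> :: "('m::{t2_space, second_countable_topology}, 'e::euclidean_space) atlas"
begin

definition maximal_atlas :: "('m, 'e) atlas" where
  "maximal_atlas = {c. is_chart c \<and> (\<forall>d\<in>\<A>. compatible c d)}"

definition global_smooth_funs :: "('m \<Rightarrow> real) set" where
  "global_smooth_funs = {F. \<forall>(U, \<phi>)\<in>\<A>. smooth_on (\<phi> ` U) (F \<circ> inv_into U \<phi>)}"

text \<open>Smooth functions on a subset \<open>N\<close> of \<open>M\<close> are those that locally extend to smooth functions on \<open>M\<close>;
  for an embedded submanifold \<open>N\<close> this is the algebra \<open>C\<^sup>\<infinity>(N)\<close> of its smooth structure, and for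
  \<open>N = UNIV\<close> it is \<open>C\<^sup>\<infinity>(M)\<close>. Functions on \<open>N\<close>, and all fields along \<open>N\<close> below, are extended by \<open>0\<close>.\<close>

definition Cinf :: "'m set \<Rightarrow> ('m \<Rightarrow> real) set" where
  "Cinf N = {f. (\<forall>p\<in>N. \<exists>U F. open U \<and> p \<in> U \<and> F \<in> global_smooth_funs \<and> (\<forall>q\<in>U \<inter> N. f q = F q)) \<and>
                (\<forall>q. q \<notin> N \<longrightarrow> f q = 0)}"

definition embedded_submanifold :: "nat \<Rightarrow> 'm set \<Rightarrow> bool" where
  "embedded_submanifold k N \<longleftrightarrow>
     (\<forall>p\<in>N. \<exists>U \<phi> W. (U, \<phi>) \<in> maximal_atlas \<and> p \<in> U \<and> subspace W \<and> dim W = k \<and>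
                     \<phi> ` (U \<inter> N) = \<phi> ` U \<inter> W)"

definition tangent :: "'m set \<Rightarrow> 'm \<Rightarrow> 'm tvec set" where
  "tangent N p = {v. lin_on (Cinf N) v \<and> (\<forall>f\<in>Cinf N. \<forall>g\<in>Cinf N. v (f * g) = f p * v g + g p * v f)}"

definition cotangent :: "'m set \<Rightarrow> 'm \<Rightarrow> 'm covec set" where
  "cotangent N p = {a. lin_on (tangent N p) a}"

definition differential :: "'m set \<Rightarrow> 'm \<Rightarrow> ('m \<Rightarrow> real) \<Rightarrow> 'm covec" where
  "differential N p f = restr (tangent N p) (\<lambda>v. v f)"

abbreviation TM :: "'m \<Rightarrow> 'm tvec set" where "TM \<equiv> tangent UNIV"
abbreviation TM_dual :: "'m \<Rightarrow> 'm covec set" where "TM_dual \<equiv> cotangent UNIV"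

text \<open>Smooth sections over \<open>N \<subseteq> M\<close> of the restrictions of \<open>TM\<close> and \<open>T\<^sup>*M\<close> to \<open>N\<close>.\<close>

definition vec_sections :: "'m set \<Rightarrow> 'm vfield set" where
  "vec_sections N = {V. (\<forall>p\<in>N. V p \<in> TM p) \<and> (\<forall>p. p \<notin> N \<longrightarrow> V p = 0) \<and>
                        (\<forall>F\<in>Cinf UNIV. (\<lambda>p. V p F) \<in> Cinf N)}"

definition covec_sections :: "'m set \<Rightarrow> 'm covfield set" where
  "covec_sections N = {\<alpha>. (\<forall>p\<in>N. \<alpha> p \<in> TM_dual p) \<and> (\<forall>p. p \<notin> N \<longrightarrow> \<alpha> p = 0) \<and>
                          (\<forall>V\<in>vec_sections UNIV. (\<lambda>p. \<alpha> p (V p)) \<in> Cinf N)}"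

text \<open>Vector fields on \<open>N\<close>, i.e. smooth sections of \<open>TN\<close>.\<close>

definition vector_fields :: "'m set \<Rightarrow> 'm vfield set" where
  "vector_fields N = {X. (\<forall>p\<in>N. X p \<in> tangent N p) \<and> (\<forall>p. p \<notin> N \<longrightarrow> X p = 0) \<and>
                         (\<forall>f\<in>Cinf N. (\<lambda>p. X p f) \<in> Cinf N)}"

definition vf_apply :: "'m vfield \<Rightarrow> ('m \<Rightarrow> real) \<Rightarrow> 'm \<Rightarrow> real" where
  "vf_apply X f = (\<lambda>p. X p f)"

text \<open>The differential of the inclusion \<open>N \<rightarrow> M\<close>, its image in \<open>TM\<close>, and the restriction of covectors.\<close>

definition push :: "'m set \<Rightarrow> 'm tvec \<Rightarrow> 'm tvec" where
  "push N w = restr (Cinf UNIV) (\<lambda>F. w (restr N F))"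

definition tangent_in_M :: "'m set \<Rightarrow> 'm \<Rightarrow> 'm tvec set" where
  "tangent_in_M N p = push N ` tangent N p"

definition covec_restr :: "'m set \<Rightarrow> 'm \<Rightarrow> 'm covec \<Rightarrow> 'm covec" where
  "covec_restr N p c = restr (tangent N p) (\<lambda>w. c (push N w))"

definition annihilator :: "'m \<Rightarrow> 'm tvec set \<Rightarrow> 'm covec set" where
  "annihilator p V = {a\<in>TM_dual p. \<forall>v\<in>V. a v = 0}"


section \<open>Poisson manifolds, the cotangent Lie algebroid, symplectic leaves\<close>

text \<open>A bivector at \<open>p\<close> is a skew-symmetric bilinear form on the cotangent space.\<close>

context
  fixes \<Psi> :: "'m \<Rightarrow> 'm covec \<Rightarrow> 'm covec \<Rightarrow> real"
begin

definition poisson_bracket :: "('m \<Rightarrow> real) \<Rightarrow> ('m \<Rightarrow> real) \<Rightarrow> 'm \<Rightarrow> real" where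
  "poisson_bracket F G = (\<lambda>p. \<Psi> p (differential UNIV p F) (differential UNIV p G))"

definition poisson_bivector :: bool where
  "poisson_bivector \<longleftrightarrow>
     (\<forall>p. lin_on (TM_dual p) (\<Psi> p) \<and> (\<forall>a\<in>TM_dual p. lin_on (TM_dual p) (\<Psi> p a)) \<and>
          (\<forall>a\<in>TM_dual p. \<forall>b\<in>TM_dual p. \<Psi> p a b = - \<Psi> p b a)) \<and>
     (\<forall>F\<in>Cinf UNIV. \<forall>G\<in>Cinf UNIV. poisson_bracket F G \<in> Cinf UNIV) \<and>
     (\<forall>F\<in>Cinf UNIV. \<forall>G\<in>Cinf UNIV. \<forall>H\<in>Cinf UNIV.
        poisson_bracket F (poisson_bracket G H) + poisson_bracket G (poisson_bracket H F) +
        poisson_bracket H (poisson_bracket F G) = 0)"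

text \<open>\<open>\<Psi>\<^sup>\<natural> : T\<^sup>*M \<rightarrow> TM\<close>, normalised so that \<open>\<Psi>\<^sup>\<natural>(dF) = {F, _}\<close>.\<close>

definition sharp :: "'m \<Rightarrow> 'm covec \<Rightarrow> 'm tvec" where
  "sharp p a = restr (Cinf UNIV) (\<lambda>F. \<Psi> p a (differential UNIV p F))"

definition sharp_field :: "'m covfield \<Rightarrow> 'm vfield" where
  "sharp_field \<alpha> = (\<lambda>p. sharp p (\<alpha> p))"

definition lie_bracket :: "'m vfield \<Rightarrow> 'm vfield \<Rightarrow> 'm vfield" where
  "lie_bracket X Y =
     (\<lambda>p. restr (Cinf UNIV) (\<lambda>F. X p (vf_apply Y F) - Y p (vf_apply X F)))"

text \<open>The bracket of the cotangent Lie algebroid,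
  \<open>[\<alpha>, \<beta>] = L\<^bsub>\<Psi>\<^sup>\<natural>\<alpha>\<^esub> \<beta> - L\<^bsub>\<Psi>\<^sup>\<natural>\<beta>\<^esub> \<alpha> - d(\<Psi>(\<alpha>, \<beta>))\<close>, where \<open>(L\<^bsub>X\<^esub> \<beta>)(V) = X(\<beta>(V)) - \<beta>([X, V])\<close>. It is
  the bracket with anchor \<open>\<Psi>\<^sup>\<natural>\<close> such that \<open>[dF, dG] = d{F, G}\<close>. The formula depends on the
  vector field \<open>V\<close> only through its value at \<open>p\<close>.\<close>

definition lie_derivative :: "'m vfield \<Rightarrow> 'm covfield \<Rightarrow> 'm vfield \<Rightarrow> 'm \<Rightarrow> real" where
  "lie_derivative X \<beta> V p = X p (\<lambda>q. \<beta> q (V q)) - \<beta> p (lie_bracket X V p)"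

definition cotangent_bracket :: "'m covfield \<Rightarrow> 'm covfield \<Rightarrow> 'm covfield" where
  "cotangent_bracket \<alpha> \<beta> = (\<lambda>p. restr (TM p) (\<lambda>v. THE r. \<forall>V\<in>vec_sections UNIV. V p = v \<longrightarrow>
     r = lie_derivative (sharp_field \<alpha>) \<beta> V p - lie_derivative (sharp_field \<beta>) \<alpha> V p
         - v (\<lambda>q. \<Psi> q (\<alpha> q) (\<beta> q))))"

text \<open>A curve on \<open>[0, T]\<close> is Hamiltonian for \<open>H\<close> if it is an integral curve of \<open>{H, _}\<close>. The symplectic leaf
  through \<open>p\<close> consists of the points that can be joined to \<open>p\<close> by a finite concatenation of such curves.\<close>

definition hamiltonian_curve :: "('m \<Rightarrow> real) \<Rightarrow> real \<Rightarrow> (real \<Rightarrow> 'm) \<Rightarrow> bool" where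
  "hamiltonian_curve H T \<gamma> \<longleftrightarrow> continuous_on {0..T} \<gamma> \<and>
     (\<forall>F\<in>Cinf UNIV. \<forall>t\<in>{0..T}.
        ((F \<circ> \<gamma>) has_real_derivative poisson_bracket H F (\<gamma> t)) (at t within {0..T}))"

definition hamiltonian_step :: "'m \<Rightarrow> 'm \<Rightarrow> bool" where
  "hamiltonian_step p q \<longleftrightarrow>
     (\<exists>H\<in>Cinf UNIV. \<exists>T\<ge>0. \<exists>\<gamma>. hamiltonian_curve H T \<gamma> \<and> \<gamma> 0 = p \<and> \<gamma> T = q)"

definition symplectic_leaf :: "'m set \<Rightarrow> bool" where
  "symplectic_leaf S \<longleftrightarrow> (\<exists>p. S = {q. hamiltonian_step\<^sup>*\<^sup>* p q})"

text \<open>The leaf \<open>S\<close> is embedded if its manifold structure (for which its tangent spaces are the images of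
  \<open>\<Psi>\<^sup>\<natural>\<close>) is that of an embedded submanifold of \<open>M\<close>.\<close>

definition embedded_symplectic_leaf :: "nat \<Rightarrow> 'm set \<Rightarrow> bool" where
  "embedded_symplectic_leaf k S \<longleftrightarrow> symplectic_leaf S \<and> embedded_submanifold k S \<and>
     (\<forall>p\<in>S. tangent_in_M S p = sharp p ` TM_dual p)"


section \<open>The Poisson triple of a leaf with a transversal\<close>

context
  fixes S :: "'m set"
begin

text \<open>The restriction \<open>[_, _]\<^sub>S\<close> of the cotangent Lie algebroid to \<open>T\<^sup>*\<^sub>SM\<close>, computed from arbitrary local
  extensions of sections over \<open>S\<close> to 1-forms on \<open>M\<close> (global extensions need not exist, as \<open>S\<close> need not
  be closed).\<close>

definition leaf_bracket :: "'m covfield \<Rightarrow> 'm covfield \<Rightarrow> 'm covfield" where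
  "leaf_bracket \<alpha> \<beta> = restr S (\<lambda>p. THE c.
     \<forall>\<alpha>'\<in>covec_sections UNIV. \<forall>\<beta>'\<in>covec_sections UNIV. \<forall>U.
       open U \<and> p \<in> U \<and> (\<forall>q\<in>U \<inter> S. \<alpha>' q = \<alpha> q \<and> \<beta>' q = \<beta> q) \<longrightarrow> c = cotangent_bracket \<alpha>' \<beta>' p)"

text \<open>The bivector \<open>\<psi>\<close> induced by \<open>\<Psi>\<close> on \<open>S\<close>, and its Poisson bracket on \<open>C\<^sup>\<infinity>(S)\<close>.\<close>

definition leaf_bivector :: "'m \<Rightarrow> 'm covec \<Rightarrow> 'm covec \<Rightarrow> real" where
  "leaf_bivector p a b = (THE r. \<forall>c\<in>TM_dual p. \<forall>e\<in>TM_dual p.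
     covec_restr S p c = a \<and> covec_restr S p e = b \<longrightarrow> r = \<Psi> p c e)"

definition leaf_poisson :: "('m \<Rightarrow> real) \<Rightarrow> ('m \<Rightarrow> real) \<Rightarrow> 'm \<Rightarrow> real" where
  "leaf_poisson f g = restr S (\<lambda>p. leaf_bivector p (differential S p f) (differential S p g))"

text \<open>\<open>E\<^sup>*\<close>, identified with the annihilator of \<open>TS\<close> in \<open>T\<^sup>*\<^sub>SM\<close>, and \<open>\<Gamma>E\<^sup>*\<close>.\<close>

definition conormal :: "'m \<Rightarrow> 'm covec set" where
  "conormal p = annihilator p (tangent_in_M S p)"

definition conormal_sections :: "'m covfield set" where
  "conormal_sections = {\<eta>\<in>covec_sections S. \<forall>p\<in>S. \<eta> p \<in> conormal p}"

definition fib_bracket :: "'m covfield \<Rightarrow> 'm covfield \<Rightarrow> 'm covfield" where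
  "fib_bracket \<eta> \<xi> = leaf_bracket \<eta> \<xi>"

definition center_sections :: "'m covfield set" where
  "center_sections = {\<eta>\<in>conormal_sections. \<forall>\<xi>\<in>conormal_sections. fib_bracket \<eta> \<xi> = 0}"

text \<open>The fibre \<open>E\<^sup>*\<^sub>p\<close> with the bracket induced by \<open>[_, _]\<^sub>f\<^sub>i\<^sub>b\<close> is the isotropy Lie algebra at \<open>p\<close>. As \<open>E\<^sup>*\<close> is
  locally trivial over the connected \<open>S\<close>, all these are isomorphic to the typical fibre.\<close>

definition isotropy_bracket :: "'m \<Rightarrow> 'm covec \<Rightarrow> 'm covec \<Rightarrow> 'm covec" where
  "isotropy_bracket p a b = (THE c. \<forall>\<eta>\<in>conormal_sections. \<forall>\<xi>\<in>conormal_sections.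
     \<eta> p = a \<and> \<xi> p = b \<longrightarrow> c = fib_bracket \<eta> \<xi> p)"

definition perfect_isotropy :: bool where
  "perfect_isotropy \<longleftrightarrow>
     (\<forall>p\<in>S. conormal p = span {isotropy_bracket p a b |a b. a \<in> conormal p \<and> b \<in> conormal p})"

definition smooth_scale :: "('m \<Rightarrow> real) \<Rightarrow> 'm covfield \<Rightarrow> 'm covfield" where
  "smooth_scale f \<eta> = (\<lambda>p. f p *\<^sub>R \<eta> p)"

text \<open>A transversal is a smooth subbundle \<open>\<Sigma>\<close> of \<open>T\<^sub>SM\<close> (given by local frames) with \<open>T\<^sub>SM = TS \<oplus> \<Sigma>\<close>.\<close>

definition transversal :: "('m \<Rightarrow> 'm tvec set) \<Rightarrow> bool" where
  "transversal \<Sigma> \<longleftrightarrow>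
     (\<forall>p\<in>S. subspace (\<Sigma> p) \<and> \<Sigma> p \<subseteq> TM p \<and> tangent_in_M S p \<inter> \<Sigma> p = {0} \<and>
            (\<forall>v\<in>TM p. \<exists>u\<in>tangent_in_M S p. \<exists>s\<in>\<Sigma> p. v = u + s)) \<and>
     (\<forall>p\<in>S. \<exists>U B. open U \<and> p \<in> U \<and> finite B \<and> B \<subseteq> vec_sections (U \<inter> S) \<and>
        (\<forall>q\<in>U \<inter> S. inj_on (\<lambda>\<sigma>. \<sigma> q) B \<and> independent ((\<lambda>\<sigma>. \<sigma> q) ` B) \<and>
                   span ((\<lambda>\<sigma>. \<sigma> q) ` B) = \<Sigma> q))"

context
  fixes \<Sigma> :: "'m \<Rightarrow> 'm tvec set"
begin

text \<open>\<open>df\<close> for \<open>f\<close> in \<open>C\<^sup>\<infinity>(S)\<close>, regarded as a section of \<open>\<Sigma>\<^sup>\<circ>\<close> via \<open>T\<^sup>*S \<cong> \<Sigma>\<^sup>\<circ>\<close>, and the \<open>E\<^sup>*\<close>-component of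
  a section of \<open>T\<^sup>*\<^sub>SM = \<Sigma>\<^sup>\<circ> \<oplus> E\<^sup>*\<close>.\<close>

definition d\<Sigma> :: "('m \<Rightarrow> real) \<Rightarrow> 'm covfield" where
  "d\<Sigma> f = restr S (\<lambda>p. THE c. c \<in> annihilator p (\<Sigma> p) \<and> covec_restr S p c = differential S p f)"

definition conormal_part :: "'m covfield \<Rightarrow> 'm covfield" where
  "conormal_part \<alpha> = restr S (\<lambda>p. THE c. c \<in> conormal p \<and> \<alpha> p - c \<in> annihilator p (\<Sigma> p))"

text \<open>In \<open>\<D>\<close> and \<open>\<K>\<close> the arguments \<open>\<alpha>\<close>, \<open>\<beta>\<close> are sections of \<open>\<Sigma>\<^sup>\<circ>\<close>.\<close>

definition \<D> :: "'m covfield \<Rightarrow> 'm covfield \<Rightarrow> 'm covfield" where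
  "\<D> \<alpha> \<eta> = conormal_part (leaf_bracket \<alpha> \<eta>)"

definition \<K> :: "'m covfield \<Rightarrow> 'm covfield \<Rightarrow> 'm covfield" where
  "\<K> \<alpha> \<beta> = conormal_part (leaf_bracket \<alpha> \<beta>)"


section \<open>The infinitesimal Poisson algebra and its first cohomology\<close>

definition P_carrier :: "(('m \<Rightarrow> real) \<times> 'm covfield) set" where
  "P_carrier = Cinf S \<times> conormal_sections"

definition P_mult ::
  "('m \<Rightarrow> real) \<times> 'm covfield \<Rightarrow> ('m \<Rightarrow> real) \<times> 'm covfield \<Rightarrow> ('m \<Rightarrow> real) \<times> 'm covfield" where
  "P_mult = (\<lambda>(f, \<eta>) (g, \<xi>). (f * g, smooth_scale f \<xi> + smooth_scale g \<eta>))"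

definition P_bracket ::
  "('m \<Rightarrow> real) \<times> 'm covfield \<Rightarrow> ('m \<Rightarrow> real) \<times> 'm covfield \<Rightarrow> ('m \<Rightarrow> real) \<times> 'm covfield" where
  "P_bracket = (\<lambda>(f, \<eta>) (g, \<xi>).
     (leaf_poisson f g, \<D> (d\<Sigma> f) \<xi> - \<D> (d\<Sigma> g) \<eta> + fib_bracket \<eta> \<xi> + \<K> (d\<Sigma> f) (d\<Sigma> g)))"

definition Poiss ::
  "(('m \<Rightarrow> real) \<times> 'm covfield \<Rightarrow> ('m \<Rightarrow> real) \<times> 'm covfield) set" where
  "Poiss = {X. lin_on P_carrier X \<and> (\<forall>x\<in>P_carrier. X x \<in> P_carrier) \<and>
     (\<forall>x\<in>P_carrier. \<forall>y\<in>P_carrier. X (P_mult x y) = P_mult (X x) y + P_mult x (X y)) \<and>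
     (\<forall>x\<in>P_carrier. \<forall>y\<in>P_carrier. X (P_bracket x y) = P_bracket (X x) y + P_bracket x (X y))}"

definition Ham ::
  "(('m \<Rightarrow> real) \<times> 'm covfield \<Rightarrow> ('m \<Rightarrow> real) \<times> 'm covfield) set" where
  "Ham = {restr P_carrier (P_bracket \<pi>) |\<pi>. \<pi> \<in> P_carrier}"

definition H1_P ::
  "(('m \<Rightarrow> real) \<times> 'm covfield \<Rightarrow> ('m \<Rightarrow> real) \<times> 'm covfield) set rvs" where
  "H1_P = quotient_rvs Poiss Ham"


section \<open>The complex of center-valued multiderivations\<close>

text \<open>A \<open>k\<close>-cochain is a function on lists of length \<open>k\<close> over \<open>C\<^sup>\<infinity>(S)\<close>, extended by \<open>0\<close> to all lists.\<close>

definition cochain_args :: "nat \<Rightarrow> ('m \<Rightarrow> real) list set" where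
  "cochain_args k = {fs. length fs = k \<and> set fs \<subseteq> Cinf S}"

definition cochains :: "nat \<Rightarrow> (('m \<Rightarrow> real) list \<Rightarrow> 'm covfield) set" where
  "cochains k = {Q.
     (\<forall>fs. fs \<notin> cochain_args k \<longrightarrow> Q fs = 0) \<and>
     (\<forall>fs\<in>cochain_args k. Q fs \<in> center_sections) \<and>
     (\<forall>fs\<in>cochain_args k. \<forall>i<k. lin_on (Cinf S) (\<lambda>g. Q (fs[i := g]))) \<and>
     (\<forall>fs\<in>cochain_args k. \<forall>i<k. \<forall>g\<in>Cinf S. \<forall>h\<in>Cinf S.
        Q (fs[i := g * h]) = smooth_scale g (Q (fs[i := h])) + smooth_scale h (Q (fs[i := g]))) \<and>
     (\<forall>fs\<in>cochain_args k. \<forall>i<k. \<forall>j<k. i \<noteq> j \<longrightarrow> Q (fs[i := fs ! j, j := fs ! i]) = - Q fs)}"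

text \<open>\<open>nths fs (- {i})\<close> is the list \<open>fs\<close> without its \<open>i\<close>-th entry.\<close>

definition cochain_diff ::
  "nat \<Rightarrow> (('m \<Rightarrow> real) list \<Rightarrow> 'm covfield) \<Rightarrow> ('m \<Rightarrow> real) list \<Rightarrow> 'm covfield" where
  "cochain_diff k Q = restr (cochain_args (Suc k)) (\<lambda>fs.
     (\<Sum>i\<le>k. (- 1) ^ i *\<^sub>R \<D> (d\<Sigma> (fs ! i)) (Q (nths fs (- {i})))) +
     (\<Sum>(i, j)\<in>{(i, j). i < j \<and> j \<le> k}.
        (- 1) ^ (i + j) *\<^sub>R Q (leaf_poisson (fs ! i) (fs ! j) # nths fs (- {i, j}))))"

definition H1_cochains :: "(('m \<Rightarrow> real) list \<Rightarrow> 'm covfield) set rvs" where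
  "H1_cochains = quotient_rvs {Q\<in>cochains 1. cochain_diff 1 Q = 0} (cochain_diff 0 ` cochains 0)"


section \<open>Derivations of the bundle of Lie algebras\<close>

text \<open>\<open>\<ell>\<close> is a Poisson vector field on \<open>S\<close>, and \<open>\<L>\<close> is a derivative endomorphism over \<open>\<ell>\<close>.\<close>

definition associated_field :: "('m covfield \<Rightarrow> 'm covfield) \<Rightarrow> 'm vfield \<Rightarrow> bool" where
  "associated_field \<L> l \<longleftrightarrow> l \<in> vector_fields S \<and>
     (\<forall>f\<in>Cinf S. \<forall>g\<in>Cinf S. vf_apply l (leaf_poisson f g) =
        leaf_poisson (vf_apply l f) g + leaf_poisson f (vf_apply l g)) \<and>
     (\<forall>f\<in>Cinf S. \<forall>\<eta>\<in>conormal_sections.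
        \<L> (smooth_scale f \<eta>) = smooth_scale f (\<L> \<eta>) + smooth_scale (vf_apply l f) \<eta>)"

definition PDer :: "('m covfield \<Rightarrow> 'm covfield) set" where
  "PDer = {\<L>. lin_on conormal_sections \<L> \<and> (\<forall>\<eta>\<in>conormal_sections. \<L> \<eta> \<in> conormal_sections) \<and>
     (\<exists>l. associated_field \<L> l) \<and>
     (\<forall>\<eta>\<in>conormal_sections. \<forall>\<xi>\<in>conormal_sections.
        \<L> (fib_bracket \<eta> \<xi>) = fib_bracket (\<L> \<eta>) \<xi> + fib_bracket \<eta> (\<L> \<xi>))}"

text \<open>\<open>E\<^sup>*\<close>-valued vector fields on \<open>S\<close>, i.e. smooth sections of \<open>TS \<otimes> E\<^sup>*\<close>: an element of \<open>T\<^sub>pS \<otimes> E\<^sup>*\<^sub>p\<close> is an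
  \<open>E\<^sup>*\<^sub>p\<close>-valued derivation at \<open>p\<close> of \<open>C\<^sup>\<infinity>(S)\<close>.\<close>

definition conormal_valued_fields :: "('m \<Rightarrow> ('m \<Rightarrow> real) \<Rightarrow> 'm covec) set" where
  "conormal_valued_fields = {\<theta>.
     (\<forall>p\<in>S. lin_on (Cinf S) (\<theta> p) \<and> (\<forall>f\<in>Cinf S. \<theta> p f \<in> conormal p) \<and>
        (\<forall>f\<in>Cinf S. \<forall>g\<in>Cinf S. \<theta> p (f * g) = f p *\<^sub>R \<theta> p g + g p *\<^sub>R \<theta> p f)) \<and>
     (\<forall>p. p \<notin> S \<longrightarrow> \<theta> p = 0) \<and>
     (\<forall>f\<in>Cinf S. (\<lambda>p. \<theta> p f) \<in> conormal_sections)}"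

definition cvf_apply ::
  "('m \<Rightarrow> ('m \<Rightarrow> real) \<Rightarrow> 'm covec) \<Rightarrow> ('m \<Rightarrow> real) \<Rightarrow> 'm covfield" where
  "cvf_apply \<theta> f = (\<lambda>p. \<theta> p f)"

definition d\<D> ::
  "('m \<Rightarrow> ('m \<Rightarrow> real) \<Rightarrow> 'm covec) \<Rightarrow> ('m \<Rightarrow> real) \<Rightarrow> ('m \<Rightarrow> real) \<Rightarrow> 'm covfield" where
  "d\<D> \<theta> f g = \<D> (d\<Sigma> f) (cvf_apply \<theta> g) - \<D> (d\<Sigma> g) (cvf_apply \<theta> f) - cvf_apply \<theta> (leaf_poisson f g)"

definition \<MM> :: "('m covfield \<Rightarrow> 'm covfield) set" where
  "\<MM> = {\<L>\<in>PDer. \<exists>l. associated_field \<L> l \<and>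
     (\<exists>\<theta>\<in>conormal_valued_fields. \<forall>f\<in>Cinf S. \<forall>g\<in>Cinf S.
        (\<forall>\<eta>\<in>conormal_sections.
           \<D> (d\<Sigma> f) (\<L> \<eta>) - \<L> (\<D> (d\<Sigma> f) \<eta>) + \<D> (d\<Sigma> (vf_apply l f)) \<eta> =
           fib_bracket (cvf_apply \<theta> f) \<eta>) \<and>
        \<L> (\<K> (d\<Sigma> f) (d\<Sigma> g)) - \<K> (d\<Sigma> (vf_apply l f)) (d\<Sigma> g) - \<K> (d\<Sigma> f) (d\<Sigma> (vf_apply l g)) =
        - d\<D> \<theta> f g)}"

definition \<C> :: "('m covfield \<Rightarrow> 'm covfield) set" where
  "\<C> = {restr conormal_sections (\<D> (d\<Sigma> f)) |f. f \<in> Cinf S}"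

end

definition Inn :: "('m covfield \<Rightarrow> 'm covfield) set" where
  "Inn = {restr conormal_sections (fib_bracket \<eta>) |\<eta>. \<eta> \<in> conormal_sections}"

end
end
end

end

theory Submission
  imports Defs
begin

text \<open>A Poisson derivation \<open>X\<close> of \<open>\<P> = C\<^sup>\<infinity>(S) \<oplus> \<Gamma>E\<^sup>*\<close> has the form \<open>X(f \<oplus> \<eta>) = \<ell>(f) \<oplus> (Q(f) + \<L>(\<eta>))\<close>: if \<open>h\<close>
  denotes the \<open>C\<^sup>\<infinity>(S)\<close>-component of \<open>X(0 \<oplus> \<eta>)\<close>, then \<open>2h\<eta> = 0\<close> because \<open>(0 \<oplus> \<eta>)\<^sup>2 = 0\<close>, hence
  \<open>h\<^sup>2 = 0\<close> as the \<open>C\<^sup>\<infinity>(S)\<close>-component of \<open>X(0 \<oplus> h\<eta>)\<close>. The remaining conditions on \<open>X\<close> say that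
  \<open>\<L> \<in> \<MM>\<close> with \<open>\<theta> = -Q\<close>. So \<open>X \<mapsto> \<L>\<close> maps \<open>Poiss\<close> onto \<open>\<MM>\<close> and \<open>Ham\<close> onto \<open>\<C> + Inn\<close>. As \<open>E\<^sup>*\<close> has positive
  rank, \<open>\<L> = 0\<close> forces \<open>\<ell> = 0\<close>, and \<open>X \<mapsto> Q\<close> identifies the kernel with the 1-cocycles; as \<open>\<psi>\<close> is
  nondegenerate, the Hamiltonian derivations in the kernel correspond to the coboundaries. The resulting
  exact sequence of real vector spaces splits.

  That \<open>\<P>\<close> is a Poisson algebra is reduced to the Jacobi and Leibniz identities on \<open>C\<^sup>\<infinity>(M)\<close>: near each point
  of \<open>S\<close>, every \<open>f \<oplus> \<eta>\<close> is represented by a function \<open>F\<close> on \<open>M\<close> with \<open>F = f\<close> and \<open>dF = df + \<eta>\<close> along \<open>S\<close>, and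
  representatives are compatible with products and brackets.\<close>

section \<open>Functions of class $C^k$\<close>

text \<open>The geometry is encoded algebraically: tangent vectors are derivations of the global
  functions on M, and the operations of the Poisson triple are definite descriptions. So two facts
  must be established before any algebra can start. Tangent spaces are spanned by coordinate
  derivations, which rests on Hadamard's lemma and bump functions; and the brackets do not depend on
  the chosen extensions, which is checked on differentials, where \<open>[dF, dG] = d{F, G}\<close>.
  All of this has to be local, since a section over a leaf that is not closed need not extend to M.
  A representative counts only through its first-order jet along S, so it may be corrected by
  functions vanishing on S. The corrections that make \<open>dF\<close> vanish on the transversal
  use functions dual to a local frame of \<Sigma>. The sign in \<theta> = -Q arises because the
  derivation law for a function f and a section reads L \<circ> D_f - D_f \<circ> L - D_{l(f)} =
  [Q(f), _], whereas \<open>\<MM>\<close> is defined with the opposite commutator. The final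
  splitting is only linear: it rests on complements of subspaces, not on a canonical lift.\<close>

lemma Ck_on_subset: "Ck_on k U f \<Longrightarrow> V \<subseteq> U \<Longrightarrow> Ck_on k V f"
  by (induction k arbitrary: f) (auto intro: continuous_on_subset)

text \<open>Openness is essential: derivatives are taken in the ambient space, so agreement on U
  must mean agreement near each of its points.\<close>

lemma Ck_on_cong:
  assumes "open U" "\<And>x. x \<in> U \<Longrightarrow> f x = g x" "Ck_on k U f"
  shows "Ck_on k U g"
  using assms(2,3)
proof (induction k arbitrary: f g)
  case 0
  then show ?case using continuous_on_eq[of U f g] by simp
next
  case (Suc k)
  have "g differentiable (at x)" if "x \<in> U" for x
    using Ck_on.simps(2)[THEN iffD1, OF Suc.prems(2)] that
      has_derivative_transform_within_open[OF _ assms(1) that Suc.prems(1)]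
    unfolding differentiable_def by meson
  moreover have "Ck_on k U (\<lambda>x. frechet_derivative g (at x) v)" for v
  proof (rule Suc.IH)
    show "Ck_on k U (\<lambda>x. frechet_derivative f (at x) v)"
      using Suc.prems by simp
    show "frechet_derivative f (at x) v = frechet_derivative g (at x) v" if "x \<in> U" for x
      using frechet_derivative_transform_within_open[OF _ assms(1) that Suc.prems(1)] Suc.prems that
      by simp
  qed
  ultimately show ?case by simp
qed

lemma Ck_on_local:
  assumes "\<And>x. x \<in> U \<Longrightarrow> \<exists>N. open N \<and> x \<in> N \<and> Ck_on k N f"
  shows "Ck_on k U f"
  using assms
proof (induction k arbitrary: f)
  case 0
  have "isCont f x" if "x \<in> U" for x
    using 0[OF that] continuous_on_eq_continuous_at by auto
  then show ?case by (simp add: continuous_at_imp_continuous_on)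
next
  case (Suc k)
  have "f differentiable (at x)" if "x \<in> U" for x
    using Suc.prems[OF that] by auto
  moreover have "Ck_on k U (\<lambda>x. frechet_derivative f (at x) v)" for v
  proof (rule Suc.IH)
    fix x assume "x \<in> U"
    then obtain N where "open N" "x \<in> N" "Ck_on (Suc k) N f" using Suc.prems by blast
    then show "\<exists>N. open N \<and> x \<in> N \<and> Ck_on k N (\<lambda>x. frechet_derivative f (at x) v)"
      by (auto intro!: exI[of _ N])
  qed
  ultimately show ?case by simp
qed

text \<open>Replaces the choice operator \<open>frechet_derivative\<close> by a derivative known in
  closed form, on which one order less is then checked.\<close>

lemma Ck_on_SucI:
  assumes "open U" "\<And>x. x \<in> U \<Longrightarrow> (f has_derivative D x) (at x)" "\<And>v. Ck_on k U (\<lambda>x. D x v)"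
  shows "Ck_on (Suc k) U f"
proof -
  have "Ck_on k U (\<lambda>x. frechet_derivative f (at x) v)" for v
    by (rule Ck_on_cong[OF assms(1) _ assms(3)[of v]]) (simp add: frechet_derivative_at[OF assms(2), symmetric])
  then show ?thesis using assms(2) by (auto simp: differentiable_def)
qed

lemma Ck_on_Suc_derivative:
  assumes "Ck_on (Suc k) U f" "x \<in> U"
  shows "(f has_derivative frechet_derivative f (at x)) (at x)"
  using assms frechet_derivative_works by auto

lemma Ck_on_Suc_frechet_derivative:
  "Ck_on (Suc k) U f \<Longrightarrow> Ck_on k U (\<lambda>x. frechet_derivative f (at x) v)"
  by simp

lemma Ck_on_SucD: "Ck_on (Suc k) U f \<Longrightarrow> Ck_on k U f"
proof (induction k arbitrary: f)
  case 0
  then show ?case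
    by (auto intro!: continuous_at_imp_continuous_on differentiable_imp_continuous_within)
next
  case (Suc k)
  have "Ck_on k U (\<lambda>x. frechet_derivative f (at x) v)" for v
    by (rule Suc.IH[OF Ck_on_Suc_frechet_derivative[OF Suc.prems]])
  then show ?case using Suc.prems by simp
qed

lemma Ck_on_const: "open U \<Longrightarrow> Ck_on k U (\<lambda>x. c)"
proof (induction k arbitrary: c)
  case (Suc k)
  show ?case by (rule Ck_on_SucI[OF Suc.prems has_derivative_const Suc.IH[OF Suc.prems]])
qed simp

lemma Ck_on_linear:
  assumes "open U" "bounded_linear L"
  shows "Ck_on k U L"
proof (cases k)
  case 0
  then show ?thesis using assms(2) by (simp add: linear_continuous_on)
next
  case (Suc n)
  have "Ck_on (Suc n) U L"
    by (rule Ck_on_SucI[OF assms(1) bounded_linear_imp_has_derivative[OF assms(2)] Ck_on_const[OF assms(1)]])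
  then show ?thesis using Suc by simp
qed

lemma Ck_on_linear_comp:
  assumes "open U" "bounded_linear L" "Ck_on k U f"
  shows "Ck_on k U (\<lambda>x. L (f x))"
  using assms(3)
proof (induction k arbitrary: f)
  case 0
  then show ?case using bounded_linear.continuous_on[OF assms(2)] by simp
next
  case (Suc k)
  show ?case
  proof (rule Ck_on_SucI[OF assms(1)])
    show "((\<lambda>x. L (f x)) has_derivative (\<lambda>v. L (frechet_derivative f (at x) v))) (at x)" if "x \<in> U" for x
      by (rule bounded_linear.has_derivative[OF assms(2) Ck_on_Suc_derivative[OF Suc.prems that]])
    show "Ck_on k U (\<lambda>x. L (frechet_derivative f (at x) v))" for v
      by (rule Suc.IH[OF Ck_on_Suc_frechet_derivative[OF Suc.prems]])
  qed
qed

lemma Ck_on_add: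
  assumes "open U" "Ck_on k U f" "Ck_on k U g"
  shows "Ck_on k U (\<lambda>x. f x + g x)"
  using assms(2,3)
proof (induction k arbitrary: f g)
  case 0
  then show ?case by (auto intro!: continuous_intros)
next
  case (Suc k)
  show ?case
  proof (rule Ck_on_SucI[OF assms(1)])
    show "((\<lambda>x. f x + g x) has_derivative
        (\<lambda>v. frechet_derivative f (at x) v + frechet_derivative g (at x) v)) (at x)" if "x \<in> U" for x
      by (rule has_derivative_add[OF Suc.prems[THEN Ck_on_Suc_derivative, OF that]])
    show "Ck_on k U (\<lambda>x. frechet_derivative f (at x) v + frechet_derivative g (at x) v)" for v
      by (rule Suc.IH[OF Suc.prems[THEN Ck_on_Suc_frechet_derivative]])
  qed
qed

lemma Ck_on_mult:
  fixes f g :: "'a::real_normed_vector \<Rightarrow> real"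
  assumes "open U" "Ck_on k U f" "Ck_on k U g"
  shows "Ck_on k U (\<lambda>x. f x * g x)"
  using assms(2,3)
proof (induction k arbitrary: f g)
  case 0
  then show ?case by (auto intro!: continuous_intros)
next
  case (Suc k)
  show ?case
  proof (rule Ck_on_SucI[OF assms(1)])
    show "((\<lambda>x. f x * g x) has_derivative
        (\<lambda>v. f x * frechet_derivative g (at x) v + frechet_derivative f (at x) v * g x)) (at x)" if "x \<in> U" for x
      by (rule has_derivative_mult[OF Suc.prems[THEN Ck_on_Suc_derivative, OF that]])
    show "Ck_on k U (\<lambda>x. f x * frechet_derivative g (at x) v + frechet_derivative f (at x) v * g x)" for v
      using Suc.IH[OF Ck_on_SucD[OF Suc.prems(1)] Ck_on_Suc_frechet_derivative[OF Suc.prems(2)]]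
        Suc.IH[OF Ck_on_Suc_frechet_derivative[OF Suc.prems(1)] Ck_on_SucD[OF Suc.prems(2)]]
      by (rule Ck_on_add[OF assms(1)])
  qed
qed

lemma Ck_on_sum:
  assumes "open U" "\<And>i. i \<in> I \<Longrightarrow> Ck_on k U (f i)"
  shows "Ck_on k U (\<lambda>x. \<Sum>i\<in>I. f i x)"
  using assms(2)
proof (induction I rule: infinite_finite_induct)
  case (insert i I)
  then have "Ck_on k U (f i)" "Ck_on k U (\<lambda>x. \<Sum>i\<in>I. f i x)" by auto
  from Ck_on_add[OF assms(1) this] show ?case using insert.hyps by simp
qed (simp_all add: Ck_on_const assms(1))

text \<open>The derivative is a product of 1/f, of class C^k by induction, and a derivative of f;
  hence 1/f gains one order.\<close>

lemma Ck_on_inverse: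
  fixes f :: "'a::real_normed_vector \<Rightarrow> real"
  assumes "open U" "Ck_on k U f" "\<And>x. x \<in> U \<Longrightarrow> f x \<noteq> 0"
  shows "Ck_on k U (\<lambda>x. inverse (f x))"
  using assms(2)
proof (induction k)
  case 0
  then show ?case using assms(3) by (auto intro!: continuous_intros)
next
  case (Suc k)
  have IH: "Ck_on k U (\<lambda>x. inverse (f x))" by (rule Suc.IH[OF Ck_on_SucD[OF Suc.prems]])
  show ?case
  proof (rule Ck_on_SucI[OF assms(1)])
    show "((\<lambda>x. inverse (f x)) has_derivative
        (\<lambda>v. - 1 * (inverse (f x) * frechet_derivative f (at x) v * inverse (f x)))) (at x)" if "x \<in> U" for x
      using Deriv.has_derivative_inverse[OF assms(3)[OF that] Ck_on_Suc_derivative[OF Suc.prems that]] by simp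
    show "Ck_on k U (\<lambda>x. - 1 * (inverse (f x) * frechet_derivative f (at x) v * inverse (f x)))" for v
      by (intro Ck_on_mult Ck_on_const assms(1) IH Ck_on_Suc_frechet_derivative Suc.prems)
  qed
qed

text \<open>The chain rule is expanded over the basis of the middle space. The derivative becomes a
  finite sum of scalar products, and the induction hypothesis is applied to the partial derivatives
  of g; so g varies in the induction while f is fixed.\<close>

lemma Ck_on_compose:
  fixes f :: "'a::real_normed_vector \<Rightarrow> 'b::euclidean_space" and g :: "'b \<Rightarrow> real"
  assumes "open U" "open V" "f ` U \<subseteq> V" "Ck_on k U f" "Ck_on k V g"
  shows "Ck_on k U (\<lambda>x. g (f x))"
  using assms(4,5)
proof (induction k arbitrary: g)
  case 0
  then show ?case using assms(3) by (auto intro: continuous_on_compose2)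
next
  case (Suc k)
  have f: "Ck_on k U f" by (rule Ck_on_SucD[OF Suc.prems(1)])
  let ?D = "\<lambda>x v. \<Sum>b\<in>Basis. (frechet_derivative f (at x) v \<bullet> b) * frechet_derivative g (at (f x)) b"
  show ?case
  proof (rule Ck_on_SucI[OF assms(1), where D = ?D])
    fix x assume x: "x \<in> U"
    have g: "(g has_derivative frechet_derivative g (at (f x))) (at (f x))"
      using Ck_on_Suc_derivative[OF Suc.prems(2)] x assms(3) by blast
    have "((\<lambda>x. g (f x)) has_derivative (\<lambda>v. frechet_derivative g (at (f x)) (frechet_derivative f (at x) v))) (at x)"
      using has_derivative_compose[OF Ck_on_Suc_derivative[OF Suc.prems(1) x] g] .
    moreover have "frechet_derivative g (at (f x)) w = (\<Sum>b\<in>Basis. (w \<bullet> b) * frechet_derivative g (at (f x)) b)" for w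
      using Linear_Algebra.linear_componentwise[OF has_derivative_linear[OF g], of w 1]
      by simp
    ultimately show "((\<lambda>x. g (f x)) has_derivative ?D x) (at x)"
      by (rule has_derivative_eq_rhs[OF _ ext])
  next
    fix v
    have "Ck_on k U (\<lambda>x. frechet_derivative g (at (f x)) b)" for b
      by (rule Suc.IH[OF f Ck_on_Suc_frechet_derivative[OF Suc.prems(2)]])
    moreover have "Ck_on k U (\<lambda>x. frechet_derivative f (at x) v \<bullet> b)" for b
      by (rule Ck_on_linear_comp[OF assms(1) bounded_linear_inner_left Ck_on_Suc_frechet_derivative[OF Suc.prems(1)]])
    ultimately show "Ck_on k U (\<lambda>x. ?D x v)"
      by (intro Ck_on_sum[OF assms(1)] Ck_on_mult[OF assms(1)])
  qed
qed

lemma smooth_on_subset: "smooth_on U f \<Longrightarrow> V \<subseteq> U \<Longrightarrow> smooth_on V f"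
  by (meson Ck_on_subset smooth_on_def)

lemma smooth_on_cong: "open U \<Longrightarrow> (\<And>x. x \<in> U \<Longrightarrow> f x = g x) \<Longrightarrow> smooth_on U f \<Longrightarrow> smooth_on U g"
  unfolding smooth_on_def using Ck_on_cong by blast

lemma smooth_on_local:
  "(\<And>x. x \<in> U \<Longrightarrow> \<exists>N. open N \<and> x \<in> N \<and> smooth_on N f) \<Longrightarrow> smooth_on U f"
  unfolding smooth_on_def by (meson Ck_on_local)

lemma smooth_on_const: "open U \<Longrightarrow> smooth_on U (\<lambda>x. c)"
  unfolding smooth_on_def by (simp only: Ck_on_const simp_thms)

lemma smooth_on_linear: "open U \<Longrightarrow> bounded_linear L \<Longrightarrow> smooth_on U L"
  unfolding smooth_on_def by (simp only: Ck_on_linear simp_thms)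

lemma smooth_on_add: "open U \<Longrightarrow> smooth_on U f \<Longrightarrow> smooth_on U g \<Longrightarrow> smooth_on U (\<lambda>x. f x + g x)"
  unfolding smooth_on_def by (simp only: Ck_on_add simp_thms)

lemma smooth_on_mult:
  fixes f g :: "'a::real_normed_vector \<Rightarrow> real"
  shows "open U \<Longrightarrow> smooth_on U f \<Longrightarrow> smooth_on U g \<Longrightarrow> smooth_on U (\<lambda>x. f x * g x)"
  unfolding smooth_on_def by (simp only: Ck_on_mult simp_thms)

lemma smooth_on_inverse:
  fixes f :: "'a::real_normed_vector \<Rightarrow> real"
  shows "open U \<Longrightarrow> smooth_on U f \<Longrightarrow> (\<And>x. x \<in> U \<Longrightarrow> f x \<noteq> 0) \<Longrightarrow> smooth_on U (\<lambda>x. inverse (f x))"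
  unfolding smooth_on_def using Ck_on_inverse[of U _ f] by blast

lemma smooth_on_sum:
  "open U \<Longrightarrow> (\<And>i. i \<in> I \<Longrightarrow> smooth_on U (f i)) \<Longrightarrow> smooth_on U (\<lambda>x. \<Sum>i\<in>I. f i x)"
  unfolding smooth_on_def using Ck_on_sum[of U I _ f] by blast

lemma smooth_on_compose:
  fixes f :: "'a::real_normed_vector \<Rightarrow> 'b::euclidean_space" and g :: "'b \<Rightarrow> real"
  assumes "open U" "open V" "f ` U \<subseteq> V" "smooth_on U f" "smooth_on V g"
  shows "smooth_on U (\<lambda>x. g (f x))"
  using Ck_on_compose[OF assms(1-3)] assms(4,5) unfolding smooth_on_def by blast

lemma smooth_on_has_derivative:
  "smooth_on U f \<Longrightarrow> x \<in> U \<Longrightarrow> (f has_derivative frechet_derivative f (at x)) (at x)"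
  unfolding smooth_on_def using Ck_on_Suc_derivative[of _ U f x] by blast

lemma smooth_on_frechet_derivative: "smooth_on U f \<Longrightarrow> smooth_on U (\<lambda>x. frechet_derivative f (at x) v)"
  unfolding smooth_on_def using Ck_on_Suc_frechet_derivative by blast

lemma smooth_on_imp_continuous_on: "smooth_on U f \<Longrightarrow> continuous_on U f"
  unfolding smooth_on_def by (metis Ck_on.simps(1))


subsection \<open>Bump functions\<close>

text \<open>The functions t^(-m) exp(-1/t), extended by 0. The derivative of each is a linear
  combination of two others, so a single induction over all m proves smoothness of
  exp(-1/t).\<close>

definition flat_exp :: "nat \<Rightarrow> real \<Rightarrow> real" where
  "flat_exp m t = (if t > 0 then inverse t ^ m * exp (- inverse t) else 0)"

lemma flat_exp_tendsto_0: "(flat_exp m \<longlongrightarrow> 0) (at 0)"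
proof -
  have "((\<lambda>t::real. inverse t ^ m * exp (- inverse t)) \<longlongrightarrow> 0) (at_right 0)"
    using filterlim_compose[OF tendsto_power_div_exp_0 filterlim_inverse_at_top_right]
    by (simp add: exp_minus divide_inverse)
  then have "(flat_exp m \<longlongrightarrow> 0) (at_right 0)"
    by (rule Lim_transform_eventually) (use eventually_at_right_less[of 0] in \<open>rule eventually_mono; simp add: flat_exp_def\<close>)
  moreover have "(flat_exp m \<longlongrightarrow> 0) (at_left 0)"
    by (rule Lim_transform_eventually[OF tendsto_const])
      (auto simp: flat_exp_def eventually_at_filter)
  ultimately show ?thesis by (simp add: filterlim_at_split)
qed

lemma flat_exp_derivative:
  "(flat_exp m has_real_derivative flat_exp (m + 2) t - m * flat_exp (m + 1) t) (at t)"
proof -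
  consider "t > 0" | "t < 0" | "t = 0" by linarith
  then show ?thesis
  proof cases
    case 1
    have "((\<lambda>t. inverse t ^ m * exp (- inverse t)) has_real_derivative
        flat_exp (m + 2) t - m * flat_exp (m + 1) t) (at t)"
      using 1 by (auto intro!: derivative_eq_intros simp: flat_exp_def)
        (cases m; simp add: field_simps power2_eq_square)
    then show ?thesis
      by (rule has_field_derivative_transform_within_open[of _ _ _ "{0<..}"]) (use 1 in \<open>auto simp: flat_exp_def\<close>)
  next
    case 2
    have "((\<lambda>t. 0) has_real_derivative flat_exp (m + 2) t - m * flat_exp (m + 1) t) (at t)"
      using 2 by (auto simp: flat_exp_def)
    then show ?thesis
      by (rule has_field_derivative_transform_within_open[of _ _ _ "{..<0}"]) (use 2 in \<open>auto simp: flat_exp_def\<close>)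
  next
    case 3
    \<comment> \<open>At 0 the difference quotient is the next member of the family, which tends to
      0; the claimed derivative is 0 there as well.\<close>
    have "((\<lambda>y. (flat_exp m y - flat_exp m 0) / (y - 0)) \<longlongrightarrow> 0) (at 0)"
      by (rule Lim_transform_eventually[OF flat_exp_tendsto_0[of "Suc m"]])
        (auto simp: flat_exp_def field_simps eventually_at_filter)
    then show ?thesis using 3 by (simp add: has_field_derivative_iff flat_exp_def)
  qed
qed

lemma smooth_on_flat_exp: "smooth_on UNIV (flat_exp m)"
proof -
  have "Ck_on k UNIV (flat_exp m)" for k
  proof (induction k arbitrary: m)
    case 0
    have "isCont (flat_exp m) t" for t
      using flat_exp_derivative DERIV_isCont by blast
    then show ?case by (simp add: continuous_at_imp_continuous_on)
  next
    case (Suc k)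
    show ?case
    proof (rule Ck_on_SucI)
      show "(flat_exp m has_derivative (\<lambda>v. v * (flat_exp (m + 2) t + - m * flat_exp (m + 1) t))) (at t)" for t
        using flat_exp_derivative[of m t] by (simp add: has_field_derivative_def mult_commute_abs)
      show "Ck_on k UNIV (\<lambda>t. v * (flat_exp (m + 2) t + - m * flat_exp (m + 1) t))" for v :: real
        by (intro Ck_on_mult Ck_on_add Ck_on_const Suc) auto
    qed simp
  qed
  then show ?thesis by (simp add: smooth_on_def)
qed

lemma smooth_step_exists:
  obtains h :: "real \<Rightarrow> real" where "smooth_on UNIV h" "\<And>t. t \<le> 1/2 \<Longrightarrow> h t = 1" "\<And>t. t \<ge> 1 \<Longrightarrow> h t = 0"
proof -
  let ?e = "flat_exp 0"
  \<comment> \<open>For each t at least one of 1 - t and t - 1/2 is positive, so the denominator of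
    the step function never vanishes.\<close>
  have pos: "?e (1 - t) + ?e (t - 1/2) \<noteq> 0" for t :: real
    by (auto simp: flat_exp_def add_nonneg_eq_0_iff intro!: add_pos_pos less_imp_neq[THEN not_sym])
  have "smooth_on UNIV (\<lambda>t. ?e (c + d * t))" for c d :: real
    by (rule smooth_on_compose[OF _ _ _ _ smooth_on_flat_exp])
      (simp_all add: smooth_on_add smooth_on_const smooth_on_linear bounded_linear_mult_right)
  from this[of 1 "-1"] this[of "-1/2" 1]
  have s: "smooth_on UNIV (\<lambda>t. ?e (1 - t))" "smooth_on UNIV (\<lambda>t. ?e (t - 1/2))"
    by (simp_all add: add.commute)
  show thesis
  proof (rule that)
    show "smooth_on UNIV (\<lambda>t. ?e (1 - t) * inverse (?e (1 - t) + ?e (t - 1/2)))"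
      by (intro smooth_on_mult smooth_on_inverse smooth_on_add s open_UNIV pos)
  qed (auto simp: flat_exp_def)
qed

lemma bump_exists:
  fixes c :: "'a::euclidean_space"
  assumes "r > 0"
  obtains h :: "'a \<Rightarrow> real" and s where "smooth_on UNIV h" "0 < s" "\<And>x. dist c x < s \<Longrightarrow> h x = 1"
    "\<And>x. dist c x \<ge> r \<Longrightarrow> h x = 0"
proof -
  obtain h :: "real \<Rightarrow> real" where h: "smooth_on UNIV h" "\<And>t. t \<le> 1/2 \<Longrightarrow> h t = 1" "\<And>t. t \<ge> 1 \<Longrightarrow> h t = (0::real)"
    by (rule smooth_step_exists) (rule that)
  \<comment> \<open>The squared distance replaces the norm, which is not smooth at c; written in
    coordinates it is a sum of products.\<close>
  let ?n = "\<lambda>x. (\<Sum>b\<in>Basis. (x \<bullet> b + - (c \<bullet> b)) * (x \<bullet> b + - (c \<bullet> b))) * inverse (r^2)"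
  have n: "?n x = (dist c x / r)^2" for x
  proof -
    have "(\<Sum>b\<in>Basis. (x \<bullet> b + - (c \<bullet> b)) * (x \<bullet> b + - (c \<bullet> b))) = (x - c) \<bullet> (x - c)"
      by (subst euclidean_inner) (simp add: inner_diff_left)
    also have "\<dots> = (dist c x)^2"
      by (simp add: dist_norm norm_minus_commute[of c x] power2_norm_eq_inner)
    finally show ?thesis by (simp add: power_mult_distrib power_inverse divide_inverse)
  qed
  have "smooth_on UNIV (\<lambda>x. x \<bullet> b + - (c \<bullet> b))" for b :: 'a
  proof -
    have "smooth_on UNIV (\<lambda>x. x \<bullet> b)" "smooth_on UNIV (\<lambda>x::'a. - (c \<bullet> b))"
      by (simp_all add: smooth_on_linear smooth_on_const bounded_linear_inner_left)
    then show ?thesis by (rule smooth_on_add[OF open_UNIV])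
  qed
  then have "smooth_on UNIV ?n"
    by (intro smooth_on_mult[OF open_UNIV] smooth_on_sum[OF open_UNIV] smooth_on_const[OF open_UNIV])
  then have "smooth_on UNIV (\<lambda>x. h (?n x))"
    by (rule smooth_on_compose[OF open_UNIV open_UNIV subset_UNIV _ h(1)])
  then have 1: "smooth_on UNIV (\<lambda>x. h ((dist c x / r)^2))"
    by (simp only: n)
  show thesis
  \<comment> \<open>Within distance r/2 the argument of h is at most 1/4, below the threshold 1/2;
    from distance r on it is at least 1.\<close>
  proof (rule that[OF 1, of "r/2"])
    fix x assume "dist c x < r/2"
    then have "dist c x / r \<le> 1/2" using assms by (simp add: field_simps)
    then have "(dist c x / r)^2 \<le> (1/2)^2" using assms by (intro power_mono) auto
    also have "\<dots> \<le> 1/2" by (simp add: power2_eq_square)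
    finally show "h ((dist c x / r)^2) = 1" by (rule h(2))
  next
    fix x assume "dist c x \<ge> r"
    then have "1 \<le> dist c x / r" using assms by simp
    then have "1 \<le> (dist c x / r)^2" by (rule one_le_power)
    then show "h ((dist c x / r)^2) = 0" by (rule h(3))
  qed (use assms in auto)
qed


subsection \<open>Hadamard's lemma\<close>

text \<open>Differentiation under the integral sign in direction v replaces G by its derivative
  along v and the weight t^m by t^(m+1). The weight is carried along to close the induction;
  Hadamard's lemma takes m = 0.\<close>

lemma Ck_on_integral:
  fixes G :: "'a::euclidean_space \<Rightarrow> real"
  assumes "smooth_on (ball c r) G" "y0 \<in> ball c r"
  shows "Ck_on k (ball c r) (\<lambda>y. integral {0..1} (\<lambda>t. t ^ m * G (y0 + t *\<^sub>R (y - y0))))"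
  using assms(1)
proof (induction k arbitrary: G m)
  have seg: "y0 + t *\<^sub>R (y - y0) \<in> ball c r" if "y \<in> ball c r" "t \<in> {0..1}" for y t
    using convexD[OF convex_ball assms(2) that(1), of "1 - t" t] that(2) by (simp add: algebra_simps)
  have cont: "continuous_on (ball c r \<times> {0..1}) (\<lambda>(y, t). t ^ m * H (y0 + t *\<^sub>R (y - y0)))"
    if "smooth_on (ball c r) H" for H :: "'a \<Rightarrow> real" and m
    unfolding split_beta
    by (intro continuous_intros continuous_on_compose2[OF smooth_on_imp_continuous_on[OF that]])
      (use seg in auto)
  {
    case 0
    then show ?case
      using integral_continuous_on_param[of "ball c r" "0::real" 1 "\<lambda>y t. t ^ m * G (y0 + t *\<^sub>R (y - y0))"]
        cont[OF 0] by simp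
  next
    case (Suc k)
    let ?D = "\<lambda>y v. integral {0..1} (\<lambda>t. t ^ Suc m * frechet_derivative G (at (y0 + t *\<^sub>R (y - y0))) v)"
    \<comment> \<open>The Leibniz rule requires the derivative as a continuous family of bounded
      linear maps; its continuity is tested on basis vectors.\<close>
    let ?B = "\<lambda>y t. Blinfun (\<lambda>v. t ^ Suc m * frechet_derivative G (at (y0 + t *\<^sub>R (y - y0))) v)"
    have dG: "(G has_derivative frechet_derivative G (at y)) (at y)" if "y \<in> ball c r" for y
      using smooth_on_has_derivative[OF Suc.prems that] .
    have B: "blinfun_apply (?B y t) = (\<lambda>v. t ^ Suc m * frechet_derivative G (at (y0 + t *\<^sub>R (y - y0))) v)"
      if "y \<in> ball c r" "t \<in> {0..1}" for y t
      by (rule bounded_linear_Blinfun_apply)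
        (intro bounded_linear_mult_right[THEN bounded_linear_compose] has_derivative_bounded_linear[OF dG] seg that)
    have contB: "continuous_on (ball c r \<times> {0..1}) (\<lambda>(y, t). ?B y t)"
      unfolding split_beta
    proof (rule continuous_on_blinfun_componentwise)
      fix i :: 'a
      have "continuous_on (ball c r \<times> {0..1})
          (\<lambda>(y, t). t ^ Suc m * frechet_derivative G (at (y0 + t *\<^sub>R (y - y0))) i)"
        by (rule cont[OF smooth_on_frechet_derivative[OF Suc.prems]])
      then show "continuous_on (ball c r \<times> {0..1}) (\<lambda>x. blinfun_apply (?B (fst x) (snd x)) i)"
        unfolding split_beta by (rule continuous_on_eq) (auto simp: B simp del: power_Suc)
    qed
    show ?case
    proof (rule Ck_on_SucI[where D = ?D])
      fix y assume y: "y \<in> ball c r"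
      have "((\<lambda>y. integral (cbox 0 1) (\<lambda>t. t ^ m * G (y0 + t *\<^sub>R (y - y0)))) has_derivative
          integral (cbox 0 1) (?B y)) (at y within ball c r)"
      proof (rule leibniz_rule[OF _ _ _ y convex_ball])
        fix z t assume z: "z \<in> ball c r" "t \<in> cbox 0 (1::real)"
        have "((\<lambda>z. t ^ m * G (y0 + t *\<^sub>R (z - y0))) has_derivative
            (\<lambda>v. t ^ m * frechet_derivative G (at (y0 + t *\<^sub>R (z - y0))) (t *\<^sub>R v))) (at z within ball c r)"
          by (rule has_derivative_mult_right, rule has_derivative_compose[OF _ dG])
            (use seg z in \<open>auto intro!: derivative_eq_intros\<close>)
        moreover have "linear (frechet_derivative G (at (y0 + t *\<^sub>R (z - y0))))"
          using has_derivative_linear[OF dG] seg z by simp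
        ultimately show "((\<lambda>z. t ^ m * G (y0 + t *\<^sub>R (z - y0))) has_derivative blinfun_apply (?B z t)) (at z within ball c r)"
          using z by (subst B) (auto simp: linear_scale mult_ac)
      next
        fix z assume z: "z \<in> ball c r"
        have "continuous_on {0..1} (\<lambda>t. t ^ m * G (y0 + t *\<^sub>R (z - y0)))"
          by (intro continuous_intros continuous_on_compose2[OF smooth_on_imp_continuous_on[OF Suc.prems]])
            (use seg z in auto)
        then show "(\<lambda>t. t ^ m * G (y0 + t *\<^sub>R (z - y0))) integrable_on cbox 0 1"
          by (simp add: integrable_continuous_interval)
      next
        show "continuous_on (ball c r \<times> cbox 0 1) (\<lambda>(y, t). ?B y t)"
          using contB by simp
      qed
      moreover have "blinfun_apply (integral (cbox 0 1) (?B y)) v = ?D y v" for v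
      proof -
        have "continuous_on {0..1} (?B y)"
        proof -
          have "continuous_on {0..1} (Pair y)" by (intro continuous_intros)
          moreover have "Pair y ` {0..1} \<subseteq> ball c r \<times> {0..1::real}" using y by auto
          ultimately show ?thesis using continuous_on_compose2[OF contB] by fastforce
        qed
        then have "?B y integrable_on {0..1}"
          by (rule integrable_continuous_interval)
        then have "((\<lambda>t. blinfun_apply (?B y t) v) has_integral blinfun_apply (integral {0..1} (?B y)) v) {0..1}"
          using has_integral_linear[OF integrable_integral blinfun.bounded_linear_left]
          by (fastforce simp: o_def)
        then have "integral {0..1} (\<lambda>t. blinfun_apply (?B y t) v) = blinfun_apply (integral {0..1} (?B y)) v"
          by (rule integral_unique)
        moreover have "integral {0..1} (\<lambda>t. blinfun_apply (?B y t) v) = ?D y v"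
          by (rule integral_cong) (subst B, use y in \<open>auto simp del: power_Suc\<close>)
        ultimately show ?thesis by simp
      qed
      ultimately show "((\<lambda>y. integral {0..1} (\<lambda>t. t ^ m * G (y0 + t *\<^sub>R (y - y0)))) has_derivative ?D y) (at y)"
        unfolding at_within_open[OF y open_ball] cbox_interval by (rule has_derivative_eq_rhs[OF _ ext])
    next
      show "Ck_on k (ball c r) (\<lambda>y. ?D y v)" for v
        by (rule Suc.IH[OF smooth_on_frechet_derivative[OF Suc.prems]])
    qed simp
  }
qed

text \<open>The coefficient \<open>g i\<close> is the average of the i-th partial derivative over
  the segment from y0 to y, and the expansion is the fundamental theorem of calculus along this
  segment. Smoothness of the coefficients is what later allows a derivation to be applied to the
  expansion.\<close>

lemma Hadamard:
  fixes G :: "'a::euclidean_space \<Rightarrow> real"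
  assumes "smooth_on (ball c r) G" "y0 \<in> ball c r"
  obtains g where "\<And>i. smooth_on (ball c r) (g i)" "\<And>i. g i y0 = frechet_derivative G (at y0) i"
    "\<And>y. y \<in> ball c r \<Longrightarrow> G y = G y0 + (\<Sum>i\<in>Basis. ((y - y0) \<bullet> i) * g i y)"
proof -
  define g where "g i y = integral {0..1} (\<lambda>t. frechet_derivative G (at (y0 + t *\<^sub>R (y - y0))) i)" for i y
  show thesis
  proof (rule that)
    show "smooth_on (ball c r) (g i)" for i
      unfolding smooth_on_def g_def
      using Ck_on_integral[OF smooth_on_frechet_derivative[OF assms(1)] assms(2), of _ 0] by simp
    show "g i y0 = frechet_derivative G (at y0) i" for i
      by (simp add: g_def)
  next
    fix y assume y: "y \<in> ball c r"
    have seg: "y0 + t *\<^sub>R (y - y0) \<in> ball c r" if "t \<in> {0..1}" for t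
      using convexD[OF convex_ball assms(2) y, of "1 - t" t] that by (simp add: algebra_simps)
    have dG: "(G has_derivative frechet_derivative G (at z)) (at z)" if "z \<in> ball c r" for z
      using smooth_on_has_derivative[OF assms(1) that] .
    let ?d = "\<lambda>t. frechet_derivative G (at (y0 + t *\<^sub>R (y - y0)))"
    have d: "((\<lambda>t. G (y0 + t *\<^sub>R (y - y0))) has_vector_derivative ?d t (y - y0)) (at t within {0..1})"
      if t: "t \<in> {0..1}" for t
    proof -
      have "((\<lambda>t. G (y0 + t *\<^sub>R (y - y0))) has_derivative (\<lambda>s. ?d t (s *\<^sub>R (y - y0)))) (at t within {0..1})"
        by (rule has_derivative_compose[OF _ dG]) (use seg t in \<open>auto intro!: derivative_eq_intros\<close>)
      then show ?thesis
        unfolding has_vector_derivative_def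
        using linear_scale[OF has_derivative_linear[OF dG[OF seg[OF t]]]] by simp
    qed
    have int: "(\<lambda>t. ?d t i) integrable_on {0..1}" for i
      by (intro integrable_continuous_interval
          continuous_on_compose2[OF smooth_on_imp_continuous_on[OF smooth_on_frechet_derivative[OF assms(1)]]] continuous_intros)
        (use seg in auto)
    have "((\<lambda>t. ?d t (y - y0)) has_integral G (y0 + 1 *\<^sub>R (y - y0)) - G (y0 + 0 *\<^sub>R (y - y0))) {0..1}"
      by (rule fundamental_theorem_of_calculus) (use d in auto)
    then have "G y - G y0 = integral {0..1} (\<lambda>t. ?d t (y - y0))"
      by (simp add: integral_unique)
    also have "\<dots> = integral {0..1} (\<lambda>t. \<Sum>i\<in>Basis. ((y - y0) \<bullet> i) * ?d t i)"
    proof (rule integral_cong)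
      fix t :: real assume "t \<in> {0..1}"
      then show "?d t (y - y0) = (\<Sum>i\<in>Basis. ((y - y0) \<bullet> i) * ?d t i)"
        using Linear_Algebra.linear_componentwise[OF has_derivative_linear[OF dG[OF seg]], of t "y - y0" 1] by simp
    qed
    also have "\<dots> = (\<Sum>i\<in>Basis. ((y - y0) \<bullet> i) * g i y)"
      unfolding g_def using integrable_cmul[OF int] by (subst integral_sum) auto
    finally show "G y = G y0 + (\<Sum>i\<in>Basis. ((y - y0) \<bullet> i) * g i y)" by simp
  qed
qed


section \<open>Smooth functions, vector fields and covectors on a manifold\<close>

lemma scaleR_fun_apply [simp]: "(r *\<^sub>R f) x = r *\<^sub>R f x"
  by (simp add: scaleR_fun_def)

lemma sum_fun_apply [simp]: "(\<Sum>i\<in>I. f i) x = (\<Sum>i\<in>I. f i x)"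
  by (induction I rule: infinite_finite_induct) auto

lemma restr_in [simp]: "x \<in> V \<Longrightarrow> restr V a x = a x"
  and restr_out [simp]: "x \<notin> V \<Longrightarrow> restr V a x = 0"
  by (simp_all add: restr_def)

lemma lin_on_add: "lin_on V a \<Longrightarrow> x \<in> V \<Longrightarrow> y \<in> V \<Longrightarrow> a (x + y) = a x + a y"
  and lin_on_scale: "lin_on V a \<Longrightarrow> x \<in> V \<Longrightarrow> a (r *\<^sub>R x) = r *\<^sub>R a x"
  and lin_on_out: "lin_on V a \<Longrightarrow> x \<notin> V \<Longrightarrow> a x = 0"
  by (simp_all add: lin_on_def)

lemma lin_on_zero: "lin_on V a \<Longrightarrow> 0 \<in> V \<Longrightarrow> a 0 = 0"
  using lin_on_scale[of V a 0 0] by simp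

lemma lin_on_diff: "lin_on V a \<Longrightarrow> subspace V \<Longrightarrow> x \<in> V \<Longrightarrow> y \<in> V \<Longrightarrow> a (x - y) = a x - a y"
  using lin_on_add[of V a x "-1 *\<^sub>R y"] lin_on_scale[of V a y "-1"] subspace_scale[of V y "-1"] by simp

lemma lin_on_sum:
  "lin_on V a \<Longrightarrow> subspace V \<Longrightarrow> (\<And>i. i \<in> I \<Longrightarrow> x i \<in> V) \<Longrightarrow> a (\<Sum>i\<in>I. x i) = (\<Sum>i\<in>I. a (x i))"
  by (induction I rule: infinite_finite_induct)
    (auto simp: lin_on_add lin_on_zero subspace_0 subspace_sum)

lemma subspace_lin_on: "subspace {a. lin_on V a}"
  by (auto simp: subspace_def lin_on_def algebra_simps)

lemma lin_on_eqI:
  assumes "lin_on V a" "lin_on V b" "\<And>x. x \<in> V \<Longrightarrow> a x = b x"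
  shows "a = b"
  using assms by (metis ext lin_on_out)


section \<open>Smooth functions on a manifold and on its subsets\<close>

locale smooth_manifold =
  fixes \<A> :: "('m::{t2_space, second_countable_topology}, 'e::euclidean_space) atlas"
  assumes atlas: "smooth_atlas \<A>"
begin

abbreviation "CM \<equiv> Cinf \<A> UNIV"
abbreviation "Tan \<equiv> tangent \<A> UNIV"
abbreviation "Cot \<equiv> cotangent \<A> UNIV"
abbreviation "dM \<equiv> differential \<A> UNIV"
abbreviation "VF \<equiv> vec_sections \<A> UNIV"

text \<open>Smoothness on a part of M, for functions such as chart coordinates and reciprocals that
  become global only after multiplication by a cutoff.\<close>

definition smooth_fun_on :: "'m set \<Rightarrow> ('m \<Rightarrow> real) \<Rightarrow> bool" where
  "smooth_fun_on V G \<longleftrightarrow> (\<forall>(U, \<phi>)\<in>\<A>. smooth_on (\<phi> ` (U \<inter> V)) (G \<circ> inv_into U \<phi>))"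

lemma atlas_subset_maximal: "\<A> \<subseteq> maximal_atlas \<A>"
  using atlas by (auto simp: smooth_atlas_def maximal_atlas_def)

lemma maximal_is_chart: "c \<in> maximal_atlas \<A> \<Longrightarrow> is_chart c"
  by (simp add: maximal_atlas_def)

lemma chart_at: obtains U \<phi> where "(U, \<phi>) \<in> \<A>" "p \<in> U"
proof -
  have "p \<in> (\<Union>(U, \<phi>)\<in>\<A>. U)" using atlas by (simp add: smooth_atlas_def)
  then show thesis using that by auto
qed

lemma atlas_is_chart: "(U, \<phi>) \<in> \<A> \<Longrightarrow> is_chart (U, \<phi>)"
  using atlas by (simp add: smooth_atlas_def)

lemma chart_open: "is_chart (U, \<phi>) \<Longrightarrow> open U"
  and chart_inj: "is_chart (U, \<phi>) \<Longrightarrow> inj_on \<phi> U"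
  and chart_homeo: "is_chart (U, \<phi>) \<Longrightarrow> homeomorphism U (\<phi> ` U) \<phi> (inv_into U \<phi>)"
  and chart_range_open: "is_chart (U, \<phi>) \<Longrightarrow> open (\<phi> ` U)"
  by (simp_all add: is_chart_def)

lemma chart_inv: "is_chart (U, \<phi>) \<Longrightarrow> q \<in> U \<Longrightarrow> inv_into U \<phi> (\<phi> q) = q"
  using chart_inj inv_into_f_f by metis

lemma chart_image_open:
  assumes "is_chart (U, \<phi>)" "open V"
  shows "open (\<phi> ` (U \<inter> V))"
proof -
  have "openin (top_of_set (\<phi> ` U)) (\<phi> ` (U \<inter> V))"
    by (rule homeomorphism_imp_open_map[OF chart_homeo[OF assms(1)]]) (simp add: openin_open_Int assms(2))
  then show ?thesis
    using chart_range_open[OF assms(1)] openin_open_trans by blast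
qed

lemma chart_preimage_open:
  assumes "is_chart (U, \<phi>)" "open B"
  shows "open {q \<in> U. \<phi> q \<in> B}"
proof -
  have "continuous_on U \<phi>" using chart_homeo[OF assms(1)] by (simp add: homeomorphism_def)
  from continuous_open_preimage[OF this chart_open[OF assms(1)] assms(2)]
  show ?thesis by (simp add: vimage_def Int_def)
qed

lemma smooth_fun_on_local:
  assumes "\<And>p. p \<in> V \<Longrightarrow> \<exists>N. open N \<and> p \<in> N \<and> smooth_fun_on N G"
  shows "smooth_fun_on V G"
  unfolding smooth_fun_on_def
proof (clarify, rule smooth_on_local)
  fix U \<phi> x assume c: "(U, \<phi>) \<in> \<A>" and "x \<in> \<phi> ` (U \<inter> V)"
  then obtain p where p: "p \<in> U" "p \<in> V" "x = \<phi> p" by auto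
  obtain N where N: "open N" "p \<in> N" "smooth_fun_on N G" using assms p by blast
  show "\<exists>W. open W \<and> x \<in> W \<and> smooth_on W (G \<circ> inv_into U \<phi>)"
    using chart_image_open[OF atlas_is_chart[OF c] N(1)] p N c
    by (intro exI[of _ "\<phi> ` (U \<inter> N)"]) (auto simp: smooth_fun_on_def)
qed

lemma smooth_fun_on_subset: "smooth_fun_on V G \<Longrightarrow> W \<subseteq> V \<Longrightarrow> smooth_fun_on W G"
  unfolding smooth_fun_on_def by (fastforce intro: smooth_on_subset)

lemma smooth_fun_on_cong:
  assumes "open V" "\<And>q. q \<in> V \<Longrightarrow> G q = H q" "smooth_fun_on V G"
  shows "smooth_fun_on V H"
  unfolding smooth_fun_on_def
proof clarify
  fix U \<phi> assume c: "(U, \<phi>) \<in> \<A>"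
  show "smooth_on (\<phi> ` (U \<inter> V)) (H \<circ> inv_into U \<phi>)"
  proof (rule smooth_on_cong)
    show "open (\<phi> ` (U \<inter> V))" by (rule chart_image_open[OF atlas_is_chart[OF c] assms(1)])
    show "smooth_on (\<phi> ` (U \<inter> V)) (G \<circ> inv_into U \<phi>)"
      using assms(3) c by (auto simp: smooth_fun_on_def)
    show "(G \<circ> inv_into U \<phi>) x = (H \<circ> inv_into U \<phi>) x" if "x \<in> \<phi> ` (U \<inter> V)" for x
      using that assms(2) chart_inv[OF atlas_is_chart[OF c]] by auto
  qed
qed

lemma smooth_fun_on_const: "open V \<Longrightarrow> smooth_fun_on V (\<lambda>q. c)"
  unfolding smooth_fun_on_def o_def
  by (auto intro!: smooth_on_const chart_image_open atlas_is_chart)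

lemma smooth_fun_on_add:
  "open V \<Longrightarrow> smooth_fun_on V F \<Longrightarrow> smooth_fun_on V G \<Longrightarrow> smooth_fun_on V (\<lambda>q. F q + G q)"
  unfolding smooth_fun_on_def o_def
  by (auto intro!: smooth_on_add[OF chart_image_open[OF atlas_is_chart]])

lemma smooth_fun_on_mult:
  "open V \<Longrightarrow> smooth_fun_on V F \<Longrightarrow> smooth_fun_on V G \<Longrightarrow> smooth_fun_on V (\<lambda>q. F q * G q)"
  unfolding smooth_fun_on_def o_def
  by (auto intro!: smooth_on_mult[OF chart_image_open[OF atlas_is_chart]])

lemma smooth_fun_on_inverse:
  assumes "open V" "smooth_fun_on V F" "\<And>q. q \<in> V \<Longrightarrow> F q \<noteq> 0"
  shows "smooth_fun_on V (\<lambda>q. inverse (F q))"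
  unfolding smooth_fun_on_def o_def
proof clarify
  fix U \<phi> assume c: "(U, \<phi>) \<in> \<A>"
  show "smooth_on (\<phi> ` (U \<inter> V)) (\<lambda>x. inverse (F (inv_into U \<phi> x)))"
  proof (rule smooth_on_inverse)
    show "open (\<phi> ` (U \<inter> V))" by (rule chart_image_open[OF atlas_is_chart[OF c] assms(1)])
    show "smooth_on (\<phi> ` (U \<inter> V)) (\<lambda>x. F (inv_into U \<phi> x))"
      using assms(2) c by (auto simp: smooth_fun_on_def o_def)
    show "F (inv_into U \<phi> x) \<noteq> 0" if "x \<in> \<phi> ` (U \<inter> V)" for x
      using that assms(3) chart_inv[OF atlas_is_chart[OF c]] by auto
  qed
qed

lemma global_smooth_funs_iff: "F \<in> global_smooth_funs \<A> \<longleftrightarrow> smooth_fun_on UNIV F"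
  by (simp add: global_smooth_funs_def smooth_fun_on_def)

lemma CM_iff: "F \<in> CM \<longleftrightarrow> smooth_fun_on UNIV F"
proof
  assume "smooth_fun_on UNIV F"
  then show "F \<in> CM" by (auto simp: Cinf_def global_smooth_funs_iff intro!: exI[of _ UNIV])
next
  assume F: "F \<in> CM"
  show "smooth_fun_on UNIV F"
  proof (rule smooth_fun_on_local)
    fix p
    obtain U F' where "open U" "p \<in> U" "F' \<in> global_smooth_funs \<A>" "\<forall>q\<in>U. F q = F' q"
      using F unfolding Cinf_def mem_Collect_eq by (metis IntI UNIV_I)
    then have "open U \<and> p \<in> U \<and> smooth_fun_on U F"
      using smooth_fun_on_cong[of U F' F] smooth_fun_on_subset[of UNIV F' U] by (simp add: global_smooth_funs_iff)
    then show "\<exists>N. open N \<and> p \<in> N \<and> smooth_fun_on N F" by blast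
  qed
qed

lemma CM_eq: "CM = global_smooth_funs \<A>"
  using CM_iff global_smooth_funs_iff by blast

lemma Cinf_localE:
  assumes "f \<in> Cinf \<A> N" "p \<in> N"
  obtains U F where "open U" "p \<in> U" "F \<in> CM" "\<And>q. q \<in> U \<inter> N \<Longrightarrow> f q = F q"
  using assms unfolding Cinf_def[of \<A> N] CM_eq by blast

lemma Cinf_out: "f \<in> Cinf \<A> N \<Longrightarrow> q \<notin> N \<Longrightarrow> f q = 0"
  by (simp add: Cinf_def)

lemma Cinf_localI:
  assumes "\<And>p. p \<in> N \<Longrightarrow> \<exists>U F. open U \<and> p \<in> U \<and> F \<in> CM \<and> (\<forall>q\<in>U \<inter> N. f q = F q)"
    "\<And>q. q \<notin> N \<Longrightarrow> f q = 0"
  shows "f \<in> Cinf \<A> N"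
  using assms unfolding Cinf_def[of \<A> N] CM_eq by simp

lemma CM_const: "(\<lambda>q. c) \<in> CM"
  and CM_add: "F \<in> CM \<Longrightarrow> G \<in> CM \<Longrightarrow> F + G \<in> CM"
  and CM_mult: "F \<in> CM \<Longrightarrow> G \<in> CM \<Longrightarrow> F * G \<in> CM"
  by (auto simp: CM_iff func_plus func_times intro!: smooth_fun_on_const smooth_fun_on_add smooth_fun_on_mult)

lemma CM_zero: "0 \<in> CM" and CM_one: "1 \<in> CM"
  using CM_const[of 0] CM_const[of 1] by (simp_all add: func_zero func_one)

lemma CM_scale: "F \<in> CM \<Longrightarrow> c *\<^sub>R F \<in> CM"
  using CM_mult[OF CM_const[of c], of F] by (simp add: func_times scaleR_fun_def)

lemma subspace_CM: "subspace CM"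
  by (simp add: subspace_def CM_zero CM_add CM_scale)

lemma CM_diff: "F \<in> CM \<Longrightarrow> G \<in> CM \<Longrightarrow> F - G \<in> CM"
  using subspace_diff[OF subspace_CM] .

lemma CM_sum: "(\<And>i. i \<in> I \<Longrightarrow> F i \<in> CM) \<Longrightarrow> (\<Sum>i\<in>I. F i) \<in> CM"
  using subspace_sum[OF subspace_CM] .

lemma restr_CM: "F \<in> CM \<Longrightarrow> restr N F \<in> Cinf \<A> N"
  by (rule Cinf_localI) (auto intro!: exI[of _ UNIV] exI[of _ F])

text \<open>Operations are performed on local extensions to M; \<open>h 0 0 = 0\<close> preserves
  the extension by 0 outside N.\<close>

lemma Cinf_local_op:
  assumes "f \<in> Cinf \<A> N" "g \<in> Cinf \<A> N"
    and "\<And>F G. F \<in> CM \<Longrightarrow> G \<in> CM \<Longrightarrow> (\<lambda>q. h (F q) (G q)) \<in> CM" "h 0 0 = 0"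
  shows "(\<lambda>q. h (f q) (g q)) \<in> Cinf \<A> N"
proof (rule Cinf_localI)
  fix p assume p: "p \<in> N"
  obtain U F where U: "open U" "p \<in> U" "F \<in> CM" "\<And>q. q \<in> U \<inter> N \<Longrightarrow> f q = F q"
    using Cinf_localE[OF assms(1) p] by blast
  obtain V G where V: "open V" "p \<in> V" "G \<in> CM" "\<And>q. q \<in> V \<inter> N \<Longrightarrow> g q = G q"
    using Cinf_localE[OF assms(2) p] by blast
  show "\<exists>U F. open U \<and> p \<in> U \<and> F \<in> CM \<and> (\<forall>q\<in>U \<inter> N. h (f q) (g q) = F q)"
    using U V assms(3)[OF U(3) V(3)]
    by (intro exI[of _ "U \<inter> V"] exI[of _ "\<lambda>q. h (F q) (G q)"]) auto
next
  fix q assume "q \<notin> N"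
  then show "h (f q) (g q) = 0" using Cinf_out assms(1,2,4) by metis
qed

lemma Cinf_add: "f \<in> Cinf \<A> N \<Longrightarrow> g \<in> Cinf \<A> N \<Longrightarrow> f + g \<in> Cinf \<A> N"
  using Cinf_local_op[of f N g "(+)"] CM_add by (simp add: func_plus)

lemma Cinf_mult: "f \<in> Cinf \<A> N \<Longrightarrow> g \<in> Cinf \<A> N \<Longrightarrow> f * g \<in> Cinf \<A> N"
  using Cinf_local_op[of f N g "(*)"] CM_mult by (simp add: func_times)

lemma Cinf_scale: "f \<in> Cinf \<A> N \<Longrightarrow> c *\<^sub>R f \<in> Cinf \<A> N"
  using Cinf_local_op[of f N f "\<lambda>x y. c *\<^sub>R x"] CM_scale[of _ c] by (simp add: scaleR_fun_def)

lemma Cinf_zero: "0 \<in> Cinf \<A> N"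
  using restr_CM[OF CM_zero, of N] by (simp add: restr_def func_zero)

lemma subspace_Cinf: "subspace (Cinf \<A> N)"
  by (simp add: subspace_def Cinf_zero Cinf_add Cinf_scale)

text \<open>Stated for the maximal atlas because the charts that straighten an embedded submanifold
  are only required to lie there. Compatibility with a chart of the atlas turns the claim into a
  composition with a smooth transition map.\<close>

lemma smooth_fun_on_chart_comp:
  fixes g :: "'e \<Rightarrow> real"
  assumes c: "(U, \<phi>) \<in> maximal_atlas \<A>" and V: "open V" "V \<subseteq> U" and g: "smooth_on (\<phi> ` V) g"
  shows "smooth_fun_on V (\<lambda>q. g (\<phi> q))"
  unfolding smooth_fun_on_def o_def
proof clarify
  fix U' \<kappa> assume c': "(U', \<kappa>) \<in> \<A>"
  have ch: "is_chart (U, \<phi>)" "is_chart (U', \<kappa>)" using c c' maximal_is_chart atlas_is_chart by blast+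
  have "compatible (U, \<phi>) (U', \<kappa>)" using c c' by (auto simp: maximal_atlas_def)
  then have s: "smooth_on (\<kappa> ` (U \<inter> U')) (\<phi> \<circ> inv_into U' \<kappa>)" by (simp add: compatible_def)
  have "smooth_on (\<kappa> ` (U' \<inter> V)) (\<lambda>x. g ((\<phi> \<circ> inv_into U' \<kappa>) x))"
  proof (rule smooth_on_compose[OF _ _ _ _ g])
    show "open (\<kappa> ` (U' \<inter> V))" by (rule chart_image_open[OF ch(2) V(1)])
    show "open (\<phi> ` V)" using chart_image_open[OF ch(1) V(1)] V(2) by (simp add: Int_absorb1)
    show "smooth_on (\<kappa> ` (U' \<inter> V)) (\<phi> \<circ> inv_into U' \<kappa>)"
      by (rule smooth_on_subset[OF s]) (use V(2) in auto)
    show "(\<phi> \<circ> inv_into U' \<kappa>) ` \<kappa> ` (U' \<inter> V) \<subseteq> \<phi> ` V"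
      using chart_inv[OF ch(2)] by auto
  qed
  then show "smooth_on (\<kappa> ` (U' \<inter> V)) (\<lambda>x. g (\<phi> (inv_into U' \<kappa> x)))" by simp
qed

lemma smooth_on_chart_repr:
  assumes c: "(U, \<phi>) \<in> maximal_atlas \<A>" and F: "F \<in> CM"
  shows "smooth_on (\<phi> ` U) (F \<circ> inv_into U \<phi>)"
proof (rule smooth_on_local)
  fix x assume "x \<in> \<phi> ` U"
  then obtain p where p: "p \<in> U" "x = \<phi> p" by auto
  obtain U' \<kappa> where c': "(U', \<kappa>) \<in> \<A>" "p \<in> U'" by (rule chart_at)
  have ch: "is_chart (U, \<phi>)" "is_chart (U', \<kappa>)" using c c' maximal_is_chart atlas_is_chart by blast+
  have "compatible (U, \<phi>) (U', \<kappa>)" using c c' by (auto simp: maximal_atlas_def)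
  then have s: "smooth_on (\<phi> ` (U \<inter> U')) (\<kappa> \<circ> inv_into U \<phi>)" by (simp add: compatible_def)
  have F': "smooth_on (\<kappa> ` U') (F \<circ> inv_into U' \<kappa>)"
    using F c' by (auto simp: CM_iff smooth_fun_on_def)
  have o: "open (\<phi> ` (U \<inter> U'))" by (rule chart_image_open[OF ch(1) chart_open[OF ch(2)]])
  have "smooth_on (\<phi> ` (U \<inter> U')) (\<lambda>x. (F \<circ> inv_into U' \<kappa>) ((\<kappa> \<circ> inv_into U \<phi>) x))"
    by (rule smooth_on_compose[OF o chart_range_open[OF ch(2)] _ s F'])
      (use chart_inv[OF ch(1)] in auto)
  then have "smooth_on (\<phi> ` (U \<inter> U')) (F \<circ> inv_into U \<phi>)"
    by (rule smooth_on_cong[OF o, rotated]) (use chart_inv[OF ch(1)] chart_inv[OF ch(2)] in auto)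
  then show "\<exists>N. open N \<and> x \<in> N \<and> smooth_on N (F \<circ> inv_into U \<phi>)"
    using o p c' by blast
qed

text \<open>Extension by 0 beyond the chart is smooth because b vanishes off K, the image of a
  compact ball under the inverse chart, and K is closed since M is Hausdorff. The set K is returned
  because cutting off other locally defined functions repeats this argument.\<close>

lemma manifold_bump:
  assumes "open V" "p \<in> V"
  obtains b N K where "b \<in> CM" "open N" "p \<in> N" "\<And>q. q \<in> N \<Longrightarrow> b q = 1" "N \<subseteq> K"
    "closed K" "K \<subseteq> V" "\<And>q. q \<notin> K \<Longrightarrow> b q = 0"
proof -
  obtain U \<phi> where c: "(U, \<phi>) \<in> \<A>" "p \<in> U" by (rule chart_at)
  have ch: "is_chart (U, \<phi>)" using c atlas_is_chart by blast
  have "open (\<phi> ` (U \<inter> V))" "\<phi> p \<in> \<phi> ` (U \<inter> V)"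
    using chart_image_open[OF ch assms(1)] c assms by auto
  then obtain r where r: "r > 0" "cball (\<phi> p) r \<subseteq> \<phi> ` (U \<inter> V)"
    using open_contains_cball by blast
  obtain h :: "'e \<Rightarrow> real" and s where h: "smooth_on UNIV h" "0 < s" "\<And>x. dist (\<phi> p) x < s \<Longrightarrow> h x = 1"
    "\<And>x. dist (\<phi> p) x \<ge> r \<Longrightarrow> h x = 0"
    by (rule bump_exists[OF r(1)]) (rule that)
  define b where "b q = (if q \<in> U then h (\<phi> q) else 0)" for q
  define K where "K = inv_into U \<phi> ` cball (\<phi> p) r"
  have "continuous_on (\<phi> ` U) (inv_into U \<phi>)"
    using chart_homeo[OF ch] by (simp add: homeomorphism_def)
  then have "compact K"
    unfolding K_def by (rule compact_continuous_image[OF continuous_on_subset compact_cball]) (use r in auto)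
  then have K: "closed K" by (rule compact_imp_closed)
  have KV: "K \<subseteq> U \<inter> V" using r(2) chart_inv[OF ch] by (auto simp: K_def)
  have bK: "b q = 0" if "q \<notin> K" for q
  proof (cases "q \<in> U")
    case True
    have "\<phi> q \<notin> cball (\<phi> p) r" using that chart_inv[OF ch True] unfolding K_def by (metis imageI)
    then show ?thesis using h(4) by (simp add: b_def)
  qed (simp add: b_def)
  have "smooth_fun_on UNIV b"
  proof (rule smooth_fun_on_local)
    fix q
    show "\<exists>N. open N \<and> q \<in> N \<and> smooth_fun_on N b"
    proof (cases "q \<in> U")
      case True
      have "smooth_fun_on U (\<lambda>q. h (\<phi> q))"
        using smooth_fun_on_chart_comp[of U \<phi> U h] c atlas_subset_maximal chart_open[OF ch]
          smooth_on_subset[OF h(1)] by blast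
      then have "smooth_fun_on U b"
        by (rule smooth_fun_on_cong[OF chart_open[OF ch], rotated]) (simp add: b_def)
      then show ?thesis using True chart_open[OF ch] by blast
    next
      case False
      have "smooth_fun_on (- K) b"
        by (rule smooth_fun_on_cong[OF _ _ smooth_fun_on_const[of _ 0]]) (use K bK in auto)
      then show ?thesis using False KV K by (intro exI[of _ "- K"]) auto
    qed
  qed
  then have 1: "b \<in> CM" by (simp add: CM_iff)
  let ?N = "{q \<in> U. \<phi> q \<in> ball (\<phi> p) s}"
  have b1: "b q = 1" if "q \<in> ?N" for q using that h(3) by (simp add: b_def)
  have NK: "?N \<subseteq> K" using b1 bK by (metis (lifting) subsetI zero_neq_one)
  show thesis
    by (rule that[OF 1 chart_preimage_open[OF ch open_ball] _ b1 NK K _ bK]) (use c h(2) KV in auto)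
qed

lemma smooth_cutoff:
  assumes "b \<in> CM" "closed K" "K \<subseteq> V" "\<And>q. q \<notin> K \<Longrightarrow> b q = 0" "open V" "smooth_fun_on V G"
  shows "(\<lambda>q. b q * G q) \<in> CM"
  unfolding CM_iff
proof (rule smooth_fun_on_local)
  fix q
  show "\<exists>N. open N \<and> q \<in> N \<and> smooth_fun_on N (\<lambda>q. b q * G q)"
  proof (cases "q \<in> V")
    case True
    have "smooth_fun_on V b" using assms(1) smooth_fun_on_subset by (auto simp: CM_iff)
    then show ?thesis using smooth_fun_on_mult[OF assms(5) _ assms(6)] True assms(5) by blast
  next
    case False
    have "smooth_fun_on (- K) (\<lambda>q. b q * G q)"
      by (rule smooth_fun_on_cong[OF _ _ smooth_fun_on_const[of _ 0]]) (use assms in auto)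
    then show ?thesis using False assms by (intro exI[of _ "- K"]) auto
  qed
qed

text \<open>The reciprocal is smooth only where h is nonzero; a cutoff makes it global at the price
  of inverting h only near p.\<close>

lemma local_inverse:
  assumes "h \<in> CM" "h p \<noteq> 0"
  obtains g N where "g \<in> CM" "open N" "p \<in> N" "\<And>q. q \<in> N \<Longrightarrow> h q * g q = 1"
proof -
  have "continuous_on UNIV h"
    unfolding continuous_on_eq_continuous_at[OF open_UNIV]
  proof
    fix q
    obtain U \<phi> where c: "(U, \<phi>) \<in> \<A>" "q \<in> U" by (rule chart_at)
    have ch: "is_chart (U, \<phi>)" using c atlas_is_chart by blast
    have "continuous_on (\<phi> ` U) (h \<circ> inv_into U \<phi>)"
      using c atlas_subset_maximal assms(1) by (intro smooth_on_imp_continuous_on smooth_on_chart_repr) auto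
    moreover have "continuous_on U \<phi>" using chart_homeo[OF ch] by (simp add: homeomorphism_def)
    ultimately have "continuous_on U (\<lambda>q. (h \<circ> inv_into U \<phi>) (\<phi> q))"
      by (rule continuous_on_compose2) auto
    then have "continuous_on U h"
      by (rule continuous_on_eq) (simp add: chart_inv[OF ch])
    then show "isCont h q" using c chart_open[OF ch] continuous_on_eq_continuous_at by blast
  qed
  then have o: "open {q. h q \<noteq> 0}"
    by (rule open_Collect_neq[OF _ continuous_on_const])
  obtain b N K where b: "b \<in> CM" "open N" "p \<in> N" "\<And>q. q \<in> N \<Longrightarrow> b q = 1" "N \<subseteq> K"
    "closed K" "K \<subseteq> {q. h q \<noteq> 0}" "\<And>q. q \<notin> K \<Longrightarrow> b q = 0"
    by (rule manifold_bump[OF o, of p]) (use assms that in auto)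
  have "smooth_fun_on {q. h q \<noteq> 0} h"
    using assms(1) smooth_fun_on_subset by (auto simp: CM_iff)
  then have "smooth_fun_on {q. h q \<noteq> 0} (\<lambda>q. inverse (h q))"
    by (rule smooth_fun_on_inverse[OF o]) simp
  then have "(\<lambda>q. b q * inverse (h q)) \<in> CM"
    by (intro smooth_cutoff[OF b(1,6,7) _ o] b(8))
  then show thesis
    by (rule that[OF _ b(2,3)]) (use b in auto)
qed


section \<open>Tangent vectors as local derivations; smooth vector fields\<close>

lemma
  assumes "v \<in> tangent \<A> N p"
  shows tangent_lin: "lin_on (Cinf \<A> N) v"
    and tangent_mult: "\<And>f g. f \<in> Cinf \<A> N \<Longrightarrow> g \<in> Cinf \<A> N \<Longrightarrow> v (f * g) = f p * v g + g p * v f"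
  using assms by (auto simp: tangent_def)

lemmas tangent_add = lin_on_add[OF tangent_lin]
lemmas tangent_scale = lin_on_scale[OF tangent_lin]
lemmas tangent_out = lin_on_out[OF tangent_lin]
lemmas tangent_zero = lin_on_zero[OF tangent_lin Cinf_zero]
lemmas tangent_diff = lin_on_diff[OF tangent_lin subspace_Cinf]
lemmas tangent_sum = lin_on_sum[OF tangent_lin subspace_Cinf]

lemma tangent_one:
  assumes "v \<in> Tan p" shows "v 1 = 0"
  using tangent_mult[OF assms CM_one CM_one] by simp

lemma subspace_tangent: "subspace (tangent \<A> N p)"
proof -
  have "subspace ({v. lin_on (Cinf \<A> N) v} \<inter>
      {v. \<forall>f\<in>Cinf \<A> N. \<forall>g\<in>Cinf \<A> N. v (f * g) = f p * v g + g p * v f})"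
    by (rule subspace_inter[OF subspace_lin_on]) (auto simp: subspace_def algebra_simps)
  then show ?thesis by (simp add: tangent_def Int_def)
qed

lemma subspace_Cot: "subspace (cotangent \<A> N p)"
  using subspace_lin_on by (simp add: cotangent_def)

text \<open>A bump function b supported where f and g agree satisfies b (f - g) = 0 on N. In the
  Leibniz rule at p only v (f - g) survives, because b is 1 and f - g is 0 at p.\<close>

lemma tangent_local:
  assumes "v \<in> tangent \<A> N p" "p \<in> N" "open W" "p \<in> W" "f \<in> Cinf \<A> N" "g \<in> Cinf \<A> N"
    and eq: "\<And>q. q \<in> W \<inter> N \<Longrightarrow> f q = g q"
  shows "v f = v g"
proof -
  obtain b M K where b: "b \<in> CM" "open M" "p \<in> M" "\<And>q. q \<in> M \<Longrightarrow> b q = 1" "M \<subseteq> K"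
    "closed K" "K \<subseteq> W" "\<And>q. q \<notin> K \<Longrightarrow> b q = 0"
    by (rule manifold_bump[OF assms(3,4)]) (rule that)
  let ?h = "f - g"
  have h: "?h \<in> Cinf \<A> N" using subspace_diff[OF subspace_Cinf assms(5,6)] .
  have b': "restr N b \<in> Cinf \<A> N" by (rule restr_CM[OF b(1)])
  have "restr N b * ?h = 0"
  proof
    fix q
    show "(restr N b * ?h) q = 0 q"
      using eq[of q] b(7,8) by (cases "q \<in> N"; cases "q \<in> K") auto
  qed
  then have "0 = v (restr N b * ?h)" using tangent_zero[OF assms(1)] by simp
  also have "\<dots> = v ?h"
    using tangent_mult[OF assms(1) b' h] assms(2) b(3,4) eq[of p] assms(4) by simp
  finally show ?thesis using tangent_diff[OF assms(1,5,6)] by simp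
qed

lemma Tan_local:
  assumes "v \<in> Tan p" "open W" "p \<in> W" "f \<in> CM" "g \<in> CM" "\<And>q. q \<in> W \<Longrightarrow> f q = g q"
  shows "v f = v g"
  using tangent_local[OF assms(1) _ assms(2-5)] assms(6) by simp

lemma VF_tangent: "V \<in> vec_sections \<A> N \<Longrightarrow> p \<in> N \<Longrightarrow> V p \<in> Tan p"
  and VF_smooth: "V \<in> vec_sections \<A> N \<Longrightarrow> F \<in> CM \<Longrightarrow> (\<lambda>p. V p F) \<in> Cinf \<A> N"
  by (auto simp: vec_sections_def)

lemma VF_Tan: "V \<in> VF \<Longrightarrow> V p \<in> Tan p"
  by (simp add: VF_tangent)

lemma VF_I:
  assumes "\<And>p. V p \<in> Tan p" "\<And>F. F \<in> CM \<Longrightarrow> (\<lambda>p. V p F) \<in> CM"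
  shows "V \<in> VF"
  using assms by (auto simp: vec_sections_def)

lemma VF_sum:
  assumes "\<And>i. i \<in> I \<Longrightarrow> a i \<in> CM" "\<And>i. i \<in> I \<Longrightarrow> V i \<in> VF"
  shows "(\<lambda>q. \<Sum>i\<in>I. a i q *\<^sub>R V i q) \<in> VF"
proof (rule VF_I)
  fix p
  show "(\<Sum>i\<in>I. a i p *\<^sub>R V i p) \<in> Tan p"
    by (rule subspace_sum[OF subspace_tangent]) (use assms VF_Tan in \<open>auto intro!: subspace_scale[OF subspace_tangent]\<close>)
next
  fix F assume "F \<in> CM"
  then have "a i * (\<lambda>p. V i p F) \<in> CM" if "i \<in> I" for i
    using CM_mult[OF assms(1)[OF that] VF_smooth[OF assms(2)[OF that]]] by simp
  then have "(\<Sum>i\<in>I. a i * (\<lambda>p. V i p F)) \<in> CM"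
    by (rule CM_sum)
  moreover have "(\<Sum>i\<in>I. a i * (\<lambda>p. V i p F)) = (\<lambda>p. (\<Sum>i\<in>I. a i p *\<^sub>R V i p) F)"
    by (rule ext) simp
  ultimately show "(\<lambda>p. (\<Sum>i\<in>I. a i p *\<^sub>R V i p) F) \<in> CM" by simp
qed

subsection \<open>Differentials\<close>

lemma dM_apply: "v \<in> Tan p \<Longrightarrow> dM p F v = v F"
  by (simp add: differential_def)

lemma differential_cotangent: "differential \<A> N p f \<in> cotangent \<A> N p"
  using subspace_tangent[of N p]
  by (auto simp: cotangent_def lin_on_def differential_def subspace_add subspace_scale)

lemma differential_eqI: "(\<And>v. v \<in> tangent \<A> N p \<Longrightarrow> v f = v g) \<Longrightarrow> differential \<A> N p f = differential \<A> N p g"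
  by (auto simp: differential_def restr_def)

lemma differential_add:
  "f \<in> Cinf \<A> N \<Longrightarrow> g \<in> Cinf \<A> N \<Longrightarrow> differential \<A> N p (f + g) = differential \<A> N p f + differential \<A> N p g"
  by (rule ext) (auto simp: differential_def restr_def tangent_add)

lemma differential_scale:
  "f \<in> Cinf \<A> N \<Longrightarrow> differential \<A> N p (c *\<^sub>R f) = c *\<^sub>R differential \<A> N p f"
  by (rule ext) (auto simp: differential_def restr_def tangent_scale)

lemma differential_mult:
  "f \<in> Cinf \<A> N \<Longrightarrow> g \<in> Cinf \<A> N \<Longrightarrow>
    differential \<A> N p (f * g) = f p *\<^sub>R differential \<A> N p g + g p *\<^sub>R differential \<A> N p f"
  by (rule ext) (auto simp: differential_def restr_def tangent_mult)

lemma differential_diff: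
  "f \<in> Cinf \<A> N \<Longrightarrow> g \<in> Cinf \<A> N \<Longrightarrow> differential \<A> N p (f - g) = differential \<A> N p f - differential \<A> N p g"
  by (rule ext) (auto simp: differential_def restr_def tangent_diff)

lemma differential_sum:
  "(\<And>i. i \<in> I \<Longrightarrow> f i \<in> Cinf \<A> N) \<Longrightarrow> differential \<A> N p (\<Sum>i\<in>I. f i) = (\<Sum>i\<in>I. differential \<A> N p (f i))"
  by (rule ext) (auto simp: differential_def restr_def tangent_sum)

lemma differential_zero: "differential \<A> N p 0 = 0"
  by (rule ext) (auto simp: differential_def restr_def tangent_zero)

lemma differential_local:
  assumes "p \<in> N" "open W" "p \<in> W" "f \<in> Cinf \<A> N" "g \<in> Cinf \<A> N"
    and "\<And>q. q \<in> W \<inter> N \<Longrightarrow> f q = g q"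
  shows "differential \<A> N p f = differential \<A> N p g"
  by (rule differential_eqI) (rule tangent_local[OF _ assms])

lemma dM_one: "dM p 1 = 0"
  by (rule ext) (auto simp: differential_def restr_def tangent_one)

lemma Cot_lin: "c \<in> Cot p \<Longrightarrow> lin_on (Tan p) c"
  by (simp add: cotangent_def)

subsection \<open>Coordinates\<close>

text \<open>The derivative in direction e of the chart. The factor s makes room for the cutoff that
  turns coordinate derivations into global vector fields.\<close>

lemma chart_vector:
  assumes c: "(U, \<phi>) \<in> maximal_atlas \<A>" and q: "q \<in> U"
  shows "restr CM (\<lambda>F. s * frechet_derivative (F \<circ> inv_into U \<phi>) (at (\<phi> q)) e) \<in> Tan q"
proof -
  have d: "((F \<circ> inv_into U \<phi>) has_derivative frechet_derivative (F \<circ> inv_into U \<phi>) (at (\<phi> q))) (at (\<phi> q))"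
    if "F \<in> CM" for F
    by (rule smooth_on_has_derivative[OF smooth_on_chart_repr[OF c that]]) (use q in auto)
  have inv: "inv_into U \<phi> (\<phi> q) = q" by (rule chart_inv[OF maximal_is_chart[OF c] q])
  have add: "frechet_derivative ((F + G) \<circ> inv_into U \<phi>) (at (\<phi> q)) e =
      frechet_derivative (F \<circ> inv_into U \<phi>) (at (\<phi> q)) e + frechet_derivative (G \<circ> inv_into U \<phi>) (at (\<phi> q)) e"
    if "F \<in> CM" "G \<in> CM" for F G
  proof -
    have "(F + G) \<circ> inv_into U \<phi> = (\<lambda>x. (F \<circ> inv_into U \<phi>) x + (G \<circ> inv_into U \<phi>) x)" by (auto simp: fun_eq_iff)
    with frechet_derivative_at[OF has_derivative_add[OF d[OF that(1)] d[OF that(2)]], symmetric] show ?thesis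
      by simp
  qed
  have scale: "frechet_derivative ((r *\<^sub>R F) \<circ> inv_into U \<phi>) (at (\<phi> q)) e =
      r * frechet_derivative (F \<circ> inv_into U \<phi>) (at (\<phi> q)) e"
    if "F \<in> CM" for F r
  proof -
    have "(r *\<^sub>R F) \<circ> inv_into U \<phi> = (\<lambda>x. r *\<^sub>R (F \<circ> inv_into U \<phi>) x)" by (auto simp: fun_eq_iff)
    with frechet_derivative_at[OF has_derivative_scaleR_right[OF d[OF that], of r]] show ?thesis
      by (metis real_scaleR_def)
  qed
  have mult: "frechet_derivative ((F * G) \<circ> inv_into U \<phi>) (at (\<phi> q)) e =
      F q * frechet_derivative (G \<circ> inv_into U \<phi>) (at (\<phi> q)) e + G q * frechet_derivative (F \<circ> inv_into U \<phi>) (at (\<phi> q)) e"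
    if "F \<in> CM" "G \<in> CM" for F G
  proof -
    have "(F * G) \<circ> inv_into U \<phi> = (\<lambda>x. (F \<circ> inv_into U \<phi>) x * (G \<circ> inv_into U \<phi>) x)" by (auto simp: fun_eq_iff)
    with frechet_derivative_at[OF has_derivative_mult[OF d[OF that(1)] d[OF that(2)]], symmetric] show ?thesis
      by (simp add: inv)
  qed
  show ?thesis
    unfolding tangent_def lin_on_def
    by (auto simp: CM_add CM_mult CM_scale add scale mult algebra_simps)
qed

text \<open>Chart coordinates and coordinate derivations, both cut off, are global objects that are
  unchanged near p. That the derivations span the tangent space is Hadamard's lemma: modulo
  constants F is a sum of products in which each factor \<open>x i - x i q\<close> vanishes at q, so
  a derivation at q sees only the values \<open>v (x i)\<close> and the partial derivatives of
  F.\<close>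

lemma coordinates:
  obtains x D N where "open N" "p \<in> N" "\<And>i. x i \<in> CM" "\<And>i. D i \<in> VF"
    "\<And>q v. q \<in> N \<Longrightarrow> v \<in> Tan q \<Longrightarrow> v = (\<Sum>i\<in>(Basis :: 'e set). v (x i) *\<^sub>R D i q)"
proof -
  obtain U \<phi> where c: "(U, \<phi>) \<in> \<A>" "p \<in> U" by (rule chart_at)
  have cm: "(U, \<phi>) \<in> maximal_atlas \<A>" using c atlas_subset_maximal by blast
  have ch: "is_chart (U, \<phi>)" using c atlas_is_chart by blast
  have oU: "open U" using chart_open[OF ch] .
  obtain b N K where b: "b \<in> CM" "open N" "p \<in> N" "\<And>q. q \<in> N \<Longrightarrow> b q = 1" "N \<subseteq> K"
    "closed K" "K \<subseteq> U" "\<And>q. q \<notin> K \<Longrightarrow> b q = 0"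
    by (rule manifold_bump[OF oU c(2)]) (rule that)
  define x where "x i q = b q * (\<phi> q \<bullet> i)" for i q
  define D where "D i q = restr CM (\<lambda>F. b q * frechet_derivative (F \<circ> inv_into U \<phi>) (at (\<phi> q)) i)" for i q
  have xCM: "x i \<in> CM" for i
  proof -
    have "smooth_fun_on U (\<lambda>q. \<phi> q \<bullet> i)"
      by (rule smooth_fun_on_chart_comp[OF cm oU order_refl])
        (rule smooth_on_linear[OF chart_range_open[OF ch] bounded_linear_inner_left])
    then show ?thesis unfolding x_def
      by (intro smooth_cutoff[OF b(1,6,7) _ oU] b(8))
  qed
  have DVF: "D i \<in> VF" for i
  proof (rule VF_I)
    fix q
    show "D i q \<in> Tan q"
    proof (cases "q \<in> K")
      case True
      then show ?thesis unfolding D_def using chart_vector[OF cm] b(7) by blast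
    next
      case False
      then have "D i q = 0" using b(8) by (auto simp: D_def restr_def fun_eq_iff)
      then show ?thesis using subspace_0[OF subspace_tangent] by simp
    qed
  next
    fix F assume F: "F \<in> CM"
    have "smooth_fun_on U (\<lambda>q. frechet_derivative (F \<circ> inv_into U \<phi>) (at (\<phi> q)) i)"
      by (rule smooth_fun_on_chart_comp[OF cm oU order_refl])
        (rule smooth_on_frechet_derivative[OF smooth_on_chart_repr[OF cm F]])
    then have "(\<lambda>q. b q * frechet_derivative (F \<circ> inv_into U \<phi>) (at (\<phi> q)) i) \<in> CM"
      by (intro smooth_cutoff[OF b(1,6,7) _ oU] b(8))
    then show "(\<lambda>q. D i q F) \<in> CM" using F by (simp add: D_def)
  qed
  have main: "v F = (\<Sum>i\<in>Basis. v (x i) * D i q F)" if q: "q \<in> N" and v: "v \<in> Tan q" and F: "F \<in> CM" for q v F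
  proof -
    have qU: "q \<in> U" using q b by blast
    let ?G = "F \<circ> inv_into U \<phi>"
    have "open (\<phi> ` (U \<inter> N))" "\<phi> q \<in> \<phi> ` (U \<inter> N)" using chart_image_open[OF ch b(2)] q qU by auto
    then obtain r where r: "r > 0" "ball (\<phi> q) r \<subseteq> \<phi> ` (U \<inter> N)"
      using open_contains_ball by blast
    have "smooth_on (ball (\<phi> q) r) ?G"
      by (rule smooth_on_subset[OF smooth_on_chart_repr[OF cm F]]) (use r in auto)
    then obtain g where g: "\<And>i. smooth_on (ball (\<phi> q) r) (g i)" "\<And>i. g i (\<phi> q) = frechet_derivative ?G (at (\<phi> q)) i"
      "\<And>y. y \<in> ball (\<phi> q) r \<Longrightarrow> ?G y = ?G (\<phi> q) + (\<Sum>i\<in>Basis. ((y - \<phi> q) \<bullet> i) * g i y)"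
      by (rule Hadamard[of _ _ _ "\<phi> q"]) (simp add: r, rule that)
    let ?W = "{q' \<in> U. \<phi> q' \<in> ball (\<phi> q) r}"
    have oW: "open ?W" by (rule chart_preimage_open[OF ch open_ball])
    have qW: "q \<in> ?W" using qU r by simp
    obtain b' N' K' where b': "b' \<in> CM" "open N'" "q \<in> N'" "\<And>q. q \<in> N' \<Longrightarrow> b' q = 1" "N' \<subseteq> K'"
      "closed K'" "K' \<subseteq> ?W" "\<And>q. q \<notin> K' \<Longrightarrow> b' q = 0"
      by (rule manifold_bump[OF oW qW]) (rule that)
    define \<gamma> where "\<gamma> i q = b' q * g i (\<phi> q)" for i q
    have \<gamma>: "\<gamma> i \<in> CM" for i
    proof -
      have "smooth_fun_on ?W (\<lambda>q. g i (\<phi> q))"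
        by (rule smooth_fun_on_chart_comp[OF cm oW _ smooth_on_subset[OF g(1)]]) auto
      then show ?thesis unfolding \<gamma>_def
        by (intro smooth_cutoff[OF b'(1,6,7) _ oW] b'(8))
    qed
    \<comment> \<open>The Hadamard expansion of F at q with cut-off coefficients: a global function,
      to which v can be applied, agreeing with F near q.\<close>
    define H where "H = (F q) *\<^sub>R 1 + (\<Sum>i\<in>Basis. (x i - (x i q) *\<^sub>R 1) * \<gamma> i)"
    have x1: "x i - (x i q) *\<^sub>R 1 \<in> CM" for i
      by (intro CM_diff xCM CM_scale CM_one)
    have HCM: "H \<in> CM" unfolding H_def by (intro CM_add CM_scale CM_sum CM_mult CM_one x1 \<gamma>)
    have summand: "v ((x i - (x i q) *\<^sub>R 1) * \<gamma> i) = v (x i) * D i q F" for i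
    proof -
      have "v (x i - (x i q) *\<^sub>R 1) = v (x i)"
        using tangent_diff[OF v xCM CM_scale[OF CM_one]] tangent_scale[OF v CM_one] tangent_one[OF v] by simp
      moreover have "\<gamma> i q = D i q F"
        using b(4)[OF q] b'(3,4) g(2) F by (simp add: \<gamma>_def D_def)
      ultimately show ?thesis using tangent_mult[OF v x1 \<gamma>] by simp
    qed
    have "v F = v H"
    proof (rule Tan_local[OF v _ _ F HCM])
      show "open (N' \<inter> N)" "q \<in> N' \<inter> N" using b b' q by auto
      fix q' assume q': "q' \<in> N' \<inter> N"
      then have q'W: "q' \<in> ?W" using b' by blast
      then have 1: "inv_into U \<phi> (\<phi> q') = q'" "inv_into U \<phi> (\<phi> q) = q" using chart_inv[OF ch] qU by auto
      have 2: "x i q' = \<phi> q' \<bullet> i" "x i q = \<phi> q \<bullet> i" "\<gamma> i q' = g i (\<phi> q')" for i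
        using b(4) b'(4) q q' by (auto simp: x_def \<gamma>_def)
      show "F q' = H q'" using g(3)[of "\<phi> q'"] q'W
        by (simp add: H_def 1 2 inner_diff_left)
    qed
    also have "v H = v ((F q) *\<^sub>R 1) + (\<Sum>i\<in>Basis. v ((x i - (x i q) *\<^sub>R 1) * \<gamma> i))"
      unfolding H_def
      using tangent_add[OF v CM_scale[OF CM_one, of "F q"] CM_sum[of Basis "\<lambda>i. (x i - (x i q) *\<^sub>R 1) * \<gamma> i"]]
        tangent_sum[OF v, of Basis "\<lambda>i. (x i - (x i q) *\<^sub>R 1) * \<gamma> i"] CM_mult[OF x1 \<gamma>]
      by simp
    also have "\<dots> = (\<Sum>i\<in>Basis. v (x i) * D i q F)"
      using tangent_scale[OF v CM_one] tangent_one[OF v] summand by simp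
    finally show ?thesis by simp
  qed
  show thesis
  proof (rule that[OF b(2,3) xCM DVF])
    fix q v assume q: "q \<in> N" and v: "v \<in> Tan q"
    show "v = (\<Sum>i\<in>(Basis :: 'e set). v (x i) *\<^sub>R D i q)"
    proof
      fix F
      show "v F = (\<Sum>i\<in>(Basis :: 'e set). v (x i) *\<^sub>R D i q) F"
      proof (cases "F \<in> CM")
        case True
        then show ?thesis using main[OF q v] by simp
      next
        case False
        then show ?thesis using tangent_out[OF v] by (simp add: D_def)
      qed
    qed
  qed
qed

lemma covector_expand:
  assumes "c \<in> Cot q" "\<And>v. v \<in> Tan q \<Longrightarrow> v = (\<Sum>i\<in>I. v (x i) *\<^sub>R D i q)" "\<And>i. D i q \<in> Tan q"
  shows "c = (\<Sum>i\<in>I. c (D i q) *\<^sub>R dM q (x i))"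
proof (rule lin_on_eqI[OF Cot_lin[OF assms(1)] Cot_lin])
  show "(\<Sum>i\<in>I. c (D i q) *\<^sub>R dM q (x i)) \<in> Cot q"
    by (intro subspace_sum[OF subspace_Cot] subspace_scale[OF subspace_Cot] differential_cotangent)
  fix v assume v: "v \<in> Tan q"
  have "c v = c (\<Sum>i\<in>I. v (x i) *\<^sub>R D i q)" using assms(2)[OF v] by simp
  also have "\<dots> = (\<Sum>i\<in>I. v (x i) * c (D i q))"
    by (subst lin_on_sum[OF Cot_lin[OF assms(1)] subspace_tangent])
      (auto intro!: subspace_scale[OF subspace_tangent] assms(3) sum.cong simp: lin_on_scale[OF Cot_lin[OF assms(1)] assms(3)])
  finally show "c v = (\<Sum>i\<in>I. c (D i q) *\<^sub>R dM q (x i)) v"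
    by (simp add: dM_apply[OF v] mult.commute)
qed

text \<open>Combine the global coordinate functions with constant coefficients. Identities that are
  linear in covectors can thus be checked on differentials.\<close>

lemma Cot_eq_dM:
  assumes "c \<in> Cot p"
  obtains F where "F \<in> CM" "c = dM p F"
proof -
  obtain x D N where N: "open N" "p \<in> N" and x: "\<And>i. x i \<in> CM" and D: "\<And>i. D i \<in> VF"
    and v: "\<And>q v. q \<in> N \<Longrightarrow> v \<in> Tan q \<Longrightarrow> v = (\<Sum>i\<in>(Basis :: 'e set). v (x i) *\<^sub>R D i q)"
    by (rule coordinates[of p]) (rule that)
  have "c = (\<Sum>i\<in>Basis. c (D i p) *\<^sub>R dM p (x i))"
    by (rule covector_expand[OF assms]) (auto intro: VF_Tan[OF D] v[OF N(2)])
  also have "\<dots> = dM p (\<Sum>i\<in>Basis. c (D i p) *\<^sub>R x i)"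
    by (simp add: differential_sum differential_scale CM_scale x)
  finally show thesis by (rule that[OF CM_sum[OF CM_scale[OF x]]])
qed

lemma tangent_vector_extends:
  assumes "v \<in> Tan p"
  obtains V where "V \<in> VF" "V p = v"
proof -
  obtain x D N where N: "open N" "p \<in> N" and x: "\<And>i. x i \<in> CM" and D: "\<And>i. D i \<in> VF"
    and v: "\<And>q v. q \<in> N \<Longrightarrow> v \<in> Tan q \<Longrightarrow> v = (\<Sum>i\<in>(Basis :: 'e set). v (x i) *\<^sub>R D i q)"
    by (rule coordinates[of p]) (rule that)
  show thesis
  proof (rule that)
    show "(\<lambda>q. \<Sum>i\<in>Basis. v (x i) *\<^sub>R D i q) \<in> VF"
      using VF_sum[of Basis "\<lambda>i q. v (x i)" D] CM_const D by simp
    show "(\<Sum>i\<in>Basis. v (x i) *\<^sub>R D i p) = v" using v[OF N(2) assms] by simp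
  qed
qed

section \<open>Local extension of functions and vector fields from a subset\<close>

lemma Cinf_extend_finite:
  assumes "finite I" "\<And>i. i \<in> I \<Longrightarrow> f i \<in> Cinf \<A> N" "p \<in> N"
  obtains W F where "open W" "p \<in> W" "\<And>i. i \<in> I \<Longrightarrow> F i \<in> CM" "\<And>i q. i \<in> I \<Longrightarrow> q \<in> W \<inter> N \<Longrightarrow> f i q = F i q"
proof -
  have "\<forall>i\<in>I. \<exists>W F. open W \<and> p \<in> W \<and> F \<in> CM \<and> (\<forall>q\<in>W \<inter> N. f i q = F q)"
    using Cinf_localE[OF assms(2) assms(3)] by metis
  then obtain W F where W: "\<forall>i\<in>I. open (W i) \<and> p \<in> W i \<and> F i \<in> CM \<and> (\<forall>q\<in>W i \<inter> N. f i q = F i q)"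
    by metis
  show thesis
    by (rule that[of "\<Inter>i\<in>I. W i" F]) (use W assms(1) in auto)
qed

lemma vec_section_extends:
  assumes V: "V \<in> vec_sections \<A> N" and p: "p \<in> N"
  obtains W V' where "open W" "p \<in> W" "V' \<in> VF" "\<And>q. q \<in> W \<inter> N \<Longrightarrow> V q = V' q"
proof -
  obtain x D N0 where N: "open N0" "p \<in> N0" and x: "\<And>i. x i \<in> CM" and D: "\<And>i. D i \<in> VF"
    and v: "\<And>q v. q \<in> N0 \<Longrightarrow> v \<in> Tan q \<Longrightarrow> v = (\<Sum>i\<in>(Basis :: 'e set). v (x i) *\<^sub>R D i q)"
    by (rule coordinates[of p]) (rule that)
  obtain W F where W: "open W" "p \<in> W" "\<And>i. i \<in> (Basis :: 'e set) \<Longrightarrow> F i \<in> CM"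
    "\<And>i q. i \<in> (Basis :: 'e set) \<Longrightarrow> q \<in> W \<inter> N \<Longrightarrow> V q (x i) = F i q"
    by (rule Cinf_extend_finite[of "Basis :: 'e set" "\<lambda>i q. V q (x i)" N p])
      (auto intro: VF_smooth[OF V x] p that)
  show thesis
  proof (rule that)
    show "open (W \<inter> N0)" "p \<in> W \<inter> N0" using W N by auto
    show "(\<lambda>q. \<Sum>i\<in>Basis. F i q *\<^sub>R D i q) \<in> VF" by (rule VF_sum) (use W D in auto)
    fix q assume "q \<in> W \<inter> N0 \<inter> N"
    then show "V q = (\<Sum>i\<in>Basis. F i q *\<^sub>R D i q)"
      using v[of q "V q"] VF_tangent[OF V, of q] W(4)[of _ q] by simp
  qed
qed

end


section \<open>Poisson manifolds and symplectic leaves\<close>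

locale poisson_manifold = smooth_manifold +
  fixes \<Psi> :: "'a \<Rightarrow> 'a covec \<Rightarrow> 'a covec \<Rightarrow> real"
  assumes poisson: "poisson_bivector \<A> \<Psi>"
begin

abbreviation "PB \<equiv> poisson_bracket \<A> \<Psi>"
abbreviation "shp \<equiv> sharp \<A> \<Psi>"

lemma Psi_lin1: "lin_on (Cot p) (\<Psi> p)"
  and Psi_lin2: "a \<in> Cot p \<Longrightarrow> lin_on (Cot p) (\<Psi> p a)"
  and Psi_skew: "a \<in> Cot p \<Longrightarrow> b \<in> Cot p \<Longrightarrow> \<Psi> p a b = - \<Psi> p b a"
  and PB_smooth: "F \<in> CM \<Longrightarrow> G \<in> CM \<Longrightarrow> PB F G \<in> CM"
  and PB_jacobi: "F \<in> CM \<Longrightarrow> G \<in> CM \<Longrightarrow> H \<in> CM \<Longrightarrow>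
    PB F (PB G H) + PB G (PB H F) + PB H (PB F G) = 0"
  using poisson unfolding poisson_bivector_def by blast+

lemma PB_apply: "PB F G p = \<Psi> p (dM p F) (dM p G)"
  by (simp add: poisson_bracket_def)

lemma PB_skew: "PB F G = - PB G F"
proof
  show "PB F G p = (- PB G F) p" for p
    using Psi_skew[OF differential_cotangent differential_cotangent, of p F G] by (simp add: PB_apply)
qed

lemma PB_add_right: "G \<in> CM \<Longrightarrow> H \<in> CM \<Longrightarrow> PB F (G + H) = PB F G + PB F H"
  by (rule ext)
    (simp add: PB_apply differential_add lin_on_add[OF Psi_lin2[OF differential_cotangent] differential_cotangent differential_cotangent])

lemma PB_add_left: "G \<in> CM \<Longrightarrow> H \<in> CM \<Longrightarrow> PB (G + H) F = PB G F + PB H F"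
  by (rule ext) (simp add: PB_apply differential_add lin_on_add[OF Psi_lin1 differential_cotangent differential_cotangent])

lemma PB_scale_right: "G \<in> CM \<Longrightarrow> PB F (c *\<^sub>R G) = c *\<^sub>R PB F G"
  by (rule ext) (simp add: PB_apply differential_scale lin_on_scale[OF Psi_lin2[OF differential_cotangent] differential_cotangent])

lemma PB_mult_right: "G \<in> CM \<Longrightarrow> H \<in> CM \<Longrightarrow> PB F (G * H) = G * PB F H + H * PB F G"
  by (rule ext)
    (simp add: PB_apply differential_mult lin_on_add[OF Psi_lin2[OF differential_cotangent]]
      lin_on_scale[OF Psi_lin2[OF differential_cotangent] differential_cotangent]
      differential_cotangent subspace_scale[OF subspace_Cot])

lemma PB_one_right: "PB F 1 = 0"
  by (rule ext)
    (simp add: PB_apply dM_one lin_on_zero[OF Psi_lin2[OF differential_cotangent] subspace_0[OF subspace_Cot]])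

lemma sharp_apply: "F \<in> CM \<Longrightarrow> shp p a F = \<Psi> p a (dM p F)"
  by (simp add: sharp_def)

lemma sharp_tangent: "a \<in> Cot p \<Longrightarrow> shp p a \<in> Tan p"
  by (auto simp: tangent_def lin_on_def[of CM] sharp_def CM_add CM_scale CM_mult
      differential_add differential_scale differential_mult lin_on_add[OF Psi_lin2] lin_on_scale[OF Psi_lin2]
      differential_cotangent subspace_scale[OF subspace_Cot])

lemma covec_sharp:
  assumes "a \<in> Cot p" "c \<in> Cot p"
  shows "c (shp p a) = \<Psi> p a c"
proof -
  obtain F where "F \<in> CM" "c = dM p F" using Cot_eq_dM[OF assms(2)] .
  then show ?thesis using assms by (simp add: dM_apply sharp_tangent sharp_apply)
qed

lemma sharp_dM_VF: "F \<in> CM \<Longrightarrow> (\<lambda>q. shp q (dM q F)) \<in> VF"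
proof (rule VF_I)
  fix G assume "F \<in> CM" "G \<in> CM"
  then show "(\<lambda>q. shp q (dM q F) G) \<in> CM"
    using PB_smooth[of F G] by (simp add: sharp_apply poisson_bracket_def)
qed (rule sharp_tangent[OF differential_cotangent])

lemma covec_sections_Cot: "\<alpha> \<in> covec_sections \<A> N \<Longrightarrow> p \<in> N \<Longrightarrow> \<alpha> p \<in> Cot p"
  and covec_sections_smooth: "\<alpha> \<in> covec_sections \<A> N \<Longrightarrow> V \<in> VF \<Longrightarrow> (\<lambda>p. \<alpha> p (V p)) \<in> Cinf \<A> N"
  by (auto simp: covec_sections_def)

lemma dM_covec_section: "F \<in> CM \<Longrightarrow> (\<lambda>q. dM q F) \<in> covec_sections \<A> UNIV"
  by (auto simp: covec_sections_def differential_cotangent dM_apply VF_Tan VF_smooth)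

lemma sharp_field_VF:
  assumes \<alpha>: "\<alpha> \<in> covec_sections \<A> UNIV"
  shows "sharp_field \<A> \<Psi> \<alpha> \<in> VF"
proof (rule VF_I)
  show "sharp_field \<A> \<Psi> \<alpha> p \<in> Tan p" for p
    unfolding sharp_field_def by (rule sharp_tangent[OF covec_sections_Cot[OF \<alpha> UNIV_I]])
  fix F assume F: "F \<in> CM"
  \<comment> \<open>Smoothness of \<alpha> is known only through pairings with vector fields, so
    \<Psi>(\<alpha>, dF) is read by skew-symmetry as minus the pairing of \<alpha> with the
    Hamiltonian field of F.\<close>
  have "(\<lambda>q. \<alpha> q (shp q (dM q F))) \<in> CM"
    by (rule covec_sections_smooth[OF \<alpha> sharp_dM_VF[OF F]])
  then have "(-1) *\<^sub>R (\<lambda>q. \<alpha> q (shp q (dM q F))) \<in> CM" by (rule CM_scale)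
  moreover have "((-1) *\<^sub>R (\<lambda>q. \<alpha> q (shp q (dM q F)))) = (\<lambda>q. sharp_field \<A> \<Psi> \<alpha> q F)"
    using covec_sharp[OF differential_cotangent covec_sections_Cot[OF \<alpha> UNIV_I]]
      Psi_skew[OF differential_cotangent covec_sections_Cot[OF \<alpha> UNIV_I]]
    by (auto simp: fun_eq_iff sharp_field_def sharp_apply[OF F])
  ultimately show "(\<lambda>q. sharp_field \<A> \<Psi> \<alpha> q F) \<in> CM" by simp
qed

section \<open>The cotangent Lie algebroid bracket in terms of functions\<close>

lemma lie_bracket_tangent:
  assumes "X \<in> VF" "Y \<in> VF"
  shows "lie_bracket \<A> X Y p \<in> Tan p"
proof -
  have va: "vf_apply Z F \<in> CM" if "Z \<in> VF" "F \<in> CM" for Z F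
    using VF_smooth[OF that] by (simp add: vf_apply_def)
  have vp: "vf_apply Z F q = Z q F" for Z F q
    by (simp add: vf_apply_def)
  have add: "vf_apply Z (F + G) = vf_apply Z F + vf_apply Z G" if "Z \<in> VF" "F \<in> CM" "G \<in> CM" for Z F G
    using tangent_add[OF VF_Tan[OF that(1)] that(2,3)] by (auto simp: vf_apply_def)
  have scale: "vf_apply Z (r *\<^sub>R F) = r *\<^sub>R vf_apply Z F" if "Z \<in> VF" "F \<in> CM" for Z F r
    using tangent_scale[OF VF_Tan[OF that(1)] that(2)] by (auto simp: vf_apply_def)
  have mult: "vf_apply Z (F * G) = F * vf_apply Z G + G * vf_apply Z F" if "Z \<in> VF" "F \<in> CM" "G \<in> CM" for Z F G
    using tangent_mult[OF VF_Tan[OF that(1)] that(2,3)] by (auto simp: vf_apply_def)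
  have t: "Z p (F + G) = Z p F + Z p G" "Z p (r *\<^sub>R F) = r *\<^sub>R Z p F" "Z p (F * G) = F p * Z p G + G p * Z p F"
    if "Z \<in> VF" "F \<in> CM" "G \<in> CM" for Z F G r
    using tangent_add[OF VF_Tan[OF that(1)] that(2,3)] tangent_scale[OF VF_Tan[OF that(1)] that(2)]
      tangent_mult[OF VF_Tan[OF that(1)] that(2,3)] by auto
  show ?thesis
    unfolding tangent_def lin_on_def lie_bracket_def
    by (auto simp: assms add scale mult va t vp CM_add CM_scale CM_mult algebra_simps)
qed

text \<open>The terms in which X differentiates V(y_j) occur both in X(\<beta>(V)) and in
  \<beta>([X, V]) and cancel. What remains depends on V only through its value at p, as the definite
  description of the bracket requires.\<close>

lemma lie_derivative_formula:
  assumes \<alpha>: "\<alpha> \<in> covec_sections \<A> UNIV" and \<beta>: "\<beta> \<in> covec_sections \<A> UNIV" and V: "V \<in> VF"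
    and CM: "\<And>i. a i \<in> CM" "\<And>i. x i \<in> CM" "\<And>j. b j \<in> CM" "\<And>j. y j \<in> CM"
    and N: "open N" "p \<in> N"
    and eq: "\<And>q. q \<in> N \<Longrightarrow> \<alpha> q = (\<Sum>i\<in>I. a i q *\<^sub>R dM q (x i))"
      "\<And>q. q \<in> N \<Longrightarrow> \<beta> q = (\<Sum>j\<in>J. b j q *\<^sub>R dM q (y j))"
  shows "lie_derivative \<A> (sharp_field \<A> \<Psi> \<alpha>) \<beta> V p =
    (\<Sum>j\<in>J. (\<Sum>i\<in>I. a i p * PB (x i) (b j) p) * V p (y j)) +
    (\<Sum>i\<in>I. \<Sum>j\<in>J. b j p * V p (a i * PB (x i) (y j)))"
proof -
  let ?X = "sharp_field \<A> \<Psi> \<alpha>"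
  have X: "?X \<in> VF" by (rule sharp_field_VF[OF \<alpha>])
  have Vp: "V p \<in> Tan p" and Xp: "?X p \<in> Tan p" using V X VF_Tan by blast+
  have VCM: "(\<lambda>q. V q F) \<in> CM" if "F \<in> CM" for F by (rule VF_smooth[OF V that])
  have Xq: "?X q F = (\<Sum>i\<in>I. a i * PB (x i) F) q" if "q \<in> N" "F \<in> CM" for q F
  proof -
    have "?X q F = \<Psi> q (\<Sum>i\<in>I. a i q *\<^sub>R dM q (x i)) (dM q F)"
      using that by (simp add: sharp_field_def sharp_apply eq(1))
    also have "\<dots> = (\<Sum>i\<in>I. \<Psi> q (a i q *\<^sub>R dM q (x i)) (dM q F))"
      by (subst lin_on_sum[OF Psi_lin1 subspace_Cot]) (auto intro: subspace_scale[OF subspace_Cot] differential_cotangent)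
    finally show ?thesis by (simp add: lin_on_scale[OF Psi_lin1 differential_cotangent] PB_apply)
  qed
  let ?BV = "\<Sum>j\<in>J. b j * (\<lambda>q. V q (y j))"
  have "?X p (\<lambda>q. \<beta> q (V q)) = ?X p ?BV"
  proof (rule Tan_local[OF Xp N])
    show "(\<lambda>q. \<beta> q (V q)) \<in> CM" by (rule covec_sections_smooth[OF \<beta> V])
    show "?BV \<in> CM" by (rule CM_sum[OF CM_mult[OF CM(3) VCM[OF CM(4)]]])
    show "\<beta> q (V q) = ?BV q" if "q \<in> N" for q
      using eq(2)[OF that] by (simp add: dM_apply VF_Tan[OF V])
  qed
  also have "\<dots> = (\<Sum>j\<in>J. b j p * ?X p (\<lambda>q. V q (y j)) + V p (y j) * ?X p (b j))"
    using tangent_sum[OF Xp, of J "\<lambda>j. b j * (\<lambda>q. V q (y j))"] tangent_mult[OF Xp CM(3) VCM[OF CM(4)]]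
      CM_mult[OF CM(3) VCM[OF CM(4)]] by simp
  finally have 1: "?X p (\<lambda>q. \<beta> q (V q)) = (\<Sum>j\<in>J. b j p * ?X p (\<lambda>q. V q (y j)) + V p (y j) * ?X p (b j))" .
  have XCM: "a i * PB (x i) F \<in> CM" if "F \<in> CM" for i F
    by (rule CM_mult[OF CM(1) PB_smooth[OF CM(2) that]])
  have Xy: "V p (\<lambda>q. ?X q (y j)) = (\<Sum>i\<in>I. V p (a i * PB (x i) (y j)))" for j
  proof -
    have "V p (\<lambda>q. ?X q (y j)) = V p (\<Sum>i\<in>I. a i * PB (x i) (y j))"
      by (rule Tan_local[OF Vp N VF_smooth[OF X CM(4)] CM_sum[OF XCM[OF CM(4)]] Xq[OF _ CM(4)]])
    then show ?thesis using tangent_sum[OF Vp, of I "\<lambda>i. a i * PB (x i) (y j)"] XCM[OF CM(4)] by simp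
  qed
  have 2: "\<beta> p (lie_bracket \<A> ?X V p) =
      (\<Sum>j\<in>J. b j p * (?X p (\<lambda>q. V q (y j)) - (\<Sum>i\<in>I. V p (a i * PB (x i) (y j)))))"
    using eq(2)[OF N(2)] lie_bracket_tangent[OF X V, of p] CM(4)
    by (simp add: dM_apply) (simp add: lie_bracket_def vf_apply_def Xy)
  have "lie_derivative \<A> ?X \<beta> V p =
      (\<Sum>j\<in>J. V p (y j) * ?X p (b j)) + (\<Sum>j\<in>J. \<Sum>i\<in>I. b j p * V p (a i * PB (x i) (y j)))"
    unfolding lie_derivative_def 1 2
    by (simp add: sum.distrib sum_subtractf algebra_simps sum_distrib_left)
  also have "(\<Sum>j\<in>J. V p (y j) * ?X p (b j)) = (\<Sum>j\<in>J. (\<Sum>i\<in>I. a i p * PB (x i) (b j) p) * V p (y j))"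
    by (simp add: Xq[OF N(2) CM(3)] mult.commute)
  also have "(\<Sum>j\<in>J. \<Sum>i\<in>I. b j p * V p (a i * PB (x i) (y j))) = (\<Sum>i\<in>I. \<Sum>j\<in>J. b j p * V p (a i * PB (x i) (y j)))"
    by (rule sum.swap)
  finally show ?thesis .
qed

text \<open>The derivatives of the coefficients along v cancel between the two Lie derivatives and
  d(\<Psi>(\<alpha>, \<beta>)); the coefficients enter only by their values and their Poisson
  brackets with the x_i and y_j at p. Arbitrary index sets let the formula serve both exact forms,
  with one-element sets, and coordinate expansions.\<close>

lemma cotangent_bracket_formula:
  assumes \<alpha>: "\<alpha> \<in> covec_sections \<A> UNIV" and \<beta>: "\<beta> \<in> covec_sections \<A> UNIV"
    and CM: "\<And>i. a i \<in> CM" "\<And>i. x i \<in> CM" "\<And>j. b j \<in> CM" "\<And>j. y j \<in> CM"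
    and N: "open N" "p \<in> N"
    and eq: "\<And>q. q \<in> N \<Longrightarrow> \<alpha> q = (\<Sum>i\<in>I. a i q *\<^sub>R dM q (x i))"
      "\<And>q. q \<in> N \<Longrightarrow> \<beta> q = (\<Sum>j\<in>J. b j q *\<^sub>R dM q (y j))"
  shows "cotangent_bracket \<A> \<Psi> \<alpha> \<beta> p = restr (Tan p) (\<lambda>v.
    (\<Sum>i\<in>I. \<Sum>j\<in>J. a i p * b j p * v (PB (x i) (y j))) +
    (\<Sum>j\<in>J. (\<Sum>i\<in>I. a i p * PB (x i) (b j) p) * v (y j)) -
    (\<Sum>i\<in>I. (\<Sum>j\<in>J. b j p * PB (y j) (a i) p) * v (x i)))" (is "_ = restr _ ?R")
proof
  fix v
  show "cotangent_bracket \<A> \<Psi> \<alpha> \<beta> p v = restr (Tan p) ?R v"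
  proof (cases "v \<in> Tan p")
    case v: True
    let ?X = "sharp_field \<A> \<Psi> \<alpha>" and ?Y = "sharp_field \<A> \<Psi> \<beta>"
    have XCM: "a i * PB (x i) (y j) \<in> CM" "b j * (a i * PB (x i) (y j)) \<in> CM" for i j
      by (intro CM_mult CM PB_smooth)+
    have XsCM: "(\<Sum>j\<in>J. b j * (a i * PB (x i) (y j))) \<in> CM" for i
      by (rule CM_sum[OF XCM(2)])
    have "v (\<lambda>q. \<Psi> q (\<alpha> q) (\<beta> q)) = v (\<Sum>i\<in>I. \<Sum>j\<in>J. b j * (a i * PB (x i) (y j)))"
    proof (rule Tan_local[OF v N])
      have "(\<lambda>q. \<beta> q (?X q)) \<in> CM" by (rule covec_sections_smooth[OF \<beta> sharp_field_VF[OF \<alpha>]])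
      then show "(\<lambda>q. \<Psi> q (\<alpha> q) (\<beta> q)) \<in> CM"
        by (simp add: sharp_field_def covec_sharp covec_sections_Cot[OF \<alpha>] covec_sections_Cot[OF \<beta>])
      show "(\<Sum>i\<in>I. \<Sum>j\<in>J. b j * (a i * PB (x i) (y j))) \<in> CM"
        by (rule CM_sum[OF CM_sum[OF XCM(2)]])
      fix q assume q: "q \<in> N"
      have "\<Psi> q (\<alpha> q) (\<beta> q) = (\<Sum>i\<in>I. \<Psi> q (a i q *\<^sub>R dM q (x i)) (\<beta> q))"
        unfolding eq(1)[OF q]
        by (subst lin_on_sum[OF Psi_lin1 subspace_Cot]) (auto intro: subspace_scale[OF subspace_Cot] differential_cotangent)
      also have "\<dots> = (\<Sum>i\<in>I. a i q * \<Psi> q (dM q (x i)) (\<Sum>j\<in>J. b j q *\<^sub>R dM q (y j)))"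
        by (simp add: lin_on_scale[OF Psi_lin1 differential_cotangent] eq(2)[OF q])
      also have "\<dots> = (\<Sum>i\<in>I. a i q * (\<Sum>j\<in>J. \<Psi> q (dM q (x i)) (b j q *\<^sub>R dM q (y j))))"
        by (subst lin_on_sum[OF Psi_lin2[OF differential_cotangent] subspace_Cot])
          (auto intro: subspace_scale[OF subspace_Cot] differential_cotangent)
      finally show "\<Psi> q (\<alpha> q) (\<beta> q) = (\<Sum>i\<in>I. \<Sum>j\<in>J. b j * (a i * PB (x i) (y j))) q"
        by (simp add: lin_on_scale[OF Psi_lin2[OF differential_cotangent] differential_cotangent] PB_apply
            sum_distrib_left mult_ac)
    qed
    also have "\<dots> = (\<Sum>i\<in>I. v (\<Sum>j\<in>J. b j * (a i * PB (x i) (y j))))"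
      using tangent_sum[OF v, of I "\<lambda>i. \<Sum>j\<in>J. b j * (a i * PB (x i) (y j))"] XsCM by simp
    also have "\<dots> = (\<Sum>i\<in>I. \<Sum>j\<in>J. v (b j * (a i * PB (x i) (y j))))"
      using tangent_sum[OF v, of J "\<lambda>j. b j * (a _ * PB (x _) (y j))"] XCM(2) by simp
    finally have vPsi: "v (\<lambda>q. \<Psi> q (\<alpha> q) (\<beta> q)) = (\<Sum>i\<in>I. \<Sum>j\<in>J. v (b j * (a i * PB (x i) (y j))))" .
    have LD: "lie_derivative \<A> ?X \<beta> V p - lie_derivative \<A> ?Y \<alpha> V p - v (\<lambda>q. \<Psi> q (\<alpha> q) (\<beta> q)) = ?R v"
      if V: "V \<in> VF" "V p = v" for V
    proof -
      have pbCM: "PB (x i) (y j) \<in> CM" "PB (y j) (x i) \<in> CM" for i j by (intro PB_smooth CM)+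
      have pbs: "PB (y j) (x i) p = - PB (x i) (y j) p" "v (PB (y j) (x i)) = - v (PB (x i) (y j))" for i j
      proof -
        have e: "PB (y j) (x i) = - PB (x i) (y j)" by (rule PB_skew)
        show "PB (y j) (x i) p = - PB (x i) (y j) p" unfolding e by simp
        show "v (PB (y j) (x i)) = - v (PB (x i) (y j))"
          unfolding e using tangent_scale[OF v pbCM(1), of "- 1"] by simp
      qed
      have t: "v (a i * PB (x i) (y j)) = a i p * v (PB (x i) (y j)) + PB (x i) (y j) p * v (a i)"
        "v (b j * PB (y j) (x i)) = - (b j p * v (PB (x i) (y j)) + PB (x i) (y j) p * v (b j))"
        "v (b j * (a i * PB (x i) (y j))) = b j p * (a i p * v (PB (x i) (y j)) + PB (x i) (y j) p * v (a i))
           + a i p * PB (x i) (y j) p * v (b j)" for i j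
        using tangent_mult[OF v CM(1) pbCM(1)] tangent_mult[OF v CM(3) pbCM(2)] tangent_mult[OF v CM(3) XCM(1)]
        by (simp_all add: pbs)
      have sw: "(\<Sum>j\<in>J. \<Sum>i\<in>I. a i p * v (b j * PB (y j) (x i))) = (\<Sum>i\<in>I. \<Sum>j\<in>J. a i p * v (b j * PB (y j) (x i)))"
        by (rule sum.swap)
      have "(\<Sum>i\<in>I. \<Sum>j\<in>J. b j p * v (a i * PB (x i) (y j))) - (\<Sum>j\<in>J. \<Sum>i\<in>I. a i p * v (b j * PB (y j) (x i)))
          - (\<Sum>i\<in>I. \<Sum>j\<in>J. v (b j * (a i * PB (x i) (y j)))) = (\<Sum>i\<in>I. \<Sum>j\<in>J. a i p * b j p * v (PB (x i) (y j)))"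
        unfolding sw unfolding sum_subtractf[symmetric] t
        by (intro sum.cong refl) (simp add: algebra_simps)
      moreover have "lie_derivative \<A> ?X \<beta> V p =
          (\<Sum>j\<in>J. (\<Sum>i\<in>I. a i p * PB (x i) (b j) p) * V p (y j)) +
          (\<Sum>i\<in>I. \<Sum>j\<in>J. b j p * V p (a i * PB (x i) (y j)))"
        by (rule lie_derivative_formula[OF \<alpha> \<beta> V(1) CM N]) (fact eq)+
      moreover have "lie_derivative \<A> ?Y \<alpha> V p =
          (\<Sum>i\<in>I. (\<Sum>j\<in>J. b j p * PB (y j) (a i) p) * V p (x i)) +
          (\<Sum>j\<in>J. \<Sum>i\<in>I. a i p * V p (b j * PB (y j) (x i)))"
        by (rule lie_derivative_formula[OF \<beta> \<alpha> V(1) CM(3,4,1,2) N]) (fact eq)+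
      ultimately show ?thesis unfolding vPsi V(2) by linarith
    qed
    \<comment> \<open>A field through v shows that at most one number meets the description.\<close>
    obtain V where V: "V \<in> VF" "V p = v" using tangent_vector_extends[OF v] .
    have "(THE r. \<forall>V\<in>VF. V p = v \<longrightarrow> r = lie_derivative \<A> ?X \<beta> V p - lie_derivative \<A> ?Y \<alpha> V p
         - v (\<lambda>q. \<Psi> q (\<alpha> q) (\<beta> q))) = ?R v"
      by (rule the_equality) (use LD V in auto)
    then show ?thesis using v unfolding cotangent_bracket_def by simp
  next
    case False
    then show ?thesis by (simp add: cotangent_bracket_def)
  qed
qed

lemma cotangent_bracket_dM:
  assumes "F \<in> CM" "G \<in> CM"
  shows "cotangent_bracket \<A> \<Psi> (\<lambda>q. dM q F) (\<lambda>q. dM q G) p = dM p (PB F G)"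
  using cotangent_bracket_formula[OF dM_covec_section[OF assms(1)] dM_covec_section[OF assms(2)],
      of "\<lambda>_. 1" "\<lambda>_. F" "\<lambda>_. 1" "\<lambda>_. G" UNIV p "{()}" "{()}"] assms CM_one
  by (simp add: PB_one_right differential_def)

end


section \<open>Restriction of the Poisson structure to a symplectic leaf\<close>

locale poisson_leaf = poisson_manifold +
  fixes S :: "'a set" and k :: nat
  assumes leaf: "embedded_symplectic_leaf \<A> \<Psi> k S"
begin

abbreviation "TanS \<equiv> tangent_in_M \<A> S"

lemma TanS_eq_sharp: "p \<in> S \<Longrightarrow> TanS p = shp p ` Cot p"
  using leaf by (simp add: embedded_symplectic_leaf_def)

lemma push_apply: "F \<in> CM \<Longrightarrow> push \<A> S w F = w (restr S F)"
  by (simp add: push_def)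

lemma TanS_tangent: "p \<in> S \<Longrightarrow> u \<in> TanS p \<Longrightarrow> u \<in> Tan p"
  using TanS_eq_sharp sharp_tangent by auto

lemma TanS_local:
  assumes "u \<in> TanS p" "p \<in> S" "open W" "p \<in> W" "F \<in> CM" "G \<in> CM" "\<And>q. q \<in> W \<inter> S \<Longrightarrow> F q = G q"
  shows "u F = u G"
proof -
  obtain w where w: "w \<in> tangent \<A> S p" "u = push \<A> S w" using assms(1) by (auto simp: tangent_in_M_def)
  have "w (restr S F) = w (restr S G)"
    by (rule tangent_local[OF w(1) assms(2-4) restr_CM restr_CM]) (use assms in auto)
  then show ?thesis using w assms by (simp add: push_apply)
qed

text \<open>At points of S the Hamiltonian vector of H is tangent to the leaf, hence sees F only
  through its restriction to S.\<close>

lemma PB_leaf_local: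
  assumes "p \<in> S" "H \<in> CM" "open W" "p \<in> W" "F \<in> CM" "G \<in> CM" "\<And>q. q \<in> W \<inter> S \<Longrightarrow> F q = G q"
  shows "PB H F p = PB H G p"
proof -
  have "shp p (dM p H) \<in> TanS p" using TanS_eq_sharp assms(1) differential_cotangent by blast
  from TanS_local[OF this assms(1,3-7)] show ?thesis using assms by (simp add: sharp_apply PB_apply)
qed

text \<open>Coefficients of \<open>\<alpha> = \<Sum>a\<^sub>i dx\<^sub>i\<close> enter the bracket at \<open>p\<close> only through \<open>a\<^sub>i(p)\<close> and \<open>{x\<^sub>j, a\<^sub>i}(p)\<close>, and
  \<open>{x\<^sub>j, _}\<close> is tangent to \<open>S\<close>. So the bracket along \<open>S\<close> depends only on the restrictions to \<open>S\<close>.\<close>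

lemma cotangent_bracket_leaf:
  assumes p: "p \<in> S" and \<alpha>: "\<alpha> \<in> covec_sections \<A> UNIV" and \<beta>: "\<beta> \<in> covec_sections \<A> UNIV"
    and F: "F \<in> CM" and G: "G \<in> CM" and U: "open U" "p \<in> U"
    and eq: "\<And>q. q \<in> U \<inter> S \<Longrightarrow> \<alpha> q = dM q F" "\<And>q. q \<in> U \<inter> S \<Longrightarrow> \<beta> q = dM q G"
  shows "cotangent_bracket \<A> \<Psi> \<alpha> \<beta> p = dM p (PB F G)"
proof -
  obtain x D N where N: "open N" "p \<in> N" and x: "\<And>i. x i \<in> CM" and D: "\<And>i. D i \<in> VF"
    and v: "\<And>q v. q \<in> N \<Longrightarrow> v \<in> Tan q \<Longrightarrow> v = (\<Sum>i\<in>(Basis :: 'b set). v (x i) *\<^sub>R D i q)"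
    by (rule coordinates[of p]) (rule that)
  let ?c = "\<lambda>\<gamma> i q. \<gamma> q (D i q)"
  have c: "?c \<gamma> i \<in> CM" if "\<gamma> \<in> covec_sections \<A> UNIV" for \<gamma> i
    by (rule covec_sections_smooth[OF that D])
  have ex: "\<gamma> q = (\<Sum>i\<in>Basis. ?c \<gamma> i q *\<^sub>R dM q (x i))" if "\<gamma> \<in> covec_sections \<A> UNIV" "q \<in> N" for \<gamma> q
    by (rule covector_expand[OF covec_sections_Cot[OF that(1)]]) (auto intro: VF_Tan[OF D] v[OF that(2)])
  have dF: "(\<lambda>q. dM q F) \<in> covec_sections \<A> UNIV" and dG: "(\<lambda>q. dM q G) \<in> covec_sections \<A> UNIV"
    using dM_covec_section F G by blast+
  have pU: "p \<in> U \<inter> S" using p U by blast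
  have loc: "PB (x i) (?c \<alpha> j) p = PB (x i) (?c (\<lambda>q. dM q F) j) p"
    "PB (x i) (?c \<beta> j) p = PB (x i) (?c (\<lambda>q. dM q G) j) p" for i j
    by (rule PB_leaf_local[OF p x U]; use c[OF \<alpha>] c[OF \<beta>] c[OF dF] c[OF dG] eq in auto)+
  define R where "R a b = restr (Tan p) (\<lambda>v.
    (\<Sum>i\<in>Basis. \<Sum>j\<in>Basis. a i p * b j p * v (PB (x i) (x j))) +
    (\<Sum>j\<in>Basis. (\<Sum>i\<in>Basis. a i p * PB (x i) (b j) p) * v (x j)) -
    (\<Sum>i\<in>Basis. (\<Sum>j\<in>Basis. b j p * PB (x j) (a i) p) * v (x i)))" for a b
  have f: "cotangent_bracket \<A> \<Psi> \<gamma> \<delta> p = R (?c \<gamma>) (?c \<delta>)"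
    if "\<gamma> \<in> covec_sections \<A> UNIV" "\<delta> \<in> covec_sections \<A> UNIV" for \<gamma> \<delta>
    unfolding R_def
    by (rule cotangent_bracket_formula[OF that c[OF that(1)] x c[OF that(2)] x N]; erule ex[OF that(1)] ex[OF that(2)])
  have "R (?c \<alpha>) (?c \<beta>) = R (?c (\<lambda>q. dM q F)) (?c (\<lambda>q. dM q G))"
    unfolding R_def loc by (simp only: eq[OF pU])
  then have "cotangent_bracket \<A> \<Psi> \<alpha> \<beta> p = cotangent_bracket \<A> \<Psi> (\<lambda>q. dM q F) (\<lambda>q. dM q G) p"
    unfolding f[OF \<alpha> \<beta>] f[OF dF dG] .
  then show ?thesis by (simp add: cotangent_bracket_dM[OF F G])
qed

text \<open>Independence of the extensions is \<open>cotangent_bracket_leaf\<close>; uniqueness of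
  the described covector needs one pair of extensions, provided by the forms dF and dG themselves.
  Exactness near p is a harmless assumption, since sections of both summands of the restricted
  cotangent bundle will turn out to have the required potentials.\<close>

lemma leaf_bracket_dM:
  assumes p: "p \<in> S" and F: "F \<in> CM" and G: "G \<in> CM" and U: "open U" "p \<in> U"
    and eq: "\<And>q. q \<in> U \<inter> S \<Longrightarrow> \<alpha> q = dM q F" "\<And>q. q \<in> U \<inter> S \<Longrightarrow> \<beta> q = dM q G"
  shows "leaf_bracket \<A> \<Psi> S \<alpha> \<beta> p = dM p (PB F G)"
proof -
  have "(THE c. \<forall>\<alpha>'\<in>covec_sections \<A> UNIV. \<forall>\<beta>'\<in>covec_sections \<A> UNIV. \<forall>U.
       open U \<and> p \<in> U \<and> (\<forall>q\<in>U \<inter> S. \<alpha>' q = \<alpha> q \<and> \<beta>' q = \<beta> q) \<longrightarrow> c = cotangent_bracket \<A> \<Psi> \<alpha>' \<beta>' p) = dM p (PB F G)"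
  proof (rule the_equality)
    show "\<forall>\<alpha>'\<in>covec_sections \<A> UNIV. \<forall>\<beta>'\<in>covec_sections \<A> UNIV. \<forall>U.
       open U \<and> p \<in> U \<and> (\<forall>q\<in>U \<inter> S. \<alpha>' q = \<alpha> q \<and> \<beta>' q = \<beta> q) \<longrightarrow> dM p (PB F G) = cotangent_bracket \<A> \<Psi> \<alpha>' \<beta>' p"
    proof (intro ballI allI impI)
      fix \<alpha>' \<beta>' U' assume ab: "\<alpha>' \<in> covec_sections \<A> UNIV" "\<beta>' \<in> covec_sections \<A> UNIV"
        and U': "open U' \<and> p \<in> U' \<and> (\<forall>q\<in>U' \<inter> S. \<alpha>' q = \<alpha> q \<and> \<beta>' q = \<beta> q)"
      show "dM p (PB F G) = cotangent_bracket \<A> \<Psi> \<alpha>' \<beta>' p"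
        by (rule cotangent_bracket_leaf[OF p ab F G, of "U \<inter> U'", symmetric]) (use U U' eq in auto)
    qed
  next
    fix c assume H: "\<forall>\<alpha>'\<in>covec_sections \<A> UNIV. \<forall>\<beta>'\<in>covec_sections \<A> UNIV. \<forall>U.
       open U \<and> p \<in> U \<and> (\<forall>q\<in>U \<inter> S. \<alpha>' q = \<alpha> q \<and> \<beta>' q = \<beta> q) \<longrightarrow> c = cotangent_bracket \<A> \<Psi> \<alpha>' \<beta>' p"
    have "c = cotangent_bracket \<A> \<Psi> (\<lambda>q. dM q F) (\<lambda>q. dM q G) p"
      by (rule H[rule_format, OF dM_covec_section[OF F] dM_covec_section[OF G], of U]) (use U eq in auto)
    then show "c = dM p (PB F G)" by (simp add: cotangent_bracket_dM[OF F G])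
  qed
  then show ?thesis using p by (simp add: leaf_bracket_def)
qed

lemma covec_restr_eq_iff: "covec_restr \<A> S p c = covec_restr \<A> S p c' \<longleftrightarrow> (\<forall>u\<in>TanS p. c u = c' u)"
  by (auto simp: covec_restr_def tangent_in_M_def fun_eq_iff restr_def)

lemma covec_restr_dM:
  assumes "p \<in> S" "F \<in> CM" "f \<in> Cinf \<A> S" "open U" "p \<in> U" "\<And>q. q \<in> U \<inter> S \<Longrightarrow> f q = F q"
  shows "covec_restr \<A> S p (dM p F) = differential \<A> S p f"
proof
  fix w
  show "covec_restr \<A> S p (dM p F) w = differential \<A> S p f w"
  proof (cases "w \<in> tangent \<A> S p")
    case True
    then have "push \<A> S w \<in> Tan p" using TanS_tangent[OF assms(1)] by (auto simp: tangent_in_M_def)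
    moreover have "w (restr S F) = w f"
      by (rule tangent_local[OF True assms(1,4,5) restr_CM[OF assms(2)] assms(3)]) (use assms(6) in auto)
    ultimately show ?thesis
      using True by (simp add: covec_restr_def differential_def[of _ S] dM_apply push_apply assms(2))
  qed (simp add: covec_restr_def differential_def)
qed

text \<open>Each argument is a covector paired with a vector in the image of sharp, which is the
  tangent space of S; skew-symmetry exchanges the roles of the two arguments.\<close>

lemma Psi_TanS:
  assumes "p \<in> S" "c \<in> Cot p" "c' \<in> Cot p" "e \<in> Cot p" "e' \<in> Cot p"
    "\<And>u. u \<in> TanS p \<Longrightarrow> c u = c' u" "\<And>u. u \<in> TanS p \<Longrightarrow> e u = e' u"
  shows "\<Psi> p c e = \<Psi> p c' e'"
proof -
  have "\<Psi> p c e = \<Psi> p c e'"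
    using assms(7)[of "shp p c"] TanS_eq_sharp[OF assms(1)] assms(2-5) by (simp add: covec_sharp)
  also have "\<dots> = - \<Psi> p e' c" by (rule Psi_skew[OF assms(2,5)])
  also have "\<Psi> p e' c = \<Psi> p e' c'"
    using assms(6)[of "shp p e'"] TanS_eq_sharp[OF assms(1)] assms(2-5) by (simp add: covec_sharp)
  finally show ?thesis using Psi_skew[OF assms(3,5)] by simp
qed

lemma leaf_poisson_eq_PB:
  assumes p: "p \<in> S" and F: "F \<in> CM" and G: "G \<in> CM" and fg: "f \<in> Cinf \<A> S" "g \<in> Cinf \<A> S"
    and U: "open U" "p \<in> U" and eq: "\<And>q. q \<in> U \<inter> S \<Longrightarrow> f q = F q" "\<And>q. q \<in> U \<inter> S \<Longrightarrow> g q = G q"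
  shows "leaf_poisson \<A> \<Psi> S f g p = PB F G p"
proof -
  have cr: "covec_restr \<A> S p (dM p F) = differential \<A> S p f"
    "covec_restr \<A> S p (dM p G) = differential \<A> S p g"
    using covec_restr_dM[OF p F fg(1) U] covec_restr_dM[OF p G fg(2) U] eq by blast+
  have "leaf_bivector \<A> \<Psi> S p (differential \<A> S p f) (differential \<A> S p g) = PB F G p"
    unfolding leaf_bivector_def
  proof (rule the_equality)
    show "\<forall>c\<in>Cot p. \<forall>e\<in>Cot p. covec_restr \<A> S p c = differential \<A> S p f \<and> covec_restr \<A> S p e = differential \<A> S p g
        \<longrightarrow> PB F G p = \<Psi> p c e"
      unfolding cr[symmetric] covec_restr_eq_iff PB_apply
    proof (intro ballI impI, elim conjE)
      fix c e assume "c \<in> Cot p" "e \<in> Cot p" "\<forall>u\<in>TanS p. c u = dM p F u" "\<forall>u\<in>TanS p. e u = dM p G u"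
      then show "\<Psi> p (dM p F) (dM p G) = \<Psi> p c e"
        by (intro Psi_TanS[OF p differential_cotangent _ differential_cotangent]) auto
    qed
    show "r = PB F G p" if "\<forall>c\<in>Cot p. \<forall>e\<in>Cot p. covec_restr \<A> S p c = differential \<A> S p f \<and>
        covec_restr \<A> S p e = differential \<A> S p g \<longrightarrow> r = \<Psi> p c e" for r
      using that cr differential_cotangent by (simp add: PB_apply)
  qed
  then show ?thesis using p by (simp add: leaf_poisson_def)
qed

text \<open>Suppose v kills every function that vanishes on S near p. Then its value on a local
  extension of f depends on f alone, which defines a derivation at p of the functions on S. Its
  push-forward is v, so v would be tangent to S.\<close>

lemma transverse_detected:
  assumes p: "p \<in> S" and v: "v \<in> Tan p" "v \<notin> TanS p"
  obtains z W where "z \<in> CM" "open W" "p \<in> W" "\<And>q. q \<in> W \<inter> S \<Longrightarrow> z q = 0" "v z \<noteq> 0"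
proof (rule ccontr)
  note detected = that
  assume contra: "\<not> thesis"
  have kill: "v z = 0" if "z \<in> CM" "open W" "p \<in> W" "\<And>q. q \<in> W \<inter> S \<Longrightarrow> z q = 0" for z W
    using detected[OF that] contra by blast
  define ext where "ext f F \<longleftrightarrow> F \<in> CM \<and> (\<exists>W. open W \<and> p \<in> W \<and> (\<forall>q\<in>W \<inter> S. f q = F q))" for f F
  define w where "w = restr (Cinf \<A> S) (\<lambda>f. v (SOME F. ext f F))"
  have w: "w f = v F" if f: "f \<in> Cinf \<A> S" and F: "ext f F" for f F
  proof -
    define F' where "F' = (SOME F. ext f F)"
    have "ext f F'" unfolding F'_def using F by (rule someI[of "ext f"])
    then obtain W' where F': "F' \<in> CM" "open W'" "p \<in> W'" "\<forall>q\<in>W' \<inter> S. f q = F' q" unfolding ext_def by blast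
    obtain W where W: "F \<in> CM" "open W" "p \<in> W" "\<forall>q\<in>W \<inter> S. f q = F q" using F unfolding ext_def by blast
    have "v (F' - F) = 0"
    proof (rule kill[of _ "W \<inter> W'"])
      show "(F' - F) q = 0" if "q \<in> W \<inter> W' \<inter> S" for q
      proof -
        have "f q = F' q" "f q = F q" using that F'(4) W(4) by blast+
        then show ?thesis by simp
      qed
    qed (use F' W in \<open>auto intro: CM_diff\<close>)
    then show ?thesis using tangent_diff[OF v(1) F'(1) W(1)] f by (simp add: w_def F'_def)
  qed
  have ex: "\<exists>F. ext f F" if "f \<in> Cinf \<A> S" for f
    using Cinf_localE[OF that p] unfolding ext_def by metis
  have "w \<in> tangent \<A> S p"
    unfolding tangent_def lin_on_def
  proof (intro CollectI conjI ballI allI impI)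
    fix f g assume fg: "f \<in> Cinf \<A> S" "g \<in> Cinf \<A> S"
    obtain F W where F: "F \<in> CM" "open W" "p \<in> W" "\<forall>q\<in>W \<inter> S. f q = F q" using ex[OF fg(1)] unfolding ext_def by blast
    obtain G W' where G: "G \<in> CM" "open W'" "p \<in> W'" "\<forall>q\<in>W' \<inter> S. g q = G q" using ex[OF fg(2)] unfolding ext_def by blast
    have fF: "ext f F" and gG: "ext g G" using F G unfolding ext_def by blast+
    have s: "ext (f + g) (F + G)" "ext (f * g) (F * G)"
      using F G unfolding ext_def by (auto intro!: CM_add CM_mult exI[of _ "W \<inter> W'"])
    show "w (f + g) = w f + w g"
      using w[OF fg(1) fF] w[OF fg(2) gG] w[OF Cinf_add[OF fg] s(1)] tangent_add[OF v(1) F(1) G(1)] by simp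
    show "w (f * g) = f p * w g + g p * w f"
      using w[OF fg(1) fF] w[OF fg(2) gG] w[OF Cinf_mult[OF fg] s(2)] tangent_mult[OF v(1) F(1) G(1)] F G p by simp
  next
    fix r f assume f: "f \<in> Cinf \<A> S"
    obtain F W where F: "F \<in> CM" "open W" "p \<in> W" "\<forall>q\<in>W \<inter> S. f q = F q" using ex[OF f] unfolding ext_def by blast
    have fF: "ext f F" using F unfolding ext_def by blast
    have s: "ext (r *\<^sub>R f) (r *\<^sub>R F)" using F unfolding ext_def by (auto intro!: CM_scale exI[of _ W])
    show "w (r *\<^sub>R f) = r *\<^sub>R w f"
      using w[OF f fF] w[OF Cinf_scale[OF f] s] tangent_scale[OF v(1) F(1)] by simp
  qed (simp add: w_def)
  moreover have "push \<A> S w = v"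
  proof
    fix F show "push \<A> S w F = v F"
    proof (cases "F \<in> CM")
      case True
      then have "w (restr S F) = v F" by (intro w[OF restr_CM]) (auto simp: ext_def intro: exI[of _ UNIV])
      then show ?thesis using True by (simp add: push_apply)
    next
      case False
      then show ?thesis using tangent_out[OF v(1)] by (simp add: push_def)
    qed
  qed
  ultimately show False using v(2) by (auto simp: tangent_in_M_def)
qed

end


section \<open>Local representatives of elements of the infinitesimal Poisson algebra\<close>

locale transversal_leaf = poisson_leaf +
  fixes \<Sigma> :: "'a \<Rightarrow> 'a tvec set"
  assumes transversal: "transversal \<A> S \<Sigma>"
begin

abbreviation "con \<equiv> conormal \<A> S"
abbreviation "CS \<equiv> Cinf \<A> S"
abbreviation "CN \<equiv> conormal_sections \<A> S"
abbreviation "dS \<equiv> d\<Sigma> \<A> S \<Sigma>"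

lemma Sigma_tangent: "p \<in> S \<Longrightarrow> v \<in> \<Sigma> p \<Longrightarrow> v \<in> Tan p"
  and Sigma_TanS: "p \<in> S \<Longrightarrow> v \<in> \<Sigma> p \<Longrightarrow> v \<in> TanS p \<Longrightarrow> v = 0"
  using transversal unfolding transversal_def by blast+

lemma Tan_split:
  assumes "p \<in> S" "v \<in> Tan p"
  obtains u s where "u \<in> TanS p" "s \<in> \<Sigma> p" "v = u + s"
  using assms transversal unfolding transversal_def by blast

lemma covector_eqI:
  assumes p: "p \<in> S" and c: "c \<in> Cot p" "c' \<in> Cot p"
    and "\<And>u. u \<in> TanS p \<Longrightarrow> c u = c' u" "\<And>s. s \<in> \<Sigma> p \<Longrightarrow> c s = c' s"
  shows "c = c'"
proof (rule lin_on_eqI[OF Cot_lin[OF c(1)] Cot_lin[OF c(2)]])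
  fix v assume "v \<in> Tan p"
  then obtain u s where us: "u \<in> TanS p" "s \<in> \<Sigma> p" "v = u + s" by (rule Tan_split[OF p])
  then show "c v = c' v"
    using assms(4,5) lin_on_add[OF Cot_lin[OF c(1)]] lin_on_add[OF Cot_lin[OF c(2)]]
      TanS_tangent[OF p us(1)] Sigma_tangent[OF p us(2)] by simp
qed

lemma annihilator_Cot: "c \<in> annihilator \<A> p V \<Longrightarrow> c \<in> Cot p"
  and annihilatorD: "c \<in> annihilator \<A> p V \<Longrightarrow> v \<in> V \<Longrightarrow> c v = 0"
  by (simp_all add: annihilator_def)

lemma subspace_annihilator: "subspace (annihilator \<A> p V)"
  using subspace_Cot[of UNIV p] by (auto simp: annihilator_def subspace_def)

lemma dSigma_eqI:
  assumes p: "p \<in> S" and c: "c \<in> annihilator \<A> p (\<Sigma> p)" "covec_restr \<A> S p c = differential \<A> S p f"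
  shows "dS f p = c"
proof -
  have "(THE c. c \<in> annihilator \<A> p (\<Sigma> p) \<and> covec_restr \<A> S p c = differential \<A> S p f) = c"
  proof (rule the_equality)
    fix c' assume c': "c' \<in> annihilator \<A> p (\<Sigma> p) \<and> covec_restr \<A> S p c' = differential \<A> S p f"
    then have "covec_restr \<A> S p c' = covec_restr \<A> S p c" using c by simp
    then show "c' = c"
      using c c' annihilator_Cot annihilatorD unfolding covec_restr_eq_iff
      by (intro covector_eqI[OF p]) (blast, blast, blast, metis)
  qed (use c in auto)
  then show ?thesis using p by (simp add: d\<Sigma>_def)
qed

lemma dSigma_eq_dM:
  assumes p: "p \<in> S" and F: "F \<in> CM" and f: "f \<in> CS" and U: "open U" "p \<in> U" "\<And>q. q \<in> U \<inter> S \<Longrightarrow> f q = F q"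
    and \<Sigma>: "\<And>s. s \<in> \<Sigma> p \<Longrightarrow> s F = 0"
  shows "dS f p = dM p F"
proof (rule dSigma_eqI[OF p _ covec_restr_dM[OF p F f U]])
  show "dM p F \<in> annihilator \<A> p (\<Sigma> p)"
    using \<Sigma> Sigma_tangent[OF p] by (auto simp: annihilator_def differential_cotangent dM_apply)
qed

lemma conormal_part_eqI:
  assumes p: "p \<in> S" and a: "\<alpha> p \<in> Cot p" and c: "c \<in> con p" "\<alpha> p - c \<in> annihilator \<A> p (\<Sigma> p)"
  shows "conormal_part \<A> S \<Sigma> \<alpha> p = c"
proof -
  have "(THE c. c \<in> con p \<and> \<alpha> p - c \<in> annihilator \<A> p (\<Sigma> p)) = c"
  proof (rule the_equality)
    fix c' assume c': "c' \<in> con p \<and> \<alpha> p - c' \<in> annihilator \<A> p (\<Sigma> p)"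
    show "c' = c"
    proof (rule covector_eqI[OF p])
      show "c' \<in> Cot p" "c \<in> Cot p" using c c' annihilator_Cot unfolding conormal_def by blast+
      show "c' u = c u" if "u \<in> TanS p" for u
        using annihilatorD[OF _ that] c c' unfolding conormal_def by metis
      show "c' s = c s" if "s \<in> \<Sigma> p" for s
        using annihilatorD[OF c(2) that] annihilatorD[OF conjunct2[OF c'] that] by simp
    qed
  qed (use c in auto)
  then show ?thesis using p by (simp add: conormal_part_def)
qed

text \<open>This replaces the inversion of a matrix of smooth functions. To enlarge the family by \<open>\<sigma>\<close>, subtract from
  \<open>\<sigma>\<close> its components along the earlier vectors: the remainder is not tangent to \<open>S\<close>, hence it is
  detected by a function vanishing on \<open>S\<close>. Only the values of the \<open>y \<tau>\<close> modulo \<open>I\<^sup>2(S)\<close> matter.\<close>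

lemma dual_functions:
  assumes p: "p \<in> S" and U: "open U" "p \<in> U" and B: "finite B" "B \<subseteq> vec_sections \<A> (U \<inter> S)"
    and ind: "inj_on (\<lambda>\<sigma>. \<sigma> p) B" "independent ((\<lambda>\<sigma>. \<sigma> p) ` B)"
    and tr: "\<And>v. v \<in> span ((\<lambda>\<sigma>. \<sigma> p) ` B) \<Longrightarrow> v \<in> TanS p \<Longrightarrow> v = 0"
  obtains y N where "open N" "p \<in> N" "N \<subseteq> U" "\<And>\<tau>. \<tau> \<in> B \<Longrightarrow> y \<tau> \<in> CM"
    "\<And>\<tau> q. \<tau> \<in> B \<Longrightarrow> q \<in> N \<inter> S \<Longrightarrow> y \<tau> q = 0"
    "\<And>\<sigma> \<tau> q. \<sigma> \<in> B \<Longrightarrow> \<tau> \<in> B \<Longrightarrow> q \<in> N \<inter> S \<Longrightarrow> \<sigma> q (y \<tau>) = (if \<sigma> = \<tau> then 1 else (0::real))"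
proof -
  have pUS: "p \<in> U \<inter> S" using p U by simp
  have tan: "\<sigma> q \<in> Tan q" if "\<sigma> \<in> B" "q \<in> U \<inter> S" for \<sigma> q using VF_tangent B(2) that by blast
  have sm: "(\<lambda>q. \<sigma> q F) \<in> Cinf \<A> (U \<inter> S)" if "\<sigma> \<in> B" "F \<in> CM" for \<sigma> F using VF_smooth B(2) that by blast
  have "\<exists>y N. open N \<and> p \<in> N \<and> N \<subseteq> U \<and> (\<forall>\<tau>\<in>B'. y \<tau> \<in> CM \<and> (\<forall>q\<in>N \<inter> S. y \<tau> q = 0)) \<and>
      (\<forall>\<sigma>\<in>B'. \<forall>\<tau>\<in>B'. \<forall>q\<in>N \<inter> S. \<sigma> q (y \<tau>) = (if \<sigma> = \<tau> then 1 else (0::real)))" if "finite B'" "B' \<subseteq> B" for B'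
    using that
  proof (induction B' rule: finite_induct)
    case empty
    then show ?case using U by (intro exI[of _ "\<lambda>_. 0"] exI[of _ U]) simp
  next
    case (insert \<sigma> B')
    then have \<sigma>B: "\<sigma> \<in> B" and B'B: "B' \<subseteq> B" by auto
    obtain y N where N: "open N" "p \<in> N" "N \<subseteq> U" and y': "\<forall>\<tau>\<in>B'. y \<tau> \<in> CM \<and> (\<forall>q\<in>N \<inter> S. y \<tau> q = 0)"
      "\<forall>\<sigma>\<in>B'. \<forall>\<tau>\<in>B'. \<forall>q\<in>N \<inter> S. \<sigma> q (y \<tau>) = (if \<sigma> = \<tau> then 1 else (0::real))"
      using insert.IH[OF B'B] by (elim exE conjE)
    have y: "\<And>\<tau>. \<tau> \<in> B' \<Longrightarrow> y \<tau> \<in> CM" "\<And>\<tau> q. \<tau> \<in> B' \<Longrightarrow> q \<in> N \<inter> S \<Longrightarrow> y \<tau> q = 0"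
      "\<And>\<sigma> \<tau> q. \<sigma> \<in> B' \<Longrightarrow> \<tau> \<in> B' \<Longrightarrow> q \<in> N \<inter> S \<Longrightarrow> \<sigma> q (y \<tau>) = (if \<sigma> = \<tau> then 1 else (0::real))"
      using y' by blast+
    define u where "u = \<sigma> p - (\<Sum>\<tau>\<in>B'. \<sigma> p (y \<tau>) *\<^sub>R \<tau> p)"
    have sumspan: "(\<Sum>\<tau>\<in>B'. \<sigma> p (y \<tau>) *\<^sub>R \<tau> p) \<in> span ((\<lambda>\<sigma>. \<sigma> p) ` B')"
      by (intro span_sum span_scale span_base) auto
    have "u \<noteq> 0"
    proof
      assume "u = 0"
      then have "\<sigma> p \<in> span ((\<lambda>\<sigma>. \<sigma> p) ` B')" using sumspan by (simp add: u_def)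
      moreover have "(\<lambda>\<sigma>. \<sigma> p) ` B' \<subseteq> (\<lambda>\<sigma>. \<sigma> p) ` B - {\<sigma> p}"
      proof
        fix v assume "v \<in> (\<lambda>\<sigma>. \<sigma> p) ` B'"
        then obtain \<tau> where \<tau>: "\<tau> \<in> B'" "v = \<tau> p" by blast
        then have "\<tau> \<in> B" "\<tau> \<noteq> \<sigma>" using B'B insert.hyps(2) by auto
        then have "\<tau> p \<noteq> \<sigma> p" using inj_on_eq_iff[OF ind(1) _ \<sigma>B] by blast
        then show "v \<in> (\<lambda>\<sigma>. \<sigma> p) ` B - {\<sigma> p}" using \<tau> \<open>\<tau> \<in> B\<close> by simp
      qed
      ultimately have "\<sigma> p \<in> span ((\<lambda>\<sigma>. \<sigma> p) ` B - {\<sigma> p})" using span_mono by blast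
      then show False using ind(2) \<sigma>B unfolding dependent_def by blast
    qed
    have "span ((\<lambda>\<sigma>. \<sigma> p) ` B') \<subseteq> span ((\<lambda>\<sigma>. \<sigma> p) ` B)" using B'B by (intro span_mono image_mono)
    moreover have "\<sigma> p \<in> span ((\<lambda>\<sigma>. \<sigma> p) ` B)" using \<sigma>B by (intro span_base) auto
    ultimately have "u \<in> span ((\<lambda>\<sigma>. \<sigma> p) ` B)"
      unfolding u_def using sumspan by (intro span_diff) auto
    with \<open>u \<noteq> 0\<close> tr have uS: "u \<notin> TanS p" by blast
    have uT: "u \<in> Tan p" unfolding u_def
      using B'B \<sigma>B tan[OF _ pUS]
      by (intro subspace_diff[OF subspace_tangent] subspace_sum[OF subspace_tangent] subspace_scale[OF subspace_tangent]) auto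
    obtain z W where z: "z \<in> CM" "open W" "p \<in> W" "\<And>q. q \<in> W \<inter> S \<Longrightarrow> z q = 0" "u z \<noteq> 0"
      by (rule transverse_detected[OF p uT uS]) (rule that)
    obtain W2 t where W2: "open W2" "p \<in> W2" "\<And>\<tau>. \<tau> \<in> B' \<Longrightarrow> t \<tau> \<in> CM"
      "\<And>\<tau> q. \<tau> \<in> B' \<Longrightarrow> q \<in> W2 \<inter> (U \<inter> S) \<Longrightarrow> \<tau> q z = t \<tau> q"
      by (rule Cinf_extend_finite[OF insert.hyps(1) _ pUS, of "\<lambda>\<tau> q. \<tau> q z"])
        (use sm z(1) B'B in \<open>auto intro: that\<close>)
    \<comment> \<open>Corrects z so that the earlier vectors annihilate it along S near p. As the
      functions \<open>y \<tau>\<close> vanish on S, the Leibniz rule leaves only the terms in which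
      they are differentiated, and \<open>t \<tau>\<close> extends the values of
      \<open>\<tau> q z\<close>.\<close>
    define y0 where "y0 = z - (\<Sum>\<tau>\<in>B'. t \<tau> * y \<tau>)"
    let ?N1 = "N \<inter> W \<inter> W2"
    have tyCM: "(\<Sum>\<tau>\<in>B'. t \<tau> * y \<tau>) \<in> CM" by (intro CM_sum CM_mult W2 y)
    have y0CM: "y0 \<in> CM" unfolding y0_def by (intro CM_diff z(1) tyCM)
    have y00: "y0 q = 0" if "q \<in> ?N1 \<inter> S" for q
      using that y(2)[of _ q] z(4)[of q] by (simp add: y0_def)
    have app: "v y0 = v z - (\<Sum>\<tau>\<in>B'. t \<tau> q * v (y \<tau>))" if v: "v \<in> Tan q" and q: "q \<in> ?N1 \<inter> S" for v q
    proof -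
      have "v y0 = v z - v (\<Sum>\<tau>\<in>B'. t \<tau> * y \<tau>)"
        unfolding y0_def by (rule tangent_diff[OF v z(1) tyCM])
      also have "v (\<Sum>\<tau>\<in>B'. t \<tau> * y \<tau>) = (\<Sum>\<tau>\<in>B'. v (t \<tau> * y \<tau>))"
        by (rule tangent_sum[OF v]) (intro CM_mult W2 y)
      also have "\<dots> = (\<Sum>\<tau>\<in>B'. t \<tau> q * v (y \<tau>))"
        using tangent_mult[OF v] W2(3) y(1) y(2)[of _ q] q by (intro sum.cong) auto
      finally show ?thesis .
    qed
    have y0\<tau>: "\<tau> q y0 = 0" if \<tau>: "\<tau> \<in> B'" and q: "q \<in> ?N1 \<inter> S" for \<tau> q
    proof -
      have qU: "q \<in> U \<inter> S" using q N(3) by auto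
      have "\<tau> q y0 = \<tau> q z - (\<Sum>\<tau>'\<in>B'. t \<tau>' q * (if \<tau> = \<tau>' then 1 else 0))"
        using app[OF tan[OF _ qU, of \<tau>] q] \<tau> B'B y(3)[OF \<tau> _, of _ q] q by auto
      also have "\<dots> = 0" using W2(4)[OF \<tau>, of q] q qU \<tau> insert.hyps(1) by (simp add: if_distrib cong: if_cong)
      finally show ?thesis .
    qed
    \<comment> \<open>Correcting the function z amounts to correcting the vector: \<sigma> sees y0
      as u sees z.\<close>
    have "\<sigma> p y0 = u z"
      using app[OF tan[OF \<sigma>B pUS]] W2(2,4) N z p pUS
      by (auto simp: u_def mult.commute intro!: sum.cong)
    then have y0\<sigma>: "\<sigma> p y0 \<noteq> 0" using z(5) by simp
    obtain W3 H where W3: "open W3" "p \<in> W3" "H \<in> CM" "\<And>q. q \<in> W3 \<inter> (U \<inter> S) \<Longrightarrow> \<sigma> q y0 = H q"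
      by (rule Cinf_localE[OF sm[OF \<sigma>B y0CM] pUS]) (rule that)
    have "H p \<noteq> 0" using W3(2,4) pUS y0\<sigma> by auto
    then obtain g W4 where W4: "g \<in> CM" "open W4" "p \<in> W4" "\<And>q. q \<in> W4 \<Longrightarrow> H q * g q = 1"
      by (rule local_inverse[OF W3(3)]) (rule that)
    \<comment> \<open>Normalises the pairing with \<sigma>, which is nonzero near p along S; since
      y0 vanishes on S, the factor g merely rescales its derivatives there.\<close>
    define yn where "yn = g * y0"
    have ynCM: "yn \<in> CM" unfolding yn_def by (intro CM_mult W4 y0CM)
    let ?N2 = "?N1 \<inter> W3 \<inter> W4"
    have yn0: "yn q = 0" if "q \<in> ?N2 \<inter> S" for q using that y00[of q] by (simp add: yn_def)
    have ynv: "v yn = g q * v y0" if "v \<in> Tan q" "q \<in> ?N2 \<inter> S" for v q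
      using tangent_mult[OF that(1) W4(1) y0CM] y00[of q] that(2) by (simp add: yn_def)
    have yn\<sigma>: "\<sigma> q yn = 1" if q: "q \<in> ?N2 \<inter> S" for q
    proof -
      have "q \<in> U \<inter> S" using q N(3) by auto
      then show ?thesis using ynv[OF tan[OF \<sigma>B] q] W3(4)[of q] W4(4)[of q] q by (simp add: mult.commute)
    qed
    have yn\<tau>: "\<tau> q yn = 0" if \<tau>: "\<tau> \<in> B'" and q: "q \<in> ?N2 \<inter> S" for \<tau> q
    proof -
      have "q \<in> U \<inter> S" using q N(3) by auto
      then show ?thesis using ynv[OF tan[of \<tau>] q] y0\<tau>[OF \<tau>, of q] \<tau> B'B q by auto
    qed
    obtain W5 s where W5: "open W5" "p \<in> W5" "\<And>\<tau>. \<tau> \<in> B' \<Longrightarrow> s \<tau> \<in> CM"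
      "\<And>\<tau> q. \<tau> \<in> B' \<Longrightarrow> q \<in> W5 \<inter> (U \<inter> S) \<Longrightarrow> \<sigma> q (y \<tau>) = s \<tau> q"
      by (rule Cinf_extend_finite[OF insert.hyps(1) _ pUS, of "\<lambda>\<tau> q. \<sigma> q (y \<tau>)"])
        (use sm[OF \<sigma>B] y(1) in \<open>auto intro: that\<close>)
    let ?N3 = "?N2 \<inter> W5"
    \<comment> \<open>The earlier functions lose their derivative along \<sigma>. Their pairings
      with the earlier vectors do not change, because those vectors annihilate
      \<open>yn\<close>.\<close>
    define y1 where "y1 \<tau> = (if \<tau> = \<sigma> then yn else y \<tau> - s \<tau> * yn)" for \<tau>
    have B'\<sigma>: "\<tau> \<noteq> \<sigma>" if "\<tau> \<in> B'" for \<tau> using that insert.hyps by auto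
    have y'v: "v (y1 \<tau>) = v (y \<tau>) - s \<tau> q * v yn" if \<tau>: "\<tau> \<in> B'" and v: "v \<in> Tan q" and q: "q \<in> ?N3 \<inter> S" for v \<tau> q
      using tangent_diff[OF v y(1)[OF \<tau>] CM_mult[OF W5(3)[OF \<tau>] ynCM]] tangent_mult[OF v W5(3)[OF \<tau>] ynCM]
        yn0[of q] q B'\<sigma>[OF \<tau>] by (simp add: y1_def)
    show ?case
    proof (intro exI[of _ y1] exI[of _ ?N3] conjI ballI)
      show "open ?N3" by (intro open_Int N(1) z(2) W2(1) W3(1) W4(2) W5(1))
      show "p \<in> ?N3" "?N3 \<subseteq> U" using N z W2 W3 W4 W5 by auto
    next
      fix \<tau> assume \<tau>: "\<tau> \<in> insert \<sigma> B'"
      show "y1 \<tau> \<in> CM"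
        using \<tau> ynCM CM_diff[OF y(1) CM_mult[OF W5(3) ynCM]] by (auto simp: y1_def)
      fix q assume q: "q \<in> ?N3 \<inter> S"
      show "y1 \<tau> q = 0"
        using \<tau> q yn0[of q] y(2)[of \<tau> q] by (auto simp: y1_def)
    next
      fix \<tau>' \<tau> q assume \<tau>: "\<tau>' \<in> insert \<sigma> B'" "\<tau> \<in> insert \<sigma> B'" and q: "q \<in> ?N3 \<inter> S"
      have qU: "q \<in> U \<inter> S" using q N(3) by auto
      have q2: "q \<in> ?N2 \<inter> S" "q \<in> N \<inter> S" "q \<in> W5 \<inter> (U \<inter> S)" using q qU by auto
      have t: "\<tau>' q \<in> Tan q" using tan[OF _ qU] \<tau>(1) \<sigma>B B'B by auto
      show "\<tau>' q (y1 \<tau>) = (if \<tau>' = \<tau> then 1 else (0::real))"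
      proof (cases "\<tau> = \<sigma>")
        case True
        then show ?thesis using \<tau>(1) yn\<sigma>[OF q2(1)] yn\<tau>[OF _ q2(1)] B'\<sigma> by (auto simp: y1_def)
      next
        case False
        then have \<tau>B: "\<tau> \<in> B'" using \<tau>(2) by simp
        show ?thesis
          using y'v[OF \<tau>B t q] \<tau>(1) yn\<sigma>[OF q2(1)] yn\<tau>[OF _ q2(1)] W5(4)[OF \<tau>B q2(3)] y(3)[OF _ \<tau>B q2(2)] B'\<sigma> \<tau>B
          by (cases "\<tau>' = \<sigma>") auto
      qed
    qed
  qed
  from this[OF B(1) order_refl] show thesis using that by metis
qed

text \<open>A local frame of \<Sigma> is given along S only; here it is replaced by global vector
  fields that agree with it along S near p. The replacement is injective because the frame has
  distinct values at p, so the dual functions can be reindexed.\<close>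

lemma frame_with_duals:
  assumes p: "p \<in> S"
  obtains B y N where "open N" "p \<in> N" "finite B" "\<And>\<tau>. \<tau> \<in> B \<Longrightarrow> y \<tau> \<in> CM"
    "\<And>\<tau> q. \<tau> \<in> B \<Longrightarrow> q \<in> N \<inter> S \<Longrightarrow> y \<tau> q = 0"
    "\<And>\<sigma> \<tau> q. \<sigma> \<in> B \<Longrightarrow> \<tau> \<in> B \<Longrightarrow> q \<in> N \<inter> S \<Longrightarrow> \<sigma> q (y \<tau>) = (if \<sigma> = \<tau> then 1 else (0::real))"
    "\<And>\<tau>. \<tau> \<in> B \<Longrightarrow> \<tau> \<in> VF" "\<And>q. q \<in> N \<inter> S \<Longrightarrow> \<Sigma> q = span ((\<lambda>\<sigma>. \<sigma> q) ` B)"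
proof -
  obtain U B where B: "open U" "p \<in> U" "finite B" "B \<subseteq> vec_sections \<A> (U \<inter> S)"
    "\<forall>q\<in>U \<inter> S. inj_on (\<lambda>\<sigma>. \<sigma> q) B \<and> independent ((\<lambda>\<sigma>. \<sigma> q) ` B) \<and> span ((\<lambda>\<sigma>. \<sigma> q) ` B) = \<Sigma> q"
    using transversal p unfolding transversal_def by meson
  have pUS: "p \<in> U \<inter> S" using B p by simp
  obtain y N where y: "open N" "p \<in> N" "N \<subseteq> U" "\<And>\<tau>. \<tau> \<in> B \<Longrightarrow> y \<tau> \<in> CM"
    "\<And>\<tau> q. \<tau> \<in> B \<Longrightarrow> q \<in> N \<inter> S \<Longrightarrow> y \<tau> q = 0"
    "\<And>\<sigma> \<tau> q. \<sigma> \<in> B \<Longrightarrow> \<tau> \<in> B \<Longrightarrow> q \<in> N \<inter> S \<Longrightarrow> \<sigma> q (y \<tau>) = (if \<sigma> = \<tau> then 1 else (0::real))"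
    by (rule dual_functions[OF p B(1-4)]) (use B(5) pUS Sigma_TanS[OF p] in \<open>auto intro: that\<close>)
  have "\<forall>\<tau>\<in>B. \<exists>V W. open W \<and> p \<in> W \<and> V \<in> VF \<and> (\<forall>q\<in>W \<inter> (U \<inter> S). \<tau> q = V q)"
  proof
    fix \<tau> assume "\<tau> \<in> B"
    then have "\<tau> \<in> vec_sections \<A> (U \<inter> S)" using B(4) by blast
    then show "\<exists>V W. open W \<and> p \<in> W \<and> V \<in> VF \<and> (\<forall>q\<in>W \<inter> (U \<inter> S). \<tau> q = V q)"
      by (rule vec_section_extends[OF _ pUS]) blast
  qed
  then obtain V W where VW: "\<forall>\<tau>\<in>B. open (W \<tau>) \<and> p \<in> W \<tau> \<and> V \<tau> \<in> VF \<and> (\<forall>q\<in>W \<tau> \<inter> (U \<inter> S). \<tau> q = V \<tau> q)"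
    by metis
  let ?N = "N \<inter> (\<Inter>\<tau>\<in>B. W \<tau>)"
  have eq: "\<tau> q = V \<tau> q" if "\<tau> \<in> B" "q \<in> ?N \<inter> S" for \<tau> q using VW that y(3) by auto
  have pN: "p \<in> ?N \<inter> S" using y VW p by auto
  have inj: "inj_on V B"
    by (rule inj_onI) (use eq[OF _ pN] B(5) pUS in \<open>metis inj_onD\<close>)
  let ?i = "the_inv_into B V"
  have i: "?i (V \<tau>) = \<tau>" if "\<tau> \<in> B" for \<tau> by (rule the_inv_into_f_f[OF inj that])
  show thesis
  proof (rule that[of ?N "V ` B" "\<lambda>\<tau>. y (?i \<tau>)"])
    show "open ?N" using y(1) B(3) VW by (intro open_Int open_INT) auto
    show "p \<in> ?N" using pN by simp
    show "finite (V ` B)" using B(3) by simp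
    show "y (?i \<tau>) \<in> CM" if "\<tau> \<in> V ` B" for \<tau> using that y(4) i by auto
    show "y (?i \<tau>) q = 0" if "\<tau> \<in> V ` B" "q \<in> ?N \<inter> S" for \<tau> q using that y(5)[of _ q] i by auto
    show "\<sigma> q (y (?i \<tau>)) = (if \<sigma> = \<tau> then 1 else (0::real))"
      if st: "\<sigma> \<in> V ` B" "\<tau> \<in> V ` B" and q: "q \<in> ?N \<inter> S" for \<sigma> \<tau> q
    proof -
      obtain \<sigma>' \<tau>' where s: "\<sigma>' \<in> B" "\<tau>' \<in> B" "\<sigma> = V \<sigma>'" "\<tau> = V \<tau>'" using st by blast
      have "\<sigma>' q (y \<tau>') = (if \<sigma>' = \<tau>' then 1 else (0::real))" using y(6)[OF s(1,2)] q by blast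
      then show ?thesis using eq[OF s(1) q] i[OF s(2)] inj_on_eq_iff[OF inj s(1,2)] s(3,4) by simp
    qed
    show "\<tau> \<in> VF" if "\<tau> \<in> V ` B" for \<tau> using that VW by auto
    show "\<Sigma> q = span ((\<lambda>\<sigma>. \<sigma> q) ` V ` B)" if q: "q \<in> ?N \<inter> S" for q
    proof -
      have "(\<lambda>\<sigma>. \<sigma> q) ` V ` B = (\<lambda>\<sigma>. \<sigma> q) ` B" unfolding image_image using eq[OF _ q] by (intro image_cong) auto
      then show ?thesis using B(5) q y(3) by auto
    qed
  qed
qed

text \<open>From any local extension F0 of f subtract the dual functions, each weighted with the
  derivative of F0 along its frame field. This keeps the values on S, where the dual functions
  vanish, and kills the derivatives along \<Sigma>; so the differential is the lift of df.\<close>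

lemma dSigma_local_potential:
  assumes f: "f \<in> CS" and p: "p \<in> S"
  obtains F U where "F \<in> CM" "open U" "p \<in> U" "\<And>q. q \<in> U \<inter> S \<Longrightarrow> f q = F q" "\<And>q. q \<in> U \<inter> S \<Longrightarrow> dS f q = dM q F"
    "\<And>q s. q \<in> U \<inter> S \<Longrightarrow> s \<in> \<Sigma> q \<Longrightarrow> s F = 0"
proof -
  obtain B y N where B: "open N" "p \<in> N" "finite B" and y: "\<And>\<tau>. \<tau> \<in> B \<Longrightarrow> y \<tau> \<in> CM"
    "\<And>\<tau> q. \<tau> \<in> B \<Longrightarrow> q \<in> N \<inter> S \<Longrightarrow> y \<tau> q = 0"
    "\<And>\<sigma> \<tau> q. \<sigma> \<in> B \<Longrightarrow> \<tau> \<in> B \<Longrightarrow> q \<in> N \<inter> S \<Longrightarrow> \<sigma> q (y \<tau>) = (if \<sigma> = \<tau> then 1 else (0::real))"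
    and BV: "\<And>\<tau>. \<tau> \<in> B \<Longrightarrow> \<tau> \<in> VF" and \<Sigma>: "\<And>q. q \<in> N \<inter> S \<Longrightarrow> \<Sigma> q = span ((\<lambda>\<sigma>. \<sigma> q) ` B)"
    by (rule frame_with_duals[OF p]) (rule that)
  obtain U F0 where U: "open U" "p \<in> U" "F0 \<in> CM" "\<And>q. q \<in> U \<inter> S \<Longrightarrow> f q = F0 q"
    by (rule Cinf_localE[OF f p]) (rule that)
  define e where "e \<tau> = (\<lambda>q. \<tau> q F0)" for \<tau> :: "'a vfield"
  have e: "e \<tau> \<in> CM" if "\<tau> \<in> B" for \<tau> unfolding e_def by (rule VF_smooth[OF BV[OF that] U(3)])
  define F where "F = F0 - (\<Sum>\<tau>\<in>B. e \<tau> * y \<tau>)"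
  have sCM: "(\<Sum>\<tau>\<in>B. e \<tau> * y \<tau>) \<in> CM" by (intro CM_sum CM_mult e y)
  have F: "F \<in> CM" unfolding F_def by (intro CM_diff U sCM)
  let ?W = "U \<inter> N"
  have fF: "f q = F q" if "q \<in> ?W \<inter> S" for q
    using that U(4)[of q] y(2)[of _ q] by (simp add: F_def)
  have zero: "s F = 0" if q: "q \<in> ?W \<inter> S" and s: "s \<in> \<Sigma> q" for s q
  proof -
    have "span ((\<lambda>\<sigma>. \<sigma> q) ` B) \<subseteq> {v. v F = 0}"
    proof (rule span_minimal)
      show "subspace {v :: 'a tvec. v F = 0}" by (auto simp: subspace_def)
      show "(\<lambda>\<sigma>. \<sigma> q) ` B \<subseteq> {v. v F = 0}"
      proof clarify
        fix \<sigma> assume \<sigma>: "\<sigma> \<in> B"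
        have v: "\<sigma> q \<in> Tan q" by (rule VF_Tan[OF BV[OF \<sigma>]])
        have "\<sigma> q (e \<tau> * y \<tau>) = e \<tau> q * (if \<sigma> = \<tau> then 1 else 0)" if "\<tau> \<in> B" for \<tau>
          using tangent_mult[OF v e[OF that] y(1)[OF that]] y(2)[OF that] y(3)[OF \<sigma> that] q by auto
        then have "\<sigma> q F = \<sigma> q F0 - (\<Sum>\<tau>\<in>B. e \<tau> q * (if \<sigma> = \<tau> then 1 else 0))"
          unfolding F_def using tangent_diff[OF v U(3) sCM] tangent_sum[OF v, of B "\<lambda>\<tau>. e \<tau> * y \<tau>"] CM_mult[OF e y(1)]
          by simp
        then show "\<sigma> q F = 0" using \<sigma> B(3) by (simp add: e_def if_distrib cong: if_cong)
      qed
    qed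
    then show ?thesis using s \<Sigma>[of q] q by auto
  qed
  show thesis
  proof (rule that[OF F])
    show "open ?W" "p \<in> ?W" using U B by auto
    show "f q = F q" if "q \<in> ?W \<inter> S" for q by (rule fF[OF that])
    show "s F = 0" if "q \<in> ?W \<inter> S" "s \<in> \<Sigma> q" for q s by (rule zero[OF that])
    fix q assume q: "q \<in> ?W \<inter> S"
    show "dS f q = dM q F"
      by (rule dSigma_eq_dM[OF _ F f, of q ?W]) (use q fF zero U B in auto)
  qed
qed

lemma conormal_sectionD:
  assumes "\<eta> \<in> CN"
  shows "\<eta> \<in> covec_sections \<A> S" "p \<in> S \<Longrightarrow> \<eta> p \<in> con p" "p \<in> S \<Longrightarrow> \<eta> p \<in> Cot p" "p \<notin> S \<Longrightarrow> \<eta> p = 0"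
    "p \<in> S \<Longrightarrow> u \<in> TanS p \<Longrightarrow> \<eta> p u = 0"
  using assms by (auto simp: conormal_sections_def covec_sections_def conormal_def annihilator_def)

text \<open>The potential is the sum of the dual functions weighted with the values of \<eta> on the
  frame. Its differential agrees with \<eta> on \<Sigma> by duality, and both vanish on TS.\<close>

lemma conormal_local_potential:
  assumes \<eta>: "\<eta> \<in> CN" and p: "p \<in> S"
  obtains F U where "F \<in> CM" "open U" "p \<in> U" "\<And>q. q \<in> U \<inter> S \<Longrightarrow> F q = 0" "\<And>q. q \<in> U \<inter> S \<Longrightarrow> \<eta> q = dM q F"
proof -
  obtain B y N where B: "open N" "p \<in> N" "finite B" and y: "\<And>\<tau>. \<tau> \<in> B \<Longrightarrow> y \<tau> \<in> CM"
    "\<And>\<tau> q. \<tau> \<in> B \<Longrightarrow> q \<in> N \<inter> S \<Longrightarrow> y \<tau> q = 0"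
    "\<And>\<sigma> \<tau> q. \<sigma> \<in> B \<Longrightarrow> \<tau> \<in> B \<Longrightarrow> q \<in> N \<inter> S \<Longrightarrow> \<sigma> q (y \<tau>) = (if \<sigma> = \<tau> then 1 else (0::real))"
    and BV: "\<And>\<tau>. \<tau> \<in> B \<Longrightarrow> \<tau> \<in> VF" and \<Sigma>: "\<And>q. q \<in> N \<inter> S \<Longrightarrow> \<Sigma> q = span ((\<lambda>\<sigma>. \<sigma> q) ` B)"
    by (rule frame_with_duals[OF p]) (rule that)
  obtain U e where U: "open U" "p \<in> U" and e: "\<And>\<tau>. \<tau> \<in> B \<Longrightarrow> e \<tau> \<in> CM"
    "\<And>\<tau> q. \<tau> \<in> B \<Longrightarrow> q \<in> U \<inter> S \<Longrightarrow> \<eta> q (\<tau> q) = e \<tau> q"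
    by (rule Cinf_extend_finite[OF B(3) _ p, of "\<lambda>\<tau> q. \<eta> q (\<tau> q)"])
      (use covec_sections_smooth[OF conormal_sectionD(1)[OF \<eta>] BV] in \<open>auto intro: that\<close>)
  define F where "F = (\<Sum>\<tau>\<in>B. e \<tau> * y \<tau>)"
  have F: "F \<in> CM" unfolding F_def by (intro CM_sum CM_mult e y)
  let ?W = "U \<inter> N"
  have F0: "F q = 0" if "q \<in> ?W \<inter> S" for q
    using that y(2)[of _ q] by (simp add: F_def)
  show thesis
  proof (rule that[OF F _ _ F0])
    show W: "open ?W" "p \<in> ?W" using U B by auto
    fix q assume q: "q \<in> ?W \<inter> S"
    show "\<eta> q = dM q F"
    proof (rule covector_eqI)
      show qS: "q \<in> S" using q by simp
      show "\<eta> q \<in> Cot q" "dM q F \<in> Cot q" using conormal_sectionD(3)[OF \<eta> qS] differential_cotangent by auto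
      show "\<eta> q u = dM q F u" if u: "u \<in> TanS q" for u
      proof -
        have ut: "u \<in> Tan q" by (rule TanS_tangent[OF qS u])
        have "u F = u 0" by (rule TanS_local[OF u qS W(1) _ F CM_zero]) (use q F0 in auto)
        then show ?thesis using conormal_sectionD(5)[OF \<eta> qS u] tangent_zero[OF ut] by (simp add: dM_apply[OF ut])
      qed
      have "span ((\<lambda>\<sigma>. \<sigma> q) ` B) \<subseteq> {v\<in>Tan q. \<eta> q v = v F}"
      proof (rule span_minimal)
        show "subspace {v\<in>Tan q. \<eta> q v = v F}"
          using subspace_tangent[of UNIV q] Cot_lin[OF conormal_sectionD(3)[OF \<eta> qS]]
          by (auto simp: subspace_def lin_on_add lin_on_scale lin_on_zero)
        show "(\<lambda>\<sigma>. \<sigma> q) ` B \<subseteq> {v\<in>Tan q. \<eta> q v = v F}"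
        proof clarify
          fix \<sigma> assume \<sigma>: "\<sigma> \<in> B"
          have v: "\<sigma> q \<in> Tan q" by (rule VF_Tan[OF BV[OF \<sigma>]])
          have "\<sigma> q (e \<tau> * y \<tau>) = e \<tau> q * (if \<sigma> = \<tau> then 1 else 0)" if "\<tau> \<in> B" for \<tau>
            using tangent_mult[OF v e(1)[OF that] y(1)[OF that]] y(2)[OF that] y(3)[OF \<sigma> that] q by auto
          then have "\<sigma> q F = (\<Sum>\<tau>\<in>B. e \<tau> q * (if \<sigma> = \<tau> then 1 else 0))"
            unfolding F_def using tangent_sum[OF v, of B "\<lambda>\<tau>. e \<tau> * y \<tau>"] CM_mult[OF e(1) y(1)]
            by simp
          then show "\<sigma> q \<in> Tan q \<and> \<eta> q (\<sigma> q) = \<sigma> q F"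
            using \<sigma> B(3) v e(2)[OF \<sigma>] q by (simp add: if_distrib cong: if_cong)
        qed
      qed
      then show "\<eta> q s = dM q F s" if "s \<in> \<Sigma> q" for s
        using that \<Sigma>[of q] q by (auto simp: dM_apply)
    qed
  qed
qed


section \<open>Representing elements of P by functions on M\<close>

abbreviation "P \<equiv> P_carrier \<A> S"
abbreviation "Pbr \<equiv> P_bracket \<A> \<Psi> S \<Sigma>"
abbreviation "lp \<equiv> leaf_poisson \<A> \<Psi> S"
abbreviation "DD f \<equiv> \<D> \<A> \<Psi> S \<Sigma> (dS f)"
abbreviation "KK f g \<equiv> \<K> \<A> \<Psi> S \<Sigma> (dS f) (dS g)"
abbreviation "fib \<equiv> fib_bracket \<A> \<Psi> S"

text \<open>Existence of the lift in the definite description: at each point it is the differential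
  of a local potential.\<close>

lemma dSigma_props:
  assumes "f \<in> CS" "p \<in> S"
  shows "dS f p \<in> annihilator \<A> p (\<Sigma> p)" "covec_restr \<A> S p (dS f p) = differential \<A> S p f"
proof -
  obtain F U where F: "F \<in> CM" "open U" "p \<in> U" "\<And>q. q \<in> U \<inter> S \<Longrightarrow> f q = F q" "\<And>q. q \<in> U \<inter> S \<Longrightarrow> dS f q = dM q F"
    "\<And>q s. q \<in> U \<inter> S \<Longrightarrow> s \<in> \<Sigma> q \<Longrightarrow> s F = 0"
    by (rule dSigma_local_potential[OF assms]) (rule that)
  have pU: "p \<in> U \<inter> S" using F assms by simp
  show "dS f p \<in> annihilator \<A> p (\<Sigma> p)"
    unfolding F(5)[OF pU]
    using F(6)[OF pU] Sigma_tangent[OF assms(2)] by (auto simp: annihilator_def differential_cotangent dM_apply)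
  show "covec_restr \<A> S p (dS f p) = differential \<A> S p f"
    unfolding F(5)[OF pU] using covec_restr_dM[OF assms(2) F(1) assms(1) F(2,3)] F(4) by blast
qed

lemma covec_restr_add: "covec_restr \<A> S p (c + c') = covec_restr \<A> S p c + covec_restr \<A> S p c'"
  and covec_restr_scale: "covec_restr \<A> S p (r *\<^sub>R c) = r *\<^sub>R covec_restr \<A> S p c"
  and covec_restr_zero: "covec_restr \<A> S p 0 = 0"
  by (auto simp: covec_restr_def restr_def fun_eq_iff)

lemma dSigma_add: "f \<in> CS \<Longrightarrow> g \<in> CS \<Longrightarrow> p \<in> S \<Longrightarrow> dS (f + g) p = dS f p + dS g p"
  by (rule dSigma_eqI)
    (auto simp: covec_restr_add dSigma_props differential_add intro: subspace_add[OF subspace_annihilator])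

lemma dSigma_scale: "f \<in> CS \<Longrightarrow> p \<in> S \<Longrightarrow> dS (r *\<^sub>R f) p = r *\<^sub>R dS f p"
  by (rule dSigma_eqI)
    (auto simp: covec_restr_scale dSigma_props differential_scale intro: subspace_scale[OF subspace_annihilator])

lemma dSigma_mult: "f \<in> CS \<Longrightarrow> g \<in> CS \<Longrightarrow> p \<in> S \<Longrightarrow> dS (f * g) p = f p *\<^sub>R dS g p + g p *\<^sub>R dS f p"
  by (rule dSigma_eqI)
    (auto simp: covec_restr_add covec_restr_scale dSigma_props differential_mult
      intro!: subspace_add[OF subspace_annihilator] subspace_scale[OF subspace_annihilator] dSigma_props(1))

lemma dSigma_zero: "dS 0 = 0"
proof
  fix p show "dS 0 p = 0 p"
  proof (cases "p \<in> S")
    case True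
    then show ?thesis
      using dSigma_eqI[OF True subspace_0[OF subspace_annihilator], of 0]
      by (simp add: covec_restr_zero differential_zero)
  qed (simp add: d\<Sigma>_def)
qed

lemma dSigma_local:
  assumes "f \<in> CS" "g \<in> CS" "p \<in> S" "open U" "p \<in> U" "\<And>q. q \<in> U \<inter> S \<Longrightarrow> f q = g q"
  shows "dS f p = dS g p"
proof -
  have "differential \<A> S p f = differential \<A> S p g" by (rule differential_local[OF assms(3-5,1,2,6)])
  then show ?thesis by (simp add: d\<Sigma>_def restr_def)
qed

lemma dM_conormal:
  assumes "p \<in> S" "F \<in> CM" "open U" "p \<in> U" "\<And>q. q \<in> U \<inter> S \<Longrightarrow> F q = 0"
  shows "dM p F \<in> con p"
  unfolding conormal_def annihilator_def
proof (intro CollectI conjI ballI differential_cotangent)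
  fix u assume u: "u \<in> TanS p"
  have "u F = u 0" by (rule TanS_local[OF u assms(1,3,4,2) CM_zero]) (use assms in auto)
  then show "dM p F u = 0" using TanS_tangent[OF assms(1) u] by (simp add: dM_apply tangent_zero)
qed

text \<open>The isomorphism of P with C^\<infinity>(M) modulo the square of the vanishing ideal,
  localised at p: near p, x is the class of F, that is, the first-order jet of F along S.\<close>

definition rep :: "'a \<Rightarrow> ('a \<Rightarrow> real) \<Rightarrow> ('a \<Rightarrow> real) \<times> 'a covfield \<Rightarrow> bool" where
  "rep p F x \<longleftrightarrow> F \<in> CM \<and>
     (\<exists>U. open U \<and> p \<in> U \<and> (\<forall>q\<in>U \<inter> S. fst x q = F q \<and> dS (fst x) q + snd x q = dM q F))"

lemma repE:
  assumes "rep p F x"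
  obtains U where "F \<in> CM" "open U" "p \<in> U" "\<And>q. q \<in> U \<inter> S \<Longrightarrow> fst x q = F q"
    "\<And>q. q \<in> U \<inter> S \<Longrightarrow> dS (fst x) q + snd x q = dM q F"
  using assms unfolding rep_def by blast

lemma repI:
  "F \<in> CM \<Longrightarrow> open U \<Longrightarrow> p \<in> U \<Longrightarrow> (\<And>q. q \<in> U \<inter> S \<Longrightarrow> fst x q = F q) \<Longrightarrow>
    (\<And>q. q \<in> U \<inter> S \<Longrightarrow> dS (fst x) q + snd x q = dM q F) \<Longrightarrow> rep p F x"
  unfolding rep_def by blast

lemma P_iff: "x \<in> P \<longleftrightarrow> fst x \<in> CS \<and> snd x \<in> CN"
  by (cases x) (simp add: P_carrier_def)

lemma split_potentials:
  assumes x: "x \<in> P" and p: "p \<in> S"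
  obtains F1 F2 U where "F1 \<in> CM" "F2 \<in> CM" "open U" "p \<in> U"
    "\<And>q. q \<in> U \<inter> S \<Longrightarrow> fst x q = F1 q" "\<And>q. q \<in> U \<inter> S \<Longrightarrow> dS (fst x) q = dM q F1"
    "\<And>q. q \<in> U \<inter> S \<Longrightarrow> F2 q = 0" "\<And>q. q \<in> U \<inter> S \<Longrightarrow> snd x q = dM q F2"
proof -
  have x': "fst x \<in> CS" "snd x \<in> CN" using x P_iff by auto
  obtain F1 U1 where 1: "F1 \<in> CM" "open U1" "p \<in> U1" "\<And>q. q \<in> U1 \<inter> S \<Longrightarrow> fst x q = F1 q"
    "\<And>q. q \<in> U1 \<inter> S \<Longrightarrow> dS (fst x) q = dM q F1"
    by (rule dSigma_local_potential[OF x'(1) p]) (rule that)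
  obtain F2 U2 where 2: "F2 \<in> CM" "open U2" "p \<in> U2" "\<And>q. q \<in> U2 \<inter> S \<Longrightarrow> F2 q = 0"
    "\<And>q. q \<in> U2 \<inter> S \<Longrightarrow> snd x q = dM q F2"
    by (rule conormal_local_potential[OF x'(2) p]) (rule that)
  show thesis
    by (rule that[OF 1(1) 2(1), of "U1 \<inter> U2"]) (use 1 2 in auto)
qed

lemma rep_exists:
  assumes x: "x \<in> P" and p: "p \<in> S"
  obtains F where "rep p F x"
proof -
  obtain F1 F2 U where F: "F1 \<in> CM" "F2 \<in> CM" "open U" "p \<in> U"
    "\<And>q. q \<in> U \<inter> S \<Longrightarrow> fst x q = F1 q" "\<And>q. q \<in> U \<inter> S \<Longrightarrow> dS (fst x) q = dM q F1"
    "\<And>q. q \<in> U \<inter> S \<Longrightarrow> F2 q = 0" "\<And>q. q \<in> U \<inter> S \<Longrightarrow> snd x q = dM q F2"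
    by (rule split_potentials[OF x p]) (rule that)
  have "rep p (F1 + F2) x"
    by (rule repI[OF CM_add[OF F(1,2)] F(3,4)]) (simp_all add: F differential_add)
  then show thesis by (rule that)
qed

lemma P_off: "x \<in> P \<Longrightarrow> q \<notin> S \<Longrightarrow> fst x q = 0" "x \<in> P \<Longrightarrow> q \<notin> S \<Longrightarrow> snd x q = 0"
  using P_iff Cinf_out conormal_sectionD(4) by blast+

text \<open>A common representative determines the function near p, hence its lifted differential at
  p, and thereby the conormal part. Identities in P are thus reduced to identities between functions
  on M.\<close>

lemma P_eqI:
  assumes x: "x \<in> P" and y: "y \<in> P" and r: "\<And>p. p \<in> S \<Longrightarrow> \<exists>F. rep p F x \<and> rep p F y"
  shows "x = y"
proof -
  have "fst x p = fst y p \<and> snd x p = snd y p" for p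
  proof (cases "p \<in> S")
    case True
    obtain F where F: "rep p F x" "rep p F y" using r[OF True] by blast
    obtain U where U: "F \<in> CM" "open U" "p \<in> U" "\<And>q. q \<in> U \<inter> S \<Longrightarrow> fst x q = F q"
      "\<And>q. q \<in> U \<inter> S \<Longrightarrow> dS (fst x) q + snd x q = dM q F" using repE[OF F(1)] by metis
    obtain V where V: "open V" "p \<in> V" "\<And>q. q \<in> V \<inter> S \<Longrightarrow> fst y q = F q"
      "\<And>q. q \<in> V \<inter> S \<Longrightarrow> dS (fst y) q + snd y q = dM q F" using repE[OF F(2)] by metis
    have "dS (fst x) p = dS (fst y) p"
      by (rule dSigma_local[of _ _ p "U \<inter> V"]) (use x y True U V in \<open>auto simp: P_iff\<close>)
    then show ?thesis using U(4)[of p] U(5)[of p] V(3)[of p] V(4)[of p] U(3) V(2) True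
      by (metis IntI add_left_cancel)
  qed (use P_off x y in auto)
  then show ?thesis by (auto simp: prod_eq_iff fun_eq_iff)
qed

text \<open>Smoothness and conormality are read off from representatives, so closure of P under the
  bracket needs no separate regularity argument for \<D>, \<K> and the fibre bracket.\<close>

lemma rep_in_P:
  assumes r: "\<And>p. p \<in> S \<Longrightarrow> \<exists>F. rep p F x" and out: "\<And>q. q \<notin> S \<Longrightarrow> fst x q = 0" "\<And>q. q \<notin> S \<Longrightarrow> snd x q = 0"
  shows "x \<in> P"
proof -
  have f: "fst x \<in> CS"
  proof (rule Cinf_localI)
    fix p assume "p \<in> S"
    then obtain F where "rep p F x" using r by blast
    then show "\<exists>U F. open U \<and> p \<in> U \<and> F \<in> CM \<and> (\<forall>q\<in>U \<inter> S. fst x q = F q)" by (rule repE) blast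
  qed (rule out)
  have pt: "\<exists>U H. open U \<and> p \<in> U \<and> H \<in> CM \<and> (\<forall>q\<in>U \<inter> S. H q = 0 \<and> snd x q = dM q H)" if p: "p \<in> S" for p
  proof -
    obtain F where "rep p F x" using r[OF p] by blast
    then obtain U where U: "F \<in> CM" "open U" "p \<in> U" "\<And>q. q \<in> U \<inter> S \<Longrightarrow> fst x q = F q"
      "\<And>q. q \<in> U \<inter> S \<Longrightarrow> dS (fst x) q + snd x q = dM q F" using repE by metis
    obtain F1 V where 1: "F1 \<in> CM" "open V" "p \<in> V" "\<And>q. q \<in> V \<inter> S \<Longrightarrow> fst x q = F1 q"
      "\<And>q. q \<in> V \<inter> S \<Longrightarrow> dS (fst x) q = dM q F1"
      by (rule dSigma_local_potential[OF f p]) (rule that)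
    \<comment> \<open>Subtracting a potential of the lifted differential leaves a potential of the
      conormal part that vanishes on S.\<close>
    have "(F - F1) q = 0 \<and> snd x q = dM q (F - F1)" if "q \<in> (U \<inter> V) \<inter> S" for q
    proof -
      have "dS (fst x) q + snd x q = dM q F" "dS (fst x) q = dM q F1" using U(5) 1(5) that by blast+
      then have "snd x q = dM q F - dM q F1" by (metis add_diff_cancel_left')
      then show ?thesis using U(4)[of q] 1(4)[of q] that differential_diff[OF U(1) 1(1)] by simp
    qed
    then show ?thesis using U 1 CM_diff by (intro exI[of _ "U \<inter> V"] exI[of _ "F - F1"]) auto
  qed
  have "snd x \<in> CN"
    unfolding conormal_sections_def covec_sections_def
  proof (intro CollectI conjI ballI allI impI)
    fix p assume p: "p \<in> S"
    obtain U H where H: "open U" "p \<in> U" "H \<in> CM" "\<forall>q\<in>U \<inter> S. H q = 0 \<and> snd x q = dM q H" using pt[OF p] by blast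
    show "snd x p \<in> con p" using dM_conormal[OF p H(3,1,2)] H p by auto
    show "snd x p \<in> Cot p" using H p differential_cotangent by auto
  next
    fix V assume V: "V \<in> VF"
    show "(\<lambda>p. snd x p (V p)) \<in> CS"
    proof (rule Cinf_localI)
      fix p assume p: "p \<in> S"
      obtain U H where H: "open U" "p \<in> U" "H \<in> CM" "\<forall>q\<in>U \<inter> S. H q = 0 \<and> snd x q = dM q H" using pt[OF p] by blast
      then show "\<exists>U F. open U \<and> p \<in> U \<and> F \<in> CM \<and> (\<forall>q\<in>U \<inter> S. snd x q (V q) = F q)"
        using VF_smooth[OF V H(3)] by (intro exI[of _ U] exI[of _ "\<lambda>q. V q H"]) (auto simp: dM_apply VF_Tan[OF V])
    qed (simp add: out)
  qed (rule out)
  with f show ?thesis by (simp add: P_iff)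
qed

lemma rep_add:
  assumes xy: "x \<in> P" "y \<in> P" and r: "rep p F x" "rep p G y"
  shows "rep p (F + G) (x + y)"
proof -
  obtain U where U: "F \<in> CM" "open U" "p \<in> U" "\<And>q. q \<in> U \<inter> S \<Longrightarrow> fst x q = F q"
    "\<And>q. q \<in> U \<inter> S \<Longrightarrow> dS (fst x) q + snd x q = dM q F" by (rule repE[OF r(1)]) (rule that)
  obtain V where V: "G \<in> CM" "open V" "p \<in> V" "\<And>q. q \<in> V \<inter> S \<Longrightarrow> fst y q = G q"
    "\<And>q. q \<in> V \<inter> S \<Longrightarrow> dS (fst y) q + snd y q = dM q G" by (rule repE[OF r(2)]) (rule that)
  show ?thesis
  proof (rule repI[OF CM_add[OF U(1) V(1)], of "U \<inter> V"])
    fix q assume q: "q \<in> U \<inter> V \<inter> S"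
    then have e: "dM q F = dS (fst x) q + snd x q" "dM q G = dS (fst y) q + snd y q" using U(5) V(5) by auto
    show "dS (fst (x + y)) q + snd (x + y) q = dM q (F + G)"
      unfolding differential_add[OF U(1) V(1)] e using xy q by (simp add: P_iff dSigma_add)
  qed (use U V in auto)
qed

lemma rep_scale:
  assumes x: "x \<in> P" and r: "rep p F x"
  shows "rep p (r *\<^sub>R F) (r *\<^sub>R x)"
proof -
  obtain U where U: "F \<in> CM" "open U" "p \<in> U" "\<And>q. q \<in> U \<inter> S \<Longrightarrow> fst x q = F q"
    "\<And>q. q \<in> U \<inter> S \<Longrightarrow> dS (fst x) q + snd x q = dM q F" by (rule repE[OF r]) (rule that)
  show ?thesis
  proof (rule repI[OF CM_scale[OF U(1)] U(2,3)])
    fix q assume q: "q \<in> U \<inter> S"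
    show "dS (fst (r *\<^sub>R x)) q + snd (r *\<^sub>R x) q = dM q (r *\<^sub>R F)"
      unfolding differential_scale[OF U(1)] U(5)[OF q, symmetric]
      using x q by (simp add: P_iff dSigma_scale scaleR_add_right)
    show "fst (r *\<^sub>R x) q = (r *\<^sub>R F) q" using U(4)[OF q] by simp
  qed
qed

lemma rep_zero: "rep p 0 0"
  by (rule repI[OF CM_zero open_UNIV]) (auto simp: dSigma_zero differential_zero)

lemma rep_mult:
  assumes "x \<in> P" "y \<in> P" "rep p F x" "rep p G y"
  shows "rep p (F * G) (P_mult x y)"
proof -
  obtain f \<eta> g \<xi> where xy: "x = (f, \<eta>)" "y = (g, \<xi>)" by (cases x, cases y)
  obtain U where U: "F \<in> CM" "open U" "p \<in> U" "\<And>q. q \<in> U \<inter> S \<Longrightarrow> f q = F q"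
    "\<And>q. q \<in> U \<inter> S \<Longrightarrow> dS f q + \<eta> q = dM q F" using repE[OF assms(3)] unfolding xy fst_conv snd_conv by metis
  obtain V where V: "G \<in> CM" "open V" "p \<in> V" "\<And>q. q \<in> V \<inter> S \<Longrightarrow> g q = G q"
    "\<And>q. q \<in> V \<inter> S \<Longrightarrow> dS g q + \<xi> q = dM q G" using repE[OF assms(4)] unfolding xy fst_conv snd_conv by metis
  have fg: "f \<in> CS" "g \<in> CS" using assms xy by (auto simp: P_iff)
  show ?thesis
  proof (rule repI[OF CM_mult[OF U(1) V(1)], of "U \<inter> V"])
    fix q assume q: "q \<in> U \<inter> V \<inter> S"
    then have e: "F q = f q" "dM q F = dS f q + \<eta> q" "G q = g q" "dM q G = dS g q + \<xi> q" using U V by auto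
    show "dS (fst (P_mult x y)) q + snd (P_mult x y) q = dM q (F * G)"
      unfolding differential_mult[OF U(1) V(1)] e
      using q by (simp add: xy P_mult_def dSigma_mult[OF fg] smooth_scale_def scaleR_add_right)
  qed (use U V in \<open>auto simp: xy P_mult_def\<close>)
qed

lemma conormal_part_conormal:
  assumes "p \<in> S" "\<alpha> p \<in> con p"
  shows "conormal_part \<A> S \<Sigma> \<alpha> p = \<alpha> p"
  by (rule conormal_part_eqI[OF assms(1) _ assms(2)])
    (use assms annihilator_Cot subspace_0[OF subspace_annihilator] in \<open>auto simp: conormal_def\<close>)

lemma conormal_part_zero: "conormal_part \<A> S \<Sigma> 0 = 0"
proof
  show "conormal_part \<A> S \<Sigma> 0 p = 0 p" for p
    using conormal_part_conormal[of p 0] subspace_0[OF subspace_annihilator, of p "TanS p"]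
    by (cases "p \<in> S") (auto simp: conormal_def conormal_part_def)
qed

lemma lp_smooth:
  assumes "f \<in> CS" "g \<in> CS"
  shows "lp f g \<in> CS"
proof (rule Cinf_localI)
  fix p assume p: "p \<in> S"
  obtain U F where U: "open U" "p \<in> U" "F \<in> CM" "\<And>q. q \<in> U \<inter> S \<Longrightarrow> f q = F q"
    by (rule Cinf_localE[OF assms(1) p]) (rule that)
  obtain V G where V: "open V" "p \<in> V" "G \<in> CM" "\<And>q. q \<in> V \<inter> S \<Longrightarrow> g q = G q"
    by (rule Cinf_localE[OF assms(2) p]) (rule that)
  have "lp f g q = PB F G q" if "q \<in> (U \<inter> V) \<inter> S" for q
    by (rule leaf_poisson_eq_PB[of q F G f g "U \<inter> V"]) (use that U V assms in auto)
  then show "\<exists>U F. open U \<and> p \<in> U \<and> F \<in> CM \<and> (\<forall>q\<in>U \<inter> S. lp f g q = F q)"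
    using U V PB_smooth by (intro exI[of _ "U \<inter> V"] exI[of _ "PB F G"]) auto
qed (simp add: leaf_poisson_def)

lemma fst_Pbr: "fst (Pbr x y) = lp (fst x) (fst y)"
  by (simp add: P_bracket_def split_beta)

text \<open>Split F = F1 + F2 and G = G1 + G2 into potentials of the lifted differentials and of the
  conormal parts. The mixed terms d{F1, G2} and d{G1, F2} and the term d{F2, G2} are conormal and
  give \<D> and the fibre bracket; d{F1, G1} is the lift of d{f, g} plus \<K>. On S itself only {F1,
  G1} survives, because Hamiltonian vectors are tangent to S and F2, G2 vanish there.\<close>

lemma rep_bracket:
  assumes x: "x \<in> P" and y: "y \<in> P" and p: "p \<in> S" and rF: "rep p F x" and rG: "rep p G y"
  shows "rep p (PB F G) (Pbr x y)"
proof -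
  obtain f \<eta> g \<xi> where xy: "x = (f, \<eta>)" "y = (g, \<xi>)" by (cases x, cases y)
  have fg: "f \<in> CS" "g \<in> CS" using x y xy by (auto simp: P_iff)
  obtain U0 where U0: "F \<in> CM" "open U0" "p \<in> U0" "\<And>q. q \<in> U0 \<inter> S \<Longrightarrow> f q = F q"
    "\<And>q. q \<in> U0 \<inter> S \<Longrightarrow> dS f q + \<eta> q = dM q F" using repE[OF rF] unfolding xy fst_conv snd_conv by metis
  obtain V0 where V0: "G \<in> CM" "open V0" "p \<in> V0" "\<And>q. q \<in> V0 \<inter> S \<Longrightarrow> g q = G q"
    "\<And>q. q \<in> V0 \<inter> S \<Longrightarrow> dS g q + \<xi> q = dM q G" using repE[OF rG] unfolding xy fst_conv snd_conv by metis
  obtain F1 F2 U1 where F: "F1 \<in> CM" "F2 \<in> CM" "open U1" "p \<in> U1"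
    "\<And>q. q \<in> U1 \<inter> S \<Longrightarrow> f q = F1 q" "\<And>q. q \<in> U1 \<inter> S \<Longrightarrow> dS f q = dM q F1"
    "\<And>q. q \<in> U1 \<inter> S \<Longrightarrow> F2 q = 0" "\<And>q. q \<in> U1 \<inter> S \<Longrightarrow> \<eta> q = dM q F2"
    by (rule split_potentials[OF x p, unfolded xy fst_conv snd_conv]) (rule that)
  obtain G1 G2 V1 where G: "G1 \<in> CM" "G2 \<in> CM" "open V1" "p \<in> V1"
    "\<And>q. q \<in> V1 \<inter> S \<Longrightarrow> g q = G1 q" "\<And>q. q \<in> V1 \<inter> S \<Longrightarrow> dS g q = dM q G1"
    "\<And>q. q \<in> V1 \<inter> S \<Longrightarrow> G2 q = 0" "\<And>q. q \<in> V1 \<inter> S \<Longrightarrow> \<xi> q = dM q G2"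
    by (rule split_potentials[OF y p, unfolded xy fst_conv snd_conv]) (rule that)
  define W where "W = U0 \<inter> V0 \<inter> U1 \<inter> V1"
  have W: "open W" "p \<in> W" unfolding W_def using U0 V0 F G by (auto intro!: open_Int)
  have WS: "q \<in> U0 \<inter> S" "q \<in> V0 \<inter> S" "q \<in> U1 \<inter> S" "q \<in> V1 \<inter> S" if "q \<in> W \<inter> S" for q
    using that by (auto simp: W_def)
  have LB: "leaf_bracket \<A> \<Psi> S \<alpha> \<beta> q = dM q (PB A B)"
    if "A \<in> CM" "B \<in> CM" "q \<in> W \<inter> S" "\<And>q. q \<in> W \<inter> S \<Longrightarrow> \<alpha> q = dM q A" "\<And>q. q \<in> W \<inter> S \<Longrightarrow> \<beta> q = dM q B" for A B \<alpha> \<beta> q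
    by (rule leaf_bracket_dM[OF _ that(1,2) W(1)]) (use that in auto)
  have z2: "PB H A q = 0" if "H \<in> CM" "A \<in> CM" "\<And>q. q \<in> W \<inter> S \<Longrightarrow> A q = 0" "q \<in> W \<inter> S" for H A q
  proof -
    have "PB H A q = PB H 0 q" by (rule PB_leaf_local[OF _ that(1) W(1) _ that(2) CM_zero]) (use that in auto)
    then show ?thesis using PB_scale_right[OF CM_zero, of H 0] by (simp add: fun_eq_iff)
  qed
  have z1: "PB A H q = 0" if "H \<in> CM" "A \<in> CM" "\<And>q. q \<in> W \<inter> S \<Longrightarrow> A q = 0" "q \<in> W \<inter> S" for H A q
    using z2[OF that] PB_skew[of A H] by simp
  have lpq: "lp f g q = PB F1 G1 q" if "q \<in> W \<inter> S" for q
    by (rule leaf_poisson_eq_PB[OF _ F(1) G(1) fg W(1)]) (use that F(5) G(5) WS in auto)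
  have D: "DD f \<xi> q = dM q (PB F1 G2)" if q: "q \<in> W \<inter> S" for q
  proof -
    have e: "leaf_bracket \<A> \<Psi> S (dS f) \<xi> q = dM q (PB F1 G2)"
      by (rule LB[OF F(1) G(2) q]) (use F G WS in auto)
    have "dM q (PB F1 G2) \<in> con q"
      by (rule dM_conormal[OF _ PB_smooth[OF F(1) G(2)] W(1)]) (use q z2[OF F(1) G(2)] G(7) WS in auto)
    then show ?thesis using conormal_part_conormal[of q "leaf_bracket \<A> \<Psi> S (dS f) \<xi>"] q e by (simp add: \<D>_def)
  qed
  have D': "DD g \<eta> q = dM q (PB G1 F2)" if q: "q \<in> W \<inter> S" for q
  proof -
    have e: "leaf_bracket \<A> \<Psi> S (dS g) \<eta> q = dM q (PB G1 F2)"
      by (rule LB[OF G(1) F(2) q]) (use F G WS in auto)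
    have "dM q (PB G1 F2) \<in> con q"
      by (rule dM_conormal[OF _ PB_smooth[OF G(1) F(2)] W(1)]) (use q z2[OF G(1) F(2)] F(7) WS in auto)
    then show ?thesis using conormal_part_conormal[of q "leaf_bracket \<A> \<Psi> S (dS g) \<eta>"] q e by (simp add: \<D>_def)
  qed
  \<comment> \<open>On TS the differential of {F1, G1} agrees with the lift of d{f, g}, so the
    difference is conormal; it is the full conormal part because the lift annihilates
    \<Sigma>.\<close>
  have K: "KK f g q = dM q (PB F1 G1) - dS (lp f g) q" if q: "q \<in> W \<inter> S" for q
    unfolding \<K>_def
  proof (rule conormal_part_eqI)
    show qS: "q \<in> S" using q by simp
    have e: "leaf_bracket \<A> \<Psi> S (dS f) (dS g) q = dM q (PB F1 G1)"
      by (rule LB[OF F(1) G(1) q]) (use F G WS in auto)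
    show "leaf_bracket \<A> \<Psi> S (dS f) (dS g) q \<in> Cot q" unfolding e by (rule differential_cotangent)
    note pr = dSigma_props[OF lp_smooth[OF fg] qS]
    show "leaf_bracket \<A> \<Psi> S (dS f) (dS g) q - (dM q (PB F1 G1) - dS (lp f g) q) \<in> annihilator \<A> q (\<Sigma> q)"
      unfolding e using pr(1) by simp
    have "covec_restr \<A> S q (dM q (PB F1 G1)) = covec_restr \<A> S q (dS (lp f g) q)"
      unfolding pr(2) by (rule covec_restr_dM[OF qS PB_smooth[OF F(1) G(1)] lp_smooth[OF fg] W(1)]) (use q lpq in auto)
    then show "dM q (PB F1 G1) - dS (lp f g) q \<in> con q"
      using subspace_diff[OF subspace_Cot differential_cotangent annihilator_Cot[OF pr(1)]]
      unfolding covec_restr_eq_iff conormal_def annihilator_def by simp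
  qed
  have Fi: "fib \<eta> \<xi> q = dM q (PB F2 G2)" if q: "q \<in> W \<inter> S" for q
    unfolding fib_bracket_def by (rule LB[OF F(2) G(2) q]) (use F G WS in auto)
  let ?F = "F1 + F2" and ?G = "G1 + G2"
  have FG: "?F \<in> CM" "?G \<in> CM" using F G CM_add by auto
  have dFG: "dM q F = dM q ?F" "dM q G = dM q ?G" if "q \<in> W \<inter> S" for q
    using U0(5)[OF WS(1)[OF that]] V0(5)[OF WS(2)[OF that]] F(6,8)[OF WS(3)[OF that]] G(6,8)[OF WS(4)[OF that]]
      differential_add F(1,2) G(1,2) by auto
  have sum: "PB ?F ?G = PB F1 G1 + PB F1 G2 + PB F2 G1 + PB F2 G2"
    by (simp add: PB_add_left PB_add_right F G CM_add algebra_simps)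
  show ?thesis
  proof (rule repI[OF PB_smooth[OF U0(1) V0(1)] W])
    fix q assume q: "q \<in> W \<inter> S"
    have "PB F G q = PB ?F ?G q" using dFG[OF q] by (simp add: PB_apply)
    also have "\<dots> = PB F1 G1 q" unfolding sum
      using z1[OF G(1) F(2) _ q] z1[OF G(2) F(2) _ q] z2[OF F(1) G(2) _ q] F(7) G(7) WS by auto
    finally show "fst (Pbr x y) q = PB F G q" using lpq[OF q] by (simp add: xy P_bracket_def)
    \<comment> \<open>F and F1 + F2 are only known to have equal differentials along S, and likewise
      for G. That their brackets also have equal differentials holds because both are the leaf
      bracket of the same sections.\<close>
    have "dM q (PB F G) = leaf_bracket \<A> \<Psi> S (\<lambda>q. dM q F) (\<lambda>q. dM q G) q"
      by (rule LB[OF U0(1) V0(1) q, symmetric]) auto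
    also have "\<dots> = dM q (PB ?F ?G)" by (rule LB[OF FG q]) (use dFG in auto)
    also have "\<dots> = dM q (PB F1 G1) + dM q (PB F1 G2) + dM q (PB F2 G1) + dM q (PB F2 G2)"
      unfolding sum by (simp add: differential_add PB_smooth F G CM_add)
    also have "dM q (PB F2 G1) = - dM q (PB G1 F2)"
      using differential_scale[OF PB_smooth[OF G(1) F(2)], of q "- 1"] PB_skew[of F2 G1] by simp
    finally have dPB: "dM q (PB F G) = dM q (PB F1 G1) + dM q (PB F1 G2) + - dM q (PB G1 F2) + dM q (PB F2 G2)" .
    have "snd (Pbr x y) q = dM q (PB F1 G2) - dM q (PB G1 F2) + dM q (PB F2 G2) + (dM q (PB F1 G1) - dS (lp f g) q)"
      using D[OF q] D'[OF q] K[OF q] Fi[OF q] by (simp add: xy P_bracket_def)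
    moreover have "l + (a - b + c + (d - l)) = d + a + - b + c" for a b c d l :: "'z::ab_group_add"
      by (simp add: algebra_simps)
    ultimately show "dS (fst (Pbr x y)) q + snd (Pbr x y) q = dM q (PB F G)"
      by (simp only: fst_Pbr xy fst_conv dPB)
  qed
qed

lemma Pbr_off: "q \<notin> S \<Longrightarrow> fst (Pbr x y) q = 0" "q \<notin> S \<Longrightarrow> snd (Pbr x y) q = 0"
  by (simp_all add: P_bracket_def split_beta leaf_poisson_def \<D>_def \<K>_def conormal_part_def fib_bracket_def leaf_bracket_def)

section \<open>The Poisson algebra laws of P, inherited from functions on M\<close>

lemma P_add: "x \<in> P \<Longrightarrow> y \<in> P \<Longrightarrow> x + y \<in> P"
  by (rule rep_in_P) (metis rep_exists rep_add, simp_all add: P_off)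

lemma P_scale: "x \<in> P \<Longrightarrow> r *\<^sub>R x \<in> P"
  by (rule rep_in_P) (metis rep_exists rep_scale, simp_all add: P_off)

lemma P_zero: "0 \<in> P"
  by (rule rep_in_P) (auto intro: rep_zero)

lemma P_mult_closed: "x \<in> P \<Longrightarrow> y \<in> P \<Longrightarrow> P_mult x y \<in> P"
  by (rule rep_in_P)
    (metis rep_exists rep_mult, simp_all add: P_off P_mult_def split_beta smooth_scale_def)

lemma Pbr_closed: "x \<in> P \<Longrightarrow> y \<in> P \<Longrightarrow> Pbr x y \<in> P"
  by (rule rep_in_P) (metis rep_exists rep_bracket, simp_all add: Pbr_off)

lemma Pbr_add_right:
  assumes "x \<in> P" "y \<in> P" "z \<in> P"
  shows "Pbr x (y + z) = Pbr x y + Pbr x z"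
proof (rule P_eqI)
  fix p assume p: "p \<in> S"
  obtain F G H where r: "rep p F x" "rep p G y" "rep p H z" using rep_exists assms p by metis
  have CM: "F \<in> CM" "G \<in> CM" "H \<in> CM" using r by (auto simp: rep_def)
  have "rep p (PB F (G + H)) (Pbr x (y + z))" by (intro rep_bracket rep_add P_add assms p r)
  moreover have "rep p (PB F G + PB F H) (Pbr x y + Pbr x z)"
    by (intro rep_bracket rep_add Pbr_closed assms p r)
  ultimately show "\<exists>F. rep p F (Pbr x (y + z)) \<and> rep p F (Pbr x y + Pbr x z)"
    using PB_add_right[OF CM(2,3)] by auto
qed (intro Pbr_closed P_add assms)+

lemma Pbr_scale_right:
  assumes "x \<in> P" "y \<in> P"
  shows "Pbr x (c *\<^sub>R y) = c *\<^sub>R Pbr x y"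
proof (rule P_eqI)
  fix p assume p: "p \<in> S"
  obtain F G where r: "rep p F x" "rep p G y" using rep_exists assms p by metis
  have CM: "F \<in> CM" "G \<in> CM" using r by (auto simp: rep_def)
  have "rep p (PB F (c *\<^sub>R G)) (Pbr x (c *\<^sub>R y))" by (intro rep_bracket rep_scale P_scale assms p r)
  moreover have "rep p (c *\<^sub>R PB F G) (c *\<^sub>R Pbr x y)"
    by (intro rep_bracket rep_scale Pbr_closed assms p r)
  ultimately show "\<exists>F. rep p F (Pbr x (c *\<^sub>R y)) \<and> rep p F (c *\<^sub>R Pbr x y)"
    using PB_scale_right[OF CM(2)] by auto
qed (intro Pbr_closed P_scale assms)+

lemma Pbr_skew:
  assumes "x \<in> P" "y \<in> P"
  shows "Pbr x y = - Pbr y x"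
proof -
  have "Pbr x y = (-1) *\<^sub>R Pbr y x"
  proof (rule P_eqI)
    fix p assume p: "p \<in> S"
    obtain F G where r: "rep p F x" "rep p G y" using rep_exists assms p by metis
    have "rep p (PB F G) (Pbr x y)" by (intro rep_bracket assms p r)
    moreover have "rep p ((-1) *\<^sub>R PB G F) ((-1) *\<^sub>R Pbr y x)"
      by (intro rep_bracket rep_scale Pbr_closed assms p r)
    ultimately show "\<exists>F. rep p F (Pbr x y) \<and> rep p F ((-1) *\<^sub>R Pbr y x)"
      using PB_skew[of F G] by auto
  qed (intro Pbr_closed P_scale assms)+
  then show ?thesis by simp
qed

lemma Pbr_mult_right:
  assumes "x \<in> P" "y \<in> P" "z \<in> P"
  shows "Pbr x (P_mult y z) = P_mult (Pbr x y) z + P_mult y (Pbr x z)"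
proof (rule P_eqI)
  fix p assume p: "p \<in> S"
  obtain F G H where r: "rep p F x" "rep p G y" "rep p H z" using rep_exists assms p by metis
  have CM: "F \<in> CM" "G \<in> CM" "H \<in> CM" using r by (auto simp: rep_def)
  have "rep p (PB F (G * H)) (Pbr x (P_mult y z))" by (intro rep_bracket rep_mult P_mult_closed assms p r)
  moreover have "rep p (PB F G * H + G * PB F H) (P_mult (Pbr x y) z + P_mult y (Pbr x z))"
    by (intro rep_bracket rep_add rep_mult P_mult_closed Pbr_closed assms p r)
  ultimately show "\<exists>F. rep p F (Pbr x (P_mult y z)) \<and> rep p F (P_mult (Pbr x y) z + P_mult y (Pbr x z))"
    using PB_mult_right[OF CM(2,3)] by (metis add.commute mult.commute)
qed (intro Pbr_closed P_add P_mult_closed assms)+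

lemma Pbr_jacobi:
  assumes "x \<in> P" "y \<in> P" "z \<in> P"
  shows "Pbr x (Pbr y z) + Pbr y (Pbr z x) + Pbr z (Pbr x y) = 0"
proof (rule P_eqI)
  fix p assume p: "p \<in> S"
  obtain F G H where r: "rep p F x" "rep p G y" "rep p H z" using rep_exists assms p by metis
  have CM: "F \<in> CM" "G \<in> CM" "H \<in> CM" using r by (auto simp: rep_def)
  have "rep p (PB F (PB G H) + PB G (PB H F) + PB H (PB F G)) (Pbr x (Pbr y z) + Pbr y (Pbr z x) + Pbr z (Pbr x y))"
    by (intro rep_bracket rep_add P_add Pbr_closed assms p r)
  then show "\<exists>F. rep p F (Pbr x (Pbr y z) + Pbr y (Pbr z x) + Pbr z (Pbr x y)) \<and> rep p F 0"
    using PB_jacobi[OF CM] rep_zero by auto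
qed (intro Pbr_closed P_add P_zero assms)+

text \<open>The bracket is a definite description, so even a zero argument is handled through a
  local potential of the other argument.\<close>

lemma leaf_bracket_zero:
  assumes "\<And>p. p \<in> S \<Longrightarrow> \<exists>F U. F \<in> CM \<and> open U \<and> p \<in> U \<and> (\<forall>q\<in>U \<inter> S. \<alpha> q = dM q F)"
  shows "leaf_bracket \<A> \<Psi> S \<alpha> 0 = 0" "leaf_bracket \<A> \<Psi> S 0 \<alpha> = 0"
proof -
  have "leaf_bracket \<A> \<Psi> S \<alpha> 0 p = 0 \<and> leaf_bracket \<A> \<Psi> S 0 \<alpha> p = 0" for p
  proof (cases "p \<in> S")
    case True
    obtain F U where F: "F \<in> CM" "open U" "p \<in> U" "\<forall>q\<in>U \<inter> S. \<alpha> q = dM q F" using assms[OF True] by blast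
    have z: "PB F 0 = 0" "PB 0 F = 0"
      using PB_scale_right[OF CM_zero, of F 0] PB_skew[of 0 F] by simp_all
    have "leaf_bracket \<A> \<Psi> S \<alpha> 0 p = dM p (PB F 0)" "leaf_bracket \<A> \<Psi> S 0 \<alpha> p = dM p (PB 0 F)"
      by (rule leaf_bracket_dM[OF True _ _ F(2,3)]; use F CM_zero in \<open>auto simp: differential_zero\<close>)+
    then show ?thesis by (simp add: z differential_zero)
  qed (simp add: leaf_bracket_def)
  then show "leaf_bracket \<A> \<Psi> S \<alpha> 0 = 0" "leaf_bracket \<A> \<Psi> S 0 \<alpha> = 0" by (auto simp: fun_eq_iff)
qed

lemma leaf_bracket_zero_dSigma:
  assumes "f \<in> CS" shows "leaf_bracket \<A> \<Psi> S (dS f) 0 = 0" "leaf_bracket \<A> \<Psi> S 0 (dS f) = 0"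
  by (rule leaf_bracket_zero; rule dSigma_local_potential[OF assms], assumption, blast)+

lemma leaf_bracket_zero_conormal:
  assumes "\<eta> \<in> CN" shows "leaf_bracket \<A> \<Psi> S \<eta> 0 = 0" "leaf_bracket \<A> \<Psi> S 0 \<eta> = 0"
  by (rule leaf_bracket_zero; rule conormal_local_potential[OF assms], assumption, blast)+

lemma CN_zero: "0 \<in> CN"
  using P_zero by (simp add: P_iff)

lemma lp_zero: "f \<in> CS \<Longrightarrow> lp f 0 = 0" "f \<in> CS \<Longrightarrow> lp 0 f = 0"
  using Pbr_scale_right[of "(f, 0)" 0 0] Pbr_skew[of "(f, 0)" 0] fst_Pbr[of "(f, 0)" 0] fst_Pbr[of 0 "(f, 0)"]
  by (auto simp: P_iff Cinf_zero CN_zero)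

text \<open>Recovers the triple from the bracket of P on homogeneous elements; algebraic properties
  of \<D>, \<K> and the fibre bracket can then be read off from those of P.\<close>

lemma Pbr_split:
  assumes "f \<in> CS" "g \<in> CS" "\<eta> \<in> CN" "\<xi> \<in> CN"
  shows "Pbr (f, 0) (g, 0) = (lp f g, KK f g)" "Pbr (f, 0) (0, \<xi>) = (0, DD f \<xi>)" "Pbr (0, \<eta>) (0, \<xi>) = (0, fib \<eta> \<xi>)"
    "Pbr (0, \<eta>) (g, 0) = (0, - DD g \<eta>)"
  using assms
  by (auto simp: P_bracket_def \<D>_def \<K>_def fib_bracket_def leaf_bracket_zero_dSigma leaf_bracket_zero_conormal
      leaf_bracket_zero_conormal[OF CN_zero] dSigma_zero conormal_part_zero lp_zero Cinf_zero CN_zero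
      leaf_bracket_zero_conormal[OF CN_zero])

text \<open>Every tangent vector of S is a Hamiltonian vector at its base point, so a Casimir
  function has a differential vanishing on TS. The conclusion concerns \<open>d\<Sigma> f\<close>
  because \<D> and \<K> depend on f only through it.\<close>

lemma lp_nondegenerate:
  assumes f: "f \<in> CS" and z: "\<And>g. g \<in> CS \<Longrightarrow> lp f g = 0"
  shows "dS f = 0"
proof
  fix p show "dS f p = 0 p"
  proof (cases "p \<in> S")
    case p: True
    obtain F U where F: "F \<in> CM" "open U" "p \<in> U" "\<And>q. q \<in> U \<inter> S \<Longrightarrow> f q = F q" "\<And>q. q \<in> U \<inter> S \<Longrightarrow> dS f q = dM q F"
      by (rule dSigma_local_potential[OF f p]) (rule that)
    have "dM p F = 0"
    proof (rule covector_eqI[OF p differential_cotangent subspace_0[OF subspace_Cot]])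
      fix u assume "u \<in> TanS p"
      then obtain a where a: "a \<in> Cot p" "u = shp p a" using TanS_eq_sharp[OF p] by blast
      obtain G where G: "G \<in> CM" "a = dM p G" using Cot_eq_dM[OF a(1)] .
      have "lp f (restr S G) p = PB F G p"
        by (rule leaf_poisson_eq_PB[OF p F(1) G(1) f restr_CM[OF G(1)] F(2,3)]) (use F in auto)
      then have "PB F G p = 0" using z[OF restr_CM[OF G(1)]] by simp
      then show "dM p F u = 0 u"
        unfolding a(2) covec_sharp[OF a(1) differential_cotangent] using PB_skew[of F G]
        by (simp add: G(2) PB_apply fun_eq_iff)
    next
      fix s assume "s \<in> \<Sigma> p"
      then show "dM p F s = 0 s"
        using annihilatorD[OF dSigma_props(1)[OF f p]] F(5)[of p] F(3) p by simp
    qed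
    then show ?thesis using F p by auto
  qed (simp add: d\<Sigma>_def)
qed

text \<open>In an adapted chart S lies in a subspace W, proper because the codimension is positive.
  Pairing the chart with a vector a orthogonal to W gives, after a cutoff, a function that vanishes
  on S and whose derivative at p in direction a is positive; its differential along S is the
  section.\<close>

lemma conormal_nonzero:
  assumes k: "k < DIM('b)" and p: "p \<in> S"
  obtains \<eta> where "\<eta> \<in> CN" "\<eta> p \<noteq> 0"
proof -
  have "embedded_submanifold \<A> k S" using leaf by (simp add: embedded_symplectic_leaf_def)
  then obtain U \<phi> W where c: "(U, \<phi>) \<in> maximal_atlas \<A>" "p \<in> U" and W: "subspace W" "dim W = k" "\<phi> ` (U \<inter> S) = \<phi> ` U \<inter> W"
    using p unfolding embedded_submanifold_def by blast
  have ch: "is_chart (U, \<phi>)" by (rule maximal_is_chart[OF c(1)])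
  have oU: "open U" by (rule chart_open[OF ch])
  obtain a where a: "a \<noteq> 0" "\<And>w. w \<in> span W \<Longrightarrow> orthogonal a w"
    using orthogonal_to_subspace_exists[of W] k W(2) by blast
  obtain b N K where b: "b \<in> CM" "open N" "p \<in> N" "\<And>q. q \<in> N \<Longrightarrow> b q = 1" "N \<subseteq> K"
    "closed K" "K \<subseteq> U" "\<And>q. q \<notin> K \<Longrightarrow> b q = 0"
    by (rule manifold_bump[OF oU c(2)]) (rule that)
  define z where "z q = b q * (a \<bullet> \<phi> q)" for q
  have z: "z \<in> CM"
  proof -
    have "smooth_fun_on U (\<lambda>q. a \<bullet> \<phi> q)"
      by (rule smooth_fun_on_chart_comp[OF c(1) oU order_refl])
        (rule smooth_on_linear[OF chart_range_open[OF ch] bounded_linear_inner_right])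
    then show ?thesis unfolding z_def by (intro smooth_cutoff[OF b(1,6,7) _ oU] b(8))
  qed
  have zS: "z q = 0" if "q \<in> S" for q
  proof (cases "q \<in> U")
    case True
    then have "\<phi> q \<in> W" using that W(3) by blast
    then show ?thesis using a(2)[OF span_base] by (simp add: z_def orthogonal_def)
  next
    case False
    then show ?thesis using b(7,8) by (auto simp: z_def)
  qed
  define v where "v = restr CM (\<lambda>F. 1 * frechet_derivative (F \<circ> inv_into U \<phi>) (at (\<phi> p)) a)"
  have v: "v \<in> Tan p" unfolding v_def by (rule chart_vector[OF c])
  have "((\<lambda>y. a \<bullet> y) has_derivative (\<lambda>y. a \<bullet> y)) (at (\<phi> p))"
    by (rule bounded_linear_imp_has_derivative[OF bounded_linear_inner_right])
  then have "((z \<circ> inv_into U \<phi>) has_derivative (\<lambda>y. a \<bullet> y)) (at (\<phi> p))"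
  proof (rule has_derivative_transform_within_open)
    show "open (\<phi> ` (U \<inter> N))" by (rule chart_image_open[OF ch b(2)])
    show "\<phi> p \<in> \<phi> ` (U \<inter> N)" using c b by blast
    show "a \<bullet> y = (z \<circ> inv_into U \<phi>) y" if "y \<in> \<phi> ` (U \<inter> N)" for y
      using that chart_inv[OF ch] b(4) by (auto simp: z_def)
  qed
  then have "frechet_derivative (z \<circ> inv_into U \<phi>) (at (\<phi> p)) = (\<lambda>y. a \<bullet> y)"
    by (rule frechet_derivative_at[symmetric])
  then have "v z = a \<bullet> a" using z by (simp add: v_def)
  then have "dM p z v \<noteq> 0" using a(1) by (simp add: dM_apply[OF v])
  then have nz: "dM p z \<noteq> 0" by (metis zero_fun_apply)
  define \<eta> where "\<eta> q = (if q \<in> S then dM q z else 0)" for q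
  have "(0, \<eta>) \<in> P"
  proof (rule rep_in_P)
    fix p
    have "rep p z (0, \<eta>)"
      by (rule repI[OF z open_UNIV]) (auto simp: zS \<eta>_def dSigma_zero)
    then show "\<exists>F. rep p F (0, \<eta>)" by blast
  qed (auto simp: \<eta>_def)
  then show thesis
    using that[of \<eta>] p nz by (auto simp: P_iff \<eta>_def)
qed

end


section \<open>Splitting a quotient space\<close>

text \<open>Elements of a quotient are cosets as sets, so the map induced by h is simply the direct
  image.\<close>

lemma linear_image_coset:
  assumes "linear h"
  shows "h ` {v + w |w. w \<in> W} = {h v + w |w. w \<in> h ` W}"
proof
  show "h ` {v + w |w. w \<in> W} \<subseteq> {h v + w |w. w \<in> h ` W}"
    using linear_add[OF assms] by auto
  show "{h v + w |w. w \<in> h ` W} \<subseteq> h ` {v + w |w. w \<in> W}"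
  proof clarify
    fix w assume "w \<in> W"
    then show "h v + h w \<in> h ` {v + w |w. w \<in> W}"
      by (intro image_eqI[of _ _ "v + w"]) (auto simp: linear_add[OF assms])
  qed
qed

lemma coset_eq_iff:
  assumes "subspace W"
  shows "{v + w |w. w \<in> W} = {v' + w |w. w \<in> W} \<longleftrightarrow> v - v' \<in> W"
proof
  assume "{v + w |w. w \<in> W} = {v' + w |w. w \<in> W}"
  moreover have "v + 0 \<in> {v + w |w. w \<in> W}" using subspace_0[OF assms] by blast
  ultimately obtain w where "v + 0 = v' + w" "w \<in> W" by blast
  then show "v - v' \<in> W" by (simp add: algebra_simps)
next
  assume d: "v - v' \<in> W"
  have "v + w \<in> {v' + w |w. w \<in> W}" if "w \<in> W" for w
    using subspace_add[OF assms d that] by (auto intro!: exI[of _ "v - v' + w"])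
  moreover have "v' + w \<in> {v + w |w. w \<in> W}" if "w \<in> W" for w
    using subspace_diff[OF assms that d] by (auto intro!: exI[of _ "w - (v - v')"])
  ultimately show "{v + w |w. w \<in> W} = {v' + w |w. w \<in> W}" by blast
qed

text \<open>Over a field the sequence \<open>0 \<rightarrow> ker \<pi> / (W \<inter> ker \<pi>) \<rightarrow> V / W \<rightarrow> \<pi> V / \<pi> W \<rightarrow> 0\<close> splits: choose a linear
  section of \<open>\<pi>\<close> over \<open>\<pi> V\<close> that maps \<open>\<pi> W\<close> into \<open>W\<close>.\<close>

lemma quotient_rvs_split:
  fixes \<pi> :: "'a::real_vector \<Rightarrow> 'b::real_vector" and \<kappa> :: "'a \<Rightarrow> 'c::real_vector"
  assumes \<pi>: "linear \<pi>" and \<kappa>: "linear \<kappa>" and V: "subspace V" and W: "subspace W" and WV: "W \<subseteq> V"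
    and M: "\<pi> ` V = M" and N: "\<pi> ` W = N"
    and inj: "\<And>x. x \<in> V \<Longrightarrow> \<pi> x = 0 \<Longrightarrow> \<kappa> x = 0 \<Longrightarrow> x = 0"
    and Z: "\<kappa> ` {x \<in> V. \<pi> x = 0} = Z" and B: "\<kappa> ` {x \<in> W. \<pi> x = 0} = B"
  shows "rvs_isomorphic (quotient_rvs V W) (dsum_rvs (quotient_rvs Z B) (quotient_rvs M N))"
proof -
  have sN: "subspace N" and sM: "subspace M" using N M linear_subspace_image[OF \<pi>] V W by auto
  have "subspace {x \<in> W. \<pi> x = 0}"
    using W linear_0[OF \<pi>] linear_add[OF \<pi>] linear_scale[OF \<pi>] by (auto simp: subspace_def)
  then have sB: "subspace B" using B linear_subspace_image[OF \<kappa>] by blast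
  obtain gV where gV: "range gV \<subseteq> V" "linear gV" "\<forall>m\<in>M. \<pi> (gV m) = m"
    using linear_exists_right_inverse_on[OF \<pi> V] M by blast
  obtain gW where gW: "range gW \<subseteq> W" "linear gW" "\<forall>n\<in>N. \<pi> (gW n) = n"
    using linear_exists_right_inverse_on[OF \<pi> W] N by blast
  obtain pN where pN: "range pN \<subseteq> N" "linear pN" "\<forall>n\<in>N. pN n = n"
    using linear_exists_right_inverse_on[OF linear_ident sN] by auto
  \<comment> \<open>\<open>pN\<close> is a linear projection onto N. The N-part of m is lifted into
    W and the rest into V, so g is a section over M that sends N into W.\<close>
  define g where "g m = gW (pN m) + gV (m - pN m)" for m
  have g: "linear g"
    unfolding g_def using gV(2) gW(2) pN(2)
    by (intro linearI) (simp_all add: linear_add linear_diff linear_scale algebra_simps)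
  have NM: "N \<subseteq> M" using M N WV by blast
  have \<pi>g: "\<pi> (g m) = m" if "m \<in> M" for m
  proof -
    have "pN m \<in> N" using pN by blast
    moreover have "m - pN m \<in> M" using subspace_diff[OF sM that] calculation NM by blast
    ultimately show ?thesis using gV(3) gW(3) by (simp add: g_def linear_add[OF \<pi>])
  qed
  have gVin: "g m \<in> V" for m
    unfolding g_def using gV(1) gW(1) WV by (intro subspace_add[OF V]) auto
  have gWin: "g n \<in> W" if "n \<in> N" for n
    unfolding g_def using pN(3) that gW(1) linear_0[OF gV(2)] by (auto simp: subset_iff)
  \<comment> \<open>Applies \<kappa> to the component of v in the kernel of \<pi>. As g maps N into
    W, this component stays in W for v in W, whence h maps W onto B.\<close>
  define h where "h v = \<kappa> (v - g (\<pi> v))" for v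
  have h: "linear h"
    unfolding h_def
    by (intro linearI) (simp_all add: linear_add linear_diff linear_scale \<pi> \<kappa> g algebra_simps
        linear_add[OF \<pi>] linear_add[OF \<kappa>] linear_add[OF g] linear_diff[OF \<kappa>] linear_scale[OF \<pi>] linear_scale[OF \<kappa>] linear_scale[OF g])
  have ker: "v - g (\<pi> v) \<in> V" "\<pi> (v - g (\<pi> v)) = 0" if "v \<in> V" for v
    using that M subspace_diff[OF V that gVin] \<pi>g[of "\<pi> v"] by (auto simp: linear_diff[OF \<pi>])
  have hV: "h v \<in> Z" if "v \<in> V" for v
    unfolding h_def Z[symmetric] using ker[OF that] by blast
  have hW: "h ` W = B"
  proof
    show "h ` W \<subseteq> B"
    proof clarify
      fix w assume w: "w \<in> W"
      then have "w - g (\<pi> w) \<in> W" using subspace_diff[OF W w gWin] N by blast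
      then show "h w \<in> B" unfolding h_def B[symmetric] using ker(2) w WV by blast
    qed
    show "B \<subseteq> h ` W"
    proof
      fix b assume "b \<in> B"
      then obtain w where "w \<in> W" "\<pi> w = 0" "b = \<kappa> w" using B by blast
      then show "b \<in> h ` W" using linear_0[OF g] by (auto simp: h_def intro!: image_eqI[of _ _ w])
    qed
  qed
  \<comment> \<open>Direct images of a coset under both linear maps, which are again cosets of B and
    N.\<close>
  define H where "H X = (h ` X, \<pi> ` X)" for X
  let ?co = "\<lambda>U v. {v + w |w. w \<in> U}"
  have Hco: "H (?co W v) = (?co B (h v), ?co N (\<pi> v))" for v
    unfolding H_def linear_image_coset[OF h] linear_image_coset[OF \<pi>] hW N ..
  have "inj_on H {?co W v |v. v \<in> V}"
  proof (rule inj_onI, clarify)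
    fix v v' assume v: "v \<in> V" "v' \<in> V" and eq: "H (?co W v) = H (?co W v')"
    define d where "d = v - v'"
    have d: "d \<in> V" unfolding d_def by (rule subspace_diff[OF V v])
    have "h v - h v' \<in> B" "\<pi> v - \<pi> v' \<in> N"
      using eq unfolding Hco prod.inject coset_eq_iff[OF sB] coset_eq_iff[OF sN] by auto
    then have dB: "h d \<in> B" and dN: "\<pi> d \<in> N" unfolding d_def by (simp_all add: linear_diff[OF h] linear_diff[OF \<pi>])
    obtain w where w: "w \<in> W" "\<pi> w = 0" "h d = \<kappa> w" using dB B by blast
    have "d - g (\<pi> d) - w = 0"
    proof (rule inj)
      show "d - g (\<pi> d) - w \<in> V" using subspace_diff[OF V ker(1)[OF d]] w WV by blast
      show "\<pi> (d - g (\<pi> d) - w) = 0" using ker(2)[OF d] w by (simp add: linear_diff[OF \<pi>])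
      show "\<kappa> (d - g (\<pi> d) - w) = 0" using w(3) by (simp add: h_def linear_diff[OF \<kappa>])
    qed
    then have "d = g (\<pi> d) + w" by (simp add: algebra_simps)
    then have "d \<in> W" using subspace_add[OF W gWin[OF dN] w(1)] by simp
    then show "?co W v = ?co W v'" unfolding coset_eq_iff[OF W] d_def .
  qed
  moreover have "H ` {?co W v |v. v \<in> V} = {?co B z |z. z \<in> Z} \<times> {?co N m |m. m \<in> M}"
  proof
    show "H ` {?co W v |v. v \<in> V} \<subseteq> {?co B z |z. z \<in> Z} \<times> {?co N m |m. m \<in> M}"
      using Hco hV M by auto
    show "{?co B z |z. z \<in> Z} \<times> {?co N m |m. m \<in> M} \<subseteq> H ` {?co W v |v. v \<in> V}"
    proof clarify
      fix z m assume "z \<in> Z" and m: "m \<in> M"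
      then obtain x where x: "x \<in> V" "\<pi> x = 0" "z = \<kappa> x" using Z by blast
      let ?v = "x + g m"
      have v: "?v \<in> V" using subspace_add[OF V x(1) gVin] .
      have "\<pi> ?v = m" using \<pi>g[OF m] x by (simp add: linear_add[OF \<pi>])
      moreover have "h ?v = z" unfolding h_def calculation using x by simp
      ultimately have "H (?co W ?v) = (?co B z, ?co N m)" using Hco by simp
      moreover have "?co W ?v \<in> {?co W v |v. v \<in> V}" using v by blast
      ultimately show "(?co B z, ?co N m) \<in> H ` {?co W v |v. v \<in> V}" by (metis (no_types, lifting) imageI)
    qed
  qed
  ultimately have bij: "bij_betw H {?co W v |v. v \<in> V} ({?co B z |z. z \<in> Z} \<times> {?co N m |m. m \<in> M})"
    by (simp add: bij_betw_def)
  have im_add: "f ` {x + y |x y. x \<in> X \<and> y \<in> Y} = {x + y |x y. x \<in> f ` X \<and> y \<in> f ` Y}"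
    if "linear f" for f :: "'a \<Rightarrow> 'z::real_vector" and X Y
  proof
    show "f ` {x + y |x y. x \<in> X \<and> y \<in> Y} \<subseteq> {x + y |x y. x \<in> f ` X \<and> y \<in> f ` Y}"
      using linear_add[OF that] by auto
    show "{x + y |x y. x \<in> f ` X \<and> y \<in> f ` Y} \<subseteq> f ` {x + y |x y. x \<in> X \<and> y \<in> Y}"
      using linear_add[OF that] by clarify (metis (mono_tags, lifting) imageI mem_Collect_eq)
  qed
  have im_scale: "f ` {r *\<^sub>R x + w |x w. x \<in> X \<and> w \<in> W} = {r *\<^sub>R x + w |x w. x \<in> f ` X \<and> w \<in> f ` W}"
    if "linear f" for f :: "'a \<Rightarrow> 'z::real_vector" and X r
  proof
    show "f ` {r *\<^sub>R x + w |x w. x \<in> X \<and> w \<in> W} \<subseteq> {r *\<^sub>R x + w |x w. x \<in> f ` X \<and> w \<in> f ` W}"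
    proof clarify
      fix x w assume "x \<in> X" "w \<in> W"
      then show "\<exists>y u. f (r *\<^sub>R x + w) = r *\<^sub>R y + u \<and> y \<in> f ` X \<and> u \<in> f ` W"
        by (intro exI[of _ "f x"] exI[of _ "f w"]) (simp add: linear_add[OF that] linear_scale[OF that])
    qed
    show "{r *\<^sub>R x + w |x w. x \<in> f ` X \<and> w \<in> f ` W} \<subseteq> f ` {r *\<^sub>R x + w |x w. x \<in> X \<and> w \<in> W}"
    proof clarify
      fix x w assume "x \<in> X" "w \<in> W"
      then show "r *\<^sub>R f x + f w \<in> f ` {r *\<^sub>R x + w |x w. x \<in> X \<and> w \<in> W}"
        by (intro image_eqI[of _ _ "r *\<^sub>R x + w"]) (auto simp: linear_add[OF that] linear_scale[OF that])
    qed
  qed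
  show ?thesis
    unfolding rvs_isomorphic_def
    by (rule exI[of _ H])
      (simp add: quotient_rvs_def dsum_rvs_def bij, simp add: H_def im_add[OF h] im_add[OF \<pi>] im_scale[OF h] im_scale[OF \<pi>] hW N)
qed


section \<open>Poisson derivations of the infinitesimal Poisson algebra\<close>

context transversal_leaf
begin

section \<open>Algebra of the Poisson triple, extracted from the bracket of P\<close>

lemma in_P: "(f, \<eta>) \<in> P \<longleftrightarrow> f \<in> CS \<and> \<eta> \<in> CN"
  by (simp add: P_iff)

lemma in_P_zero: "f \<in> CS \<Longrightarrow> (f, 0) \<in> P" "\<eta> \<in> CN \<Longrightarrow> (0, \<eta>) \<in> P"
  by (simp_all add: in_P CN_zero Cinf_zero)

lemma subspace_CN: "subspace CN"
  unfolding subspace_def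
proof (intro conjI ballI allI CN_zero)
  fix \<eta> \<xi> and r :: real assume "\<eta> \<in> CN" "\<xi> \<in> CN"
  then show "\<eta> + \<xi> \<in> CN" using P_add[OF in_P_zero(2) in_P_zero(2), of \<eta> \<xi>] by (simp add: in_P)
next
  fix \<eta> and r :: real assume "\<eta> \<in> CN"
  then show "r *\<^sub>R \<eta> \<in> CN" using P_scale[OF in_P_zero(2), of \<eta> r] by (simp add: in_P)
qed

lemmas CN_add = subspace_add[OF subspace_CN]
lemmas CN_scale = subspace_scale[OF subspace_CN]
lemmas CN_neg = subspace_neg[OF subspace_CN]

lemmas Pbr_comp = Pbr_split(1)[OF _ _ CN_zero CN_zero] Pbr_split(2)[OF _ Cinf_zero CN_zero]
  Pbr_split(3)[OF Cinf_zero Cinf_zero] Pbr_split(4)[OF Cinf_zero _ _ CN_zero]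

lemma P_mult_pair: "P_mult (f, \<eta>) (g, \<xi>) = (f * g, smooth_scale f \<xi> + smooth_scale g \<eta>)"
  by (simp add: P_mult_def)

lemma smooth_scale_add_right: "smooth_scale f (\<eta> + \<xi>) = smooth_scale f \<eta> + smooth_scale f \<xi>"
  and smooth_scale_zero: "smooth_scale 0 \<eta> = 0" "smooth_scale f 0 = 0"
  by (auto simp: smooth_scale_def fun_eq_iff algebra_simps)

lemma smooth_scale_closed: "f \<in> CS \<Longrightarrow> \<eta> \<in> CN \<Longrightarrow> smooth_scale f \<eta> \<in> CN"
  using P_mult_closed[OF in_P_zero] by (simp add: P_mult_pair smooth_scale_zero in_P)

lemma DD_closed: "f \<in> CS \<Longrightarrow> \<xi> \<in> CN \<Longrightarrow> DD f \<xi> \<in> CN"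
  and fib_closed: "\<eta> \<in> CN \<Longrightarrow> \<xi> \<in> CN \<Longrightarrow> fib \<eta> \<xi> \<in> CN"
  and KK_closed: "f \<in> CS \<Longrightarrow> g \<in> CS \<Longrightarrow> KK f g \<in> CN"
  using Pbr_closed[OF in_P_zero(1) in_P_zero(2), of f \<xi>] Pbr_closed[OF in_P_zero(2) in_P_zero(2), of \<eta> \<xi>]
    Pbr_closed[OF in_P_zero(1) in_P_zero(1), of f g]
  by (simp_all add: Pbr_comp in_P Cinf_zero CN_zero)

lemma DD_add: "f \<in> CS \<Longrightarrow> \<eta> \<in> CN \<Longrightarrow> \<xi> \<in> CN \<Longrightarrow> DD f (\<eta> + \<xi>) = DD f \<eta> + DD f \<xi>"
  using Pbr_add_right[OF in_P_zero(1) in_P_zero(2) in_P_zero(2), of f \<eta> \<xi>]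
  by (simp add: Pbr_comp Cinf_zero CN_zero CN_add)

lemma DD_scale: "f \<in> CS \<Longrightarrow> \<eta> \<in> CN \<Longrightarrow> DD f (c *\<^sub>R \<eta>) = c *\<^sub>R DD f \<eta>"
  using Pbr_scale_right[OF in_P_zero(1) in_P_zero(2), of f \<eta> c]
  by (simp add: Pbr_comp Cinf_zero CN_zero CN_scale)

lemma DD_minus: "f \<in> CS \<Longrightarrow> \<eta> \<in> CN \<Longrightarrow> DD f (- \<eta>) = - DD f \<eta>"
  using DD_scale[of f \<eta> "- 1"] by simp

lemma DD_zero: "f \<in> CS \<Longrightarrow> DD f 0 = 0" "\<eta> \<in> CN \<Longrightarrow> DD 0 \<eta> = 0"
  by (simp_all add: \<D>_def dSigma_zero leaf_bracket_zero_dSigma leaf_bracket_zero_conormal conormal_part_zero)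

lemma KK_zero: "g \<in> CS \<Longrightarrow> KK 0 g = 0" "g \<in> CS \<Longrightarrow> KK g 0 = 0"
  by (simp_all add: \<K>_def dSigma_zero leaf_bracket_zero_dSigma conormal_part_zero)

lemma fib_zero: "\<eta> \<in> CN \<Longrightarrow> fib 0 \<eta> = 0" "\<eta> \<in> CN \<Longrightarrow> fib \<eta> 0 = 0"
  by (simp_all add: fib_bracket_def leaf_bracket_zero_conormal)

lemma fib_skew: "\<eta> \<in> CN \<Longrightarrow> \<xi> \<in> CN \<Longrightarrow> fib \<eta> \<xi> = - fib \<xi> \<eta>"
  using Pbr_skew[OF in_P_zero(2) in_P_zero(2), of \<eta> \<xi>] by (simp add: Pbr_comp Cinf_zero)

lemma fib_add_right: "\<eta> \<in> CN \<Longrightarrow> \<xi> \<in> CN \<Longrightarrow> \<zeta> \<in> CN \<Longrightarrow> fib \<eta> (\<xi> + \<zeta>) = fib \<eta> \<xi> + fib \<eta> \<zeta>"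
  using Pbr_add_right[OF in_P_zero(2) in_P_zero(2) in_P_zero(2), of \<eta> \<xi> \<zeta>]
  by (simp add: Pbr_comp Cinf_zero CN_add)

lemma fib_add_left: "\<eta> \<in> CN \<Longrightarrow> \<xi> \<in> CN \<Longrightarrow> \<zeta> \<in> CN \<Longrightarrow> fib (\<xi> + \<zeta>) \<eta> = fib \<xi> \<eta> + fib \<zeta> \<eta>"
  using fib_add_right[of \<eta> \<xi> \<zeta>] fib_skew[of \<eta> \<xi>] fib_skew[of \<eta> \<zeta>] fib_skew[of \<eta> "\<xi> + \<zeta>"] CN_add[of \<xi> \<zeta>]
  by (simp add: algebra_simps)

lemma fib_minus_left: "\<eta> \<in> CN \<Longrightarrow> \<xi> \<in> CN \<Longrightarrow> fib (- \<xi>) \<eta> = - fib \<xi> \<eta>"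
  using Pbr_scale_right[OF in_P_zero(2) in_P_zero(2), of \<eta> \<xi> "- 1"] fib_skew[of \<xi> \<eta>] fib_skew[of "- \<xi>" \<eta>] CN_neg[of \<xi>]
  by (simp add: Pbr_comp Cinf_zero)

lemma Pbr_add_left:
  assumes "x \<in> P" "y \<in> P" "z \<in> P"
  shows "Pbr (y + z) x = Pbr y x + Pbr z x"
  using Pbr_add_right[OF assms] Pbr_skew[OF assms(2,1)] Pbr_skew[OF assms(3,1)] Pbr_skew[OF P_add[OF assms(2,3)] assms(1)]
  by simp

lemma Pbr_scale_left: "x \<in> P \<Longrightarrow> y \<in> P \<Longrightarrow> Pbr (c *\<^sub>R y) x = c *\<^sub>R Pbr y x"
  using Pbr_scale_right[of x y c] Pbr_skew[of x y] Pbr_skew[OF P_scale[of y c], of x] by simp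

subsection \<open>Hamiltonian derivations\<close>

abbreviation "PoissP \<equiv> Poiss \<A> \<Psi> S \<Sigma>"
abbreviation "HamP \<equiv> Ham \<A> \<Psi> S \<Sigma>"

lemma Ham_subset_Poiss: "HamP \<subseteq> PoissP"
proof
  fix X assume "X \<in> HamP"
  then obtain \<pi> where X: "X = restr P (Pbr \<pi>)" and \<pi>: "\<pi> \<in> P" by (auto simp: Ham_def)
  show "X \<in> PoissP"
    unfolding Poiss_def lin_on_def
  proof (intro CollectI conjI ballI allI impI)
    fix x y assume xy: "x \<in> P" "y \<in> P"
    show "X (x + y) = X x + X y" using xy \<pi> by (simp add: X P_add Pbr_add_right)
    show "X (P_mult x y) = P_mult (X x) y + P_mult x (X y)"
      using xy \<pi> by (simp add: X P_mult_closed Pbr_mult_right)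
    have "Pbr \<pi> (Pbr x y) + Pbr x (Pbr y \<pi>) + Pbr y (Pbr \<pi> x) = 0" by (rule Pbr_jacobi[OF \<pi> xy])
    moreover have "Pbr x (Pbr y \<pi>) = - Pbr x (Pbr \<pi> y)"
      using Pbr_skew[OF xy(2) \<pi>] Pbr_scale_right[OF xy(1) Pbr_closed[OF \<pi> xy(2)], of "- 1"] by simp
    moreover have "Pbr y (Pbr \<pi> x) = - Pbr (Pbr \<pi> x) y" by (rule Pbr_skew[OF xy(2) Pbr_closed[OF \<pi> xy(1)]])
    ultimately show "X (Pbr x y) = Pbr (X x) y + Pbr x (X y)"
      using xy \<pi> by (simp add: X Pbr_closed algebra_simps)
  qed (use \<pi> in \<open>auto simp: X P_scale Pbr_scale_right Pbr_closed\<close>)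
qed

lemma subspace_Ham: "subspace HamP"
  unfolding subspace_def
proof (intro conjI ballI allI)
  have "restr P (Pbr 0) = 0"
    using Pbr_scale_left[OF _ P_zero, of _ 0] by (auto simp: restr_def fun_eq_iff)
  then show "0 \<in> HamP" using P_zero unfolding Ham_def by (metis (mono_tags, lifting) mem_Collect_eq)
  fix X Y assume "X \<in> HamP" "Y \<in> HamP"
  then obtain \<pi> \<rho> where X: "X = restr P (Pbr \<pi>)" "\<pi> \<in> P" "Y = restr P (Pbr \<rho>)" "\<rho> \<in> P" by (auto simp: Ham_def)
  have "X + Y = restr P (Pbr (\<pi> + \<rho>))"
    using X Pbr_add_left[OF _ X(2,4)] by (auto simp: restr_def fun_eq_iff)
  then show "X + Y \<in> HamP" using P_add[OF X(2,4)] unfolding Ham_def by blast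
next
  fix c X assume "X \<in> HamP"
  then obtain \<pi> where X: "X = restr P (Pbr \<pi>)" "\<pi> \<in> P" by (auto simp: Ham_def)
  have "c *\<^sub>R X = restr P (Pbr (c *\<^sub>R \<pi>))"
    using X Pbr_scale_left[OF _ X(2)] by (auto simp: restr_def fun_eq_iff)
  then show "c *\<^sub>R X \<in> HamP" using P_scale[OF X(2)] unfolding Ham_def by blast
qed

lemma P_mult_add: "P_mult (x + x') y = P_mult x y + P_mult x' y" "P_mult y (x + x') = P_mult y x + P_mult y x'"
  and P_mult_scale: "P_mult (c *\<^sub>R x) y = c *\<^sub>R P_mult x y" "P_mult y (c *\<^sub>R x) = c *\<^sub>R P_mult y x"
  by (auto simp: P_mult_def split_beta smooth_scale_def fun_eq_iff algebra_simps prod_eq_iff)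

lemma subspace_Poiss: "subspace PoissP"
  unfolding subspace_def
proof (intro conjI ballI allI)
  have P0: "P_mult 0 y = 0" "P_mult y 0 = 0" for y :: "('a \<Rightarrow> real) \<times> 'a covfield"
    using P_mult_scale(1)[of 0 0 y] P_mult_scale(2)[of y 0 0] by simp_all
  show "0 \<in> PoissP"
    using P_zero Pbr_scale_left[OF _ P_zero, of _ 0] Pbr_scale_right[OF _ P_zero, of _ 0]
    by (auto simp: Poiss_def lin_on_def P0)
  fix X Y assume XY: "X \<in> PoissP" "Y \<in> PoissP"
  show "X + Y \<in> PoissP"
    using XY P_add unfolding Poiss_def lin_on_def
    by (auto simp: P_mult_add Pbr_add_left Pbr_add_right algebra_simps)
next
  fix c X assume X: "X \<in> PoissP"
  show "c *\<^sub>R X \<in> PoissP"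
    using X P_scale unfolding Poiss_def lin_on_def
    by (auto simp: P_mult_scale Pbr_scale_left Pbr_scale_right algebra_simps)
qed

subsection \<open>The components of a Poisson derivation\<close>

text \<open>The derivation laws are evaluated on pairs from the two summands. For two functions \<K>
  couples the components: the failure of Q to be a cocycle is measured by the action of l and L on
  \<K>.\<close>

lemma Poiss_components:
  assumes X: "X \<in> PoissP"
  defines "l \<equiv> \<lambda>f. fst (X (f, 0))" and "Q \<equiv> \<lambda>f. snd (X (f, 0))" and "L \<equiv> \<lambda>\<eta>. snd (X (0, \<eta>))"
  shows "\<And>f \<eta>. f \<in> CS \<Longrightarrow> \<eta> \<in> CN \<Longrightarrow> X (f, \<eta>) = (l f, Q f + L \<eta>)"
    and "\<And>f. f \<in> CS \<Longrightarrow> l f \<in> CS" "\<And>f. f \<in> CS \<Longrightarrow> Q f \<in> CN" "\<And>\<eta>. \<eta> \<in> CN \<Longrightarrow> L \<eta> \<in> CN"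
    and "\<And>f g. f \<in> CS \<Longrightarrow> g \<in> CS \<Longrightarrow> l (f + g) = l f + l g" "\<And>f g. f \<in> CS \<Longrightarrow> g \<in> CS \<Longrightarrow> Q (f + g) = Q f + Q g"
      "\<And>\<eta> \<xi>. \<eta> \<in> CN \<Longrightarrow> \<xi> \<in> CN \<Longrightarrow> L (\<eta> + \<xi>) = L \<eta> + L \<xi>"
    and "\<And>f r. f \<in> CS \<Longrightarrow> l (r *\<^sub>R f) = r *\<^sub>R l f" "\<And>f r. f \<in> CS \<Longrightarrow> Q (r *\<^sub>R f) = r *\<^sub>R Q f"
      "\<And>\<eta> r. \<eta> \<in> CN \<Longrightarrow> L (r *\<^sub>R \<eta>) = r *\<^sub>R L \<eta>"
    and "\<And>f g. f \<in> CS \<Longrightarrow> g \<in> CS \<Longrightarrow> l (f * g) = f * l g + g * l f"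
      "\<And>f g. f \<in> CS \<Longrightarrow> g \<in> CS \<Longrightarrow> Q (f * g) = smooth_scale f (Q g) + smooth_scale g (Q f)"
      "\<And>f \<eta>. f \<in> CS \<Longrightarrow> \<eta> \<in> CN \<Longrightarrow> L (smooth_scale f \<eta>) = smooth_scale f (L \<eta>) + smooth_scale (l f) \<eta>"
    and "\<And>f g. f \<in> CS \<Longrightarrow> g \<in> CS \<Longrightarrow> l (lp f g) = lp (l f) g + lp f (l g)"
      "\<And>f g. f \<in> CS \<Longrightarrow> g \<in> CS \<Longrightarrow> Q (lp f g) + L (KK f g) = KK (l f) g - DD g (Q f) + (KK f (l g) + DD f (Q g))"
      "\<And>f \<xi>. f \<in> CS \<Longrightarrow> \<xi> \<in> CN \<Longrightarrow> L (DD f \<xi>) = DD (l f) \<xi> + fib (Q f) \<xi> + DD f (L \<xi>)"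
      "\<And>\<eta> \<xi>. \<eta> \<in> CN \<Longrightarrow> \<xi> \<in> CN \<Longrightarrow> L (fib \<eta> \<xi>) = fib (L \<eta>) \<xi> + fib \<eta> (L \<xi>)"
proof -
  have X': "\<And>x y. x \<in> P \<Longrightarrow> y \<in> P \<Longrightarrow> X (x + y) = X x + X y" "\<And>x r. x \<in> P \<Longrightarrow> X (r *\<^sub>R x) = r *\<^sub>R X x"
    "\<And>x. x \<in> P \<Longrightarrow> X x \<in> P" "\<And>x y. x \<in> P \<Longrightarrow> y \<in> P \<Longrightarrow> X (P_mult x y) = P_mult (X x) y + P_mult x (X y)"
    "\<And>x y. x \<in> P \<Longrightarrow> y \<in> P \<Longrightarrow> X (Pbr x y) = Pbr (X x) y + Pbr x (X y)"
    using X by (auto simp: Poiss_def lin_on_def)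
  have X1: "X (f, 0) = (l f, Q f)" for f by (simp add: l_def Q_def)
  show cl: "\<And>f. f \<in> CS \<Longrightarrow> l f \<in> CS" "\<And>f. f \<in> CS \<Longrightarrow> Q f \<in> CN" "\<And>\<eta>. \<eta> \<in> CN \<Longrightarrow> L \<eta> \<in> CN"
    using X'(3)[OF in_P_zero(1)] X'(3)[OF in_P_zero(2)] unfolding l_def Q_def L_def P_iff by blast+
  have X2: "X (0, \<eta>) = (0, L \<eta>)" if \<eta>: "\<eta> \<in> CN" for \<eta>
  proof -
    define h where "h = fst (X (0, \<eta>))"
    have Xh: "X (0, \<eta>) = (h, L \<eta>)" by (simp add: h_def L_def)
    have h: "h \<in> CS" using X'(3)[OF in_P_zero(2)[OF \<eta>]] by (simp add: h_def P_iff)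
    have "X (0, 0) = (0, 0)" using X'(2)[OF P_zero, of 0] by (simp add: zero_prod_def)
    then have X0: "X (0, 0) = (0, 0)" "l 0 = 0" "Q 0 = 0" by (simp_all add: X1)
    define s where "s = smooth_scale h \<eta>"
    have "(0, 0) = P_mult (h, L \<eta>) (0, \<eta>) + P_mult (0, \<eta>) (h, L \<eta>)"
      using X'(4)[OF in_P_zero(2)[OF \<eta>] in_P_zero(2)[OF \<eta>]] unfolding Xh
      by (simp only: P_mult_pair smooth_scale_zero add_0 mult_zero_left X0)
    then have "s + s = 0" unfolding s_def by (simp add: P_mult_pair smooth_scale_zero)
    then have "2 *\<^sub>R s = 0" by (simp only: scaleR_2)
    then have s0: "s = 0" unfolding scaleR_eq_0_iff by simp
    have "X (P_mult (h, 0) (0, \<eta>)) = X (0, s)"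
      unfolding s_def by (simp only: P_mult_pair smooth_scale_zero add_0_right mult_zero_right)
    then have "(0, 0) = P_mult (l h, Q h) (0, \<eta>) + P_mult (h, 0) (h, L \<eta>)"
      using X'(4)[OF in_P_zero(1)[OF h] in_P_zero(2)[OF \<eta>]] unfolding Xh X1 s0 X0 by simp
    then have "h * h = 0" by (simp add: P_mult_pair)
    then have "h = 0" by (auto simp: fun_eq_iff)
    then show ?thesis using Xh by simp
  qed
  show XX: "X (f, \<eta>) = (l f, Q f + L \<eta>)" if "f \<in> CS" "\<eta> \<in> CN" for f \<eta>
    using X'(1)[OF in_P_zero(1)[OF that(1)] in_P_zero(2)[OF that(2)]] X1 X2[OF that(2)] by simp
  show "l (f + g) = l f + l g" "Q (f + g) = Q f + Q g" if "f \<in> CS" "g \<in> CS" for f g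
    using X'(1)[OF in_P_zero(1) in_P_zero(1), OF that] by (simp_all add: X1)
  show "L (\<eta> + \<xi>) = L \<eta> + L \<xi>" if "\<eta> \<in> CN" "\<xi> \<in> CN" for \<eta> \<xi>
    using X'(1)[OF in_P_zero(2) in_P_zero(2), OF that] by (simp_all add: X2 that CN_add)
  show "l (r *\<^sub>R f) = r *\<^sub>R l f" "Q (r *\<^sub>R f) = r *\<^sub>R Q f" if "f \<in> CS" for f r
    using X'(2)[OF in_P_zero(1), OF that, of r] by (simp_all add: X1)
  show "L (r *\<^sub>R \<eta>) = r *\<^sub>R L \<eta>" if "\<eta> \<in> CN" for \<eta> r
    using X'(2)[OF in_P_zero(2), OF that, of r] by (simp_all add: X2 that CN_scale)
  show "l (f * g) = f * l g + g * l f" "Q (f * g) = smooth_scale f (Q g) + smooth_scale g (Q f)" if "f \<in> CS" "g \<in> CS" for f g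
    using X'(4)[OF in_P_zero(1) in_P_zero(1), OF that] by (simp_all add: X1 P_mult_pair smooth_scale_zero algebra_simps)
  show "L (smooth_scale f \<eta>) = smooth_scale f (L \<eta>) + smooth_scale (l f) \<eta>" if "f \<in> CS" "\<eta> \<in> CN" for f \<eta>
    using X'(4)[OF in_P_zero(1) in_P_zero(2), OF that] by (simp_all add: X1 X2 that P_mult_pair smooth_scale_zero smooth_scale_closed algebra_simps)
  have PX: "Pbr (f, \<eta>) y = Pbr (f, 0) y + Pbr (0, \<eta>) y" "Pbr y (f, \<eta>) = Pbr y (f, 0) + Pbr y (0, \<eta>)"
    if "f \<in> CS" "\<eta> \<in> CN" "y \<in> P" for f \<eta> y
    using Pbr_add_left[OF that(3) in_P_zero(1)[OF that(1)] in_P_zero(2)[OF that(2)]]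
      Pbr_add_right[OF that(3) in_P_zero(1)[OF that(1)] in_P_zero(2)[OF that(2)]] by simp_all
  show "l (lp f g) = lp (l f) g + lp f (l g)"
    "Q (lp f g) + L (KK f g) = KK (l f) g - DD g (Q f) + (KK f (l g) + DD f (Q g))" if "f \<in> CS" "g \<in> CS" for f g
    using X'(5)[OF in_P_zero(1) in_P_zero(1), OF that]
      PX(1)[OF cl(1)[OF that(1)] cl(2)[OF that(1)] in_P_zero(1)[OF that(2)]]
      PX(2)[OF cl(1)[OF that(2)] cl(2)[OF that(2)] in_P_zero(1)[OF that(1)]]
      XX[OF lp_smooth[OF that] KK_closed[OF that]]
    by (simp_all add: X1 that cl Pbr_comp)
  show "L (DD f \<xi>) = DD (l f) \<xi> + fib (Q f) \<xi> + DD f (L \<xi>)" if "f \<in> CS" "\<xi> \<in> CN" for f \<xi>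
    using X'(5)[OF in_P_zero(1) in_P_zero(2), OF that]
      PX(1)[OF cl(1)[OF that(1)] cl(2)[OF that(1)] in_P_zero(2)[OF that(2)]]
    by (simp add: X1 X2 that cl Pbr_comp DD_closed)
  show "L (fib \<eta> \<xi>) = fib (L \<eta>) \<xi> + fib \<eta> (L \<xi>)" if "\<eta> \<in> CN" "\<xi> \<in> CN" for \<eta> \<xi>
    using X'(5)[OF in_P_zero(2) in_P_zero(2), OF that]
    by (simp add: X2 that cl Pbr_comp fib_closed)
qed

text \<open>The converse of \<open>Poiss_components\<close>: product and bracket are biadditive, so
  the laws on homogeneous elements add up to the laws on P.\<close>

lemma Poiss_I:
  assumes cl: "\<And>f. f \<in> CS \<Longrightarrow> l f \<in> CS" "\<And>f. f \<in> CS \<Longrightarrow> Q f \<in> CN" "\<And>\<eta>. \<eta> \<in> CN \<Longrightarrow> L \<eta> \<in> CN"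
    and add: "\<And>f g. f \<in> CS \<Longrightarrow> g \<in> CS \<Longrightarrow> l (f + g) = l f + l g" "\<And>f g. f \<in> CS \<Longrightarrow> g \<in> CS \<Longrightarrow> Q (f + g) = Q f + Q g"
      "\<And>\<eta> \<xi>. \<eta> \<in> CN \<Longrightarrow> \<xi> \<in> CN \<Longrightarrow> L (\<eta> + \<xi>) = L \<eta> + L \<xi>"
    and scale: "\<And>f r. f \<in> CS \<Longrightarrow> l (r *\<^sub>R f) = r *\<^sub>R l f" "\<And>f r. f \<in> CS \<Longrightarrow> Q (r *\<^sub>R f) = r *\<^sub>R Q f"
      "\<And>\<eta> r. \<eta> \<in> CN \<Longrightarrow> L (r *\<^sub>R \<eta>) = r *\<^sub>R L \<eta>"
    and mult: "\<And>f g. f \<in> CS \<Longrightarrow> g \<in> CS \<Longrightarrow> l (f * g) = f * l g + g * l f"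
      "\<And>f g. f \<in> CS \<Longrightarrow> g \<in> CS \<Longrightarrow> Q (f * g) = smooth_scale f (Q g) + smooth_scale g (Q f)"
      "\<And>f \<eta>. f \<in> CS \<Longrightarrow> \<eta> \<in> CN \<Longrightarrow> L (smooth_scale f \<eta>) = smooth_scale f (L \<eta>) + smooth_scale (l f) \<eta>"
    and br: "\<And>f g. f \<in> CS \<Longrightarrow> g \<in> CS \<Longrightarrow> l (lp f g) = lp (l f) g + lp f (l g)"
      "\<And>f g. f \<in> CS \<Longrightarrow> g \<in> CS \<Longrightarrow> Q (lp f g) + L (KK f g) = KK (l f) g - DD g (Q f) + (KK f (l g) + DD f (Q g))"
      "\<And>f \<xi>. f \<in> CS \<Longrightarrow> \<xi> \<in> CN \<Longrightarrow> L (DD f \<xi>) = DD (l f) \<xi> + fib (Q f) \<xi> + DD f (L \<xi>)"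
      "\<And>\<eta> \<xi>. \<eta> \<in> CN \<Longrightarrow> \<xi> \<in> CN \<Longrightarrow> L (fib \<eta> \<xi>) = fib (L \<eta>) \<xi> + fib \<eta> (L \<xi>)"
  shows "restr P (\<lambda>x. (l (fst x), Q (fst x) + L (snd x))) \<in> PoissP" (is "?X \<in> _")
proof -
  define X where "X = ?X"
  have X: "X (f, \<eta>) = (l f, Q f + L \<eta>)" if "f \<in> CS" "\<eta> \<in> CN" for f \<eta> using that by (simp add: X_def in_P)
  have Lneg: "L (- \<eta>) = - L \<eta>" if "\<eta> \<in> CN" for \<eta> using scale(3)[OF that, of "- 1"] by simp
  have Pb: "Pbr (f, \<eta>) (g, \<xi>) = (lp f g, DD f \<xi> + - DD g \<eta> + fib \<eta> \<xi> + KK f g)" for f g \<eta> \<xi>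
    by (simp add: P_bracket_def)
  show ?thesis
    unfolding X_def[symmetric] Poiss_def lin_on_def
  proof (intro CollectI conjI ballI allI impI)
    fix x assume x: "x \<in> P"
    obtain f \<eta> where x': "x = (f, \<eta>)" "f \<in> CS" "\<eta> \<in> CN" using x by (cases x) (auto simp: in_P)
    show "X x \<in> P" using x' by (simp add: X in_P cl CN_add)
    show "X (r *\<^sub>R x) = r *\<^sub>R X x" for r
      using x' by (simp add: X cl Cinf_scale CN_scale scale scaleR_add_right)
    fix y assume y: "y \<in> P"
    obtain g \<xi> where y': "y = (g, \<xi>)" "g \<in> CS" "\<xi> \<in> CN" using y by (cases y) (auto simp: in_P)
    show "X (x + y) = X x + X y"
      using x' y' by (simp add: X Cinf_add CN_add add add_ac)
    have "X (P_mult x y) = (l (f * g), Q (f * g) + L (smooth_scale f \<xi> + smooth_scale g \<eta>))"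
      using x' y' X[OF Cinf_mult CN_add[OF smooth_scale_closed smooth_scale_closed]] by (simp add: P_mult_def)
    also have "\<dots> = P_mult (l f, Q f + L \<eta>) (g, \<xi>) + P_mult (f, \<eta>) (l g, Q g + L \<xi>)"
      using x' y' by (simp add: P_mult_def mult add smooth_scale_closed smooth_scale_add_right algebra_simps)
    finally show "X (P_mult x y) = P_mult (X x) y + P_mult x (X y)" using x' y' X by simp
    have cls: "DD f \<xi> \<in> CN" "- DD g \<eta> \<in> CN" "fib \<eta> \<xi> \<in> CN" "KK f g \<in> CN" "lp f g \<in> CS" "DD g \<eta> \<in> CN"
      using x' y' by (auto simp: DD_closed fib_closed KK_closed lp_smooth CN_neg)
    have "X (Pbr x y) = (l (lp f g), Q (lp f g) + L (DD f \<xi> + - DD g \<eta> + fib \<eta> \<xi> + KK f g))"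
      unfolding x' y' Pb by (rule X[OF cls(5) CN_add[OF CN_add[OF CN_add[OF cls(1,2)] cls(3)] cls(4)]])
    also have "L (DD f \<xi> + - DD g \<eta> + fib \<eta> \<xi> + KK f g) = L (DD f \<xi>) + - L (DD g \<eta>) + L (fib \<eta> \<xi>) + L (KK f g)"
      using cls CN_add by (simp only: add Lneg)
    finally have 1: "X (Pbr x y) = (l (lp f g), Q (lp f g) + (L (DD f \<xi>) + - L (DD g \<eta>) + L (fib \<eta> \<xi>) + L (KK f g)))" .
    have "Q (lp f g) + (L (DD f \<xi>) + - L (DD g \<eta>) + L (fib \<eta> \<xi>) + L (KK f g)) =
        L (DD f \<xi>) + - L (DD g \<eta>) + L (fib \<eta> \<xi>) + (Q (lp f g) + L (KK f g))" by (simp only: add_ac)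
    also have "\<dots> = (DD (l f) \<xi> + fib (Q f) \<xi> + DD f (L \<xi>)) + - (DD (l g) \<eta> + fib (Q g) \<eta> + DD g (L \<eta>)) +
        (fib (L \<eta>) \<xi> + fib \<eta> (L \<xi>)) + (KK (l f) g - DD g (Q f) + (KK f (l g) + DD f (Q g)))"
      using x' y' by (simp only: br)
    finally have "Q (lp f g) + (L (DD f \<xi>) + - L (DD g \<eta>) + L (fib \<eta> \<xi>) + L (KK f g)) =
        (DD (l f) \<xi> + fib (Q f) \<xi> + DD f (L \<xi>)) + - (DD (l g) \<eta> + fib (Q g) \<eta> + DD g (L \<eta>)) +
        (fib (L \<eta>) \<xi> + fib \<eta> (L \<xi>)) + (KK (l f) g - DD g (Q f) + (KK f (l g) + DD f (Q g)))" .
    \<comment> \<open>The law for g and \<eta> produces Q g as the first argument, whereas {(f,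
      \<eta>), X(g, \<xi>)} has it as the second.\<close>
    moreover have "fib (Q g) \<eta> = - fib \<eta> (Q g)" using x' y' cl by (intro fib_skew) auto
    ultimately have 2: "Q (lp f g) + (L (DD f \<xi>) + - L (DD g \<eta>) + L (fib \<eta> \<xi>) + L (KK f g)) =
       DD (l f) \<xi> + fib (Q f) \<xi> + DD f (L \<xi>) + - (DD (l g) \<eta> + - fib \<eta> (Q g) + DD g (L \<eta>)) +
        (fib (L \<eta>) \<xi> + fib \<eta> (L \<xi>)) + (KK (l f) g - DD g (Q f) + (KK f (l g) + DD f (Q g)))" by (simp only:)
    have "snd (Pbr (l f, Q f + L \<eta>) (g, \<xi>) + Pbr (f, \<eta>) (l g, Q g + L \<xi>)) =
        DD (l f) \<xi> + - (DD g (Q f) + DD g (L \<eta>)) + (fib (Q f) \<xi> + fib (L \<eta>) \<xi>) + KK (l f) g +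
        (DD f (Q g) + DD f (L \<xi>) + - DD (l g) \<eta> + (fib \<eta> (Q g) + fib \<eta> (L \<xi>)) + KK f (l g))"
      using x' y' cl by (simp only: Pb snd_add snd_conv DD_add fib_add_left fib_add_right)
    moreover have rearrange: "a + - (n + i) + (b + j) + m + (s + c + - d + (e + k) + q) =
        a + b + c + - (d + - e + i) + (j + k) + (m - n + (q + s))" for a b c d e i j k m n q s :: "'z::ab_group_add"
      by (simp add: algebra_simps)
    ultimately have "snd (Pbr (l f, Q f + L \<eta>) (g, \<xi>) + Pbr (f, \<eta>) (l g, Q g + L \<xi>)) =
        DD (l f) \<xi> + fib (Q f) \<xi> + DD f (L \<xi>) + - (DD (l g) \<eta> + - fib \<eta> (Q g) + DD g (L \<eta>)) +
        (fib (L \<eta>) \<xi> + fib \<eta> (L \<xi>)) + (KK (l f) g - DD g (Q f) + (KK f (l g) + DD f (Q g)))"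
      by (elim trans) (rule rearrange)
    then have 3: "snd (Pbr (l f, Q f + L \<eta>) (g, \<xi>) + Pbr (f, \<eta>) (l g, Q g + L \<xi>)) =
        Q (lp f g) + (L (DD f \<xi>) + - L (DD g \<eta>) + L (fib \<eta> \<xi>) + L (KK f g))"
      by (rule trans[OF _ 2[symmetric]])
    have "fst (Pbr (l f, Q f + L \<eta>) (g, \<xi>) + Pbr (f, \<eta>) (l g, Q g + L \<xi>)) = l (lp f g)"
      using x' y' by (simp add: Pb br)
    with 3 have "X (Pbr x y) = Pbr (l f, Q f + L \<eta>) (g, \<xi>) + Pbr (f, \<eta>) (l g, Q g + L \<xi>)"
      unfolding 1 by (metis prod.collapse)
    then show "X (Pbr x y) = Pbr (X x) y + Pbr x (X y)" using x' y' X by simp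
  qed (simp add: X_def)
qed


subsection \<open>The kernel and the image of the projection to derivations of the bundle of Lie algebras\<close>

text \<open>The component called L, defined for all maps X and not only for derivations, so that it
  is linear on the whole space of maps as the splitting lemma requires.\<close>

definition fibre_part :: "(('a \<Rightarrow> real) \<times> 'a covfield \<Rightarrow> ('a \<Rightarrow> real) \<times> 'a covfield) \<Rightarrow> 'a covfield \<Rightarrow> 'a covfield" where
  "fibre_part X = restr CN (\<lambda>\<eta>. snd (X (0, \<eta>)))"

text \<open>The component called Q, encoded as a function on one-element lists to match 1-cochains.
  It is linear in every X, but its values are known to be central only when the fibre part of a
  Poisson derivation vanishes.\<close>

definition mixed_part :: "(('a \<Rightarrow> real) \<times> 'a covfield \<Rightarrow> ('a \<Rightarrow> real) \<times> 'a covfield) \<Rightarrow> ('a \<Rightarrow> real) list \<Rightarrow> 'a covfield" where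
  "mixed_part X = restr (cochain_args \<A> S 1) (\<lambda>fs. snd (X (hd fs, 0)))"

abbreviation "centre \<equiv> center_sections \<A> \<Psi> S"

lemma linear_fibre_part: "linear fibre_part"
  by (rule linearI) (auto simp: fibre_part_def restr_def fun_eq_iff)

lemma linear_mixed_part: "linear mixed_part"
  by (rule linearI) (auto simp: mixed_part_def restr_def fun_eq_iff)

lemma cochain_args_1: "fs \<in> cochain_args \<A> S 1 \<longleftrightarrow> (\<exists>f\<in>CS. fs = [f])"
  by (auto simp: cochain_args_def length_Suc_conv)

lemma cochain_args_0: "fs \<in> cochain_args \<A> S 0 \<longleftrightarrow> fs = []"
  by (auto simp: cochain_args_def)

lemma cochain_args_2: "fs \<in> cochain_args \<A> S (Suc 1) \<longleftrightarrow> (\<exists>f\<in>CS. \<exists>g\<in>CS. fs = [f, g])"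
  by (auto simp: cochain_args_def length_Suc_conv)

lemma cochain_diff_0:
  assumes "f \<in> CS"
  shows "cochain_diff \<A> \<Psi> S \<Sigma> 0 Q [f] = DD f (Q [])"
proof -
  have e: "{(i, j). i < j \<and> j \<le> (0::nat)} = {}" by auto
  have "[f] \<in> cochain_args \<A> S (Suc 0)" using assms by (simp add: cochain_args_def)
  then show ?thesis unfolding cochain_diff_def e by (simp add: nths_Cons)
qed

lemma cochain_diff_1:
  assumes "f \<in> CS" "g \<in> CS"
  shows "cochain_diff \<A> \<Psi> S \<Sigma> 1 Q [f, g] = DD f (Q [g]) - DD g (Q [f]) - Q [lp f g]"
proof -
  have e: "{(i, j). i < j \<and> j \<le> (1::nat)} = {(0, 1)}" "{..1} = {0, 1::nat}" by auto
  have "[f, g] \<in> cochain_args \<A> S (Suc 1)" using assms by (simp add: cochain_args_def)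
  then show ?thesis unfolding cochain_diff_def e by (simp add: nths_Cons)
qed

lemma centerD: "\<zeta> \<in> centre \<Longrightarrow> \<zeta> \<in> CN" "\<zeta> \<in> centre \<Longrightarrow> \<xi> \<in> CN \<Longrightarrow> fib \<zeta> \<xi> = 0"
  by (simp_all add: center_sections_def)

lemma fibre_part_Ham:
  assumes "f \<in> CS" "\<eta> \<in> CN"
  shows "fibre_part (restr P (Pbr (f, \<eta>))) = restr CN (DD f) + restr CN (fib \<eta>)"
proof
  fix \<xi>
  show "fibre_part (restr P (Pbr (f, \<eta>))) \<xi> = (restr CN (DD f) + restr CN (fib \<eta>)) \<xi>"
  proof (cases "\<xi> \<in> CN")
    case True
    have "Pbr (f, \<eta>) (0, \<xi>) = Pbr (f, 0) (0, \<xi>) + Pbr (0, \<eta>) (0, \<xi>)"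
      using Pbr_add_left[OF in_P_zero(2)[OF True] in_P_zero(1)[OF assms(1)] in_P_zero(2)[OF assms(2)]] by simp
    then show ?thesis using True assms by (simp add: fibre_part_def in_P_zero Pbr_comp)
  qed (simp add: fibre_part_def)
qed

lemma fibre_part_image_Ham:
  "fibre_part ` HamP = {\<L> + \<L>' |\<L> \<L>'. \<L> \<in> \<C> \<A> \<Psi> S \<Sigma> \<and> \<L>' \<in> Inn \<A> \<Psi> S}"
proof
  show "fibre_part ` HamP \<subseteq> {\<L> + \<L>' |\<L> \<L>'. \<L> \<in> \<C> \<A> \<Psi> S \<Sigma> \<and> \<L>' \<in> Inn \<A> \<Psi> S}"
  proof
    fix Y assume "Y \<in> fibre_part ` HamP"
    then obtain f \<eta> where f\<eta>: "(f, \<eta>) \<in> P" "Y = fibre_part (restr P (Pbr (f, \<eta>)))" by (auto simp: Ham_def)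
    then have "Y = restr CN (DD f) + restr CN (fib \<eta>)" using fibre_part_Ham by (simp add: in_P)
    moreover have "restr CN (DD f) \<in> \<C> \<A> \<Psi> S \<Sigma>" "restr CN (fib \<eta>) \<in> Inn \<A> \<Psi> S"
      using f\<eta>(1) unfolding \<C>_def Inn_def in_P by blast+
    ultimately show "Y \<in> {\<L> + \<L>' |\<L> \<L>'. \<L> \<in> \<C> \<A> \<Psi> S \<Sigma> \<and> \<L>' \<in> Inn \<A> \<Psi> S}" by blast
  qed
  show "{\<L> + \<L>' |\<L> \<L>'. \<L> \<in> \<C> \<A> \<Psi> S \<Sigma> \<and> \<L>' \<in> Inn \<A> \<Psi> S} \<subseteq> fibre_part ` HamP"
  proof clarify
    fix Y Y' assume "Y \<in> \<C> \<A> \<Psi> S \<Sigma>" "Y' \<in> Inn \<A> \<Psi> S"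
    then obtain f \<eta> where f: "f \<in> CS" "Y = restr CN (DD f)" and \<eta>: "\<eta> \<in> CN" "Y' = restr CN (fib \<eta>)"
      unfolding \<C>_def Inn_def by blast
    have "restr P (Pbr (f, \<eta>)) \<in> HamP" using f(1) \<eta>(1) in_P unfolding Ham_def by blast
    then show "Y + Y' \<in> fibre_part ` HamP" using fibre_part_Ham[OF f(1) \<eta>(1)] f(2) \<eta>(2) by (metis imageI)
  qed
qed

lemma fibre_part_image_subset: "fibre_part ` PoissP \<subseteq> \<MM> \<A> \<Psi> S \<Sigma>"
proof
  fix Y assume "Y \<in> fibre_part ` PoissP"
  then obtain X where X: "X \<in> PoissP" and Y: "Y = fibre_part X" by blast
  define l where "l f = fst (X (f, 0))" for f
  define Q where "Q f = snd (X (f, 0))" for f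
  define L where "L \<eta> = snd (X (0, \<eta>))" for \<eta>
  note c = Poiss_components[OF X, folded l_def Q_def L_def]
  have YL: "Y \<eta> = L \<eta>" if "\<eta> \<in> CN" for \<eta> using that by (simp add: Y fibre_part_def L_def)
  \<comment> \<open>The derivation l is turned into a field of tangent vectors by evaluating at p;
    \<theta> below is obtained from -Q in the same way.\<close>
  define v where "v p = restr CS (\<lambda>f. l f p)" for p
  have va: "vf_apply v f = l f" if "f \<in> CS" for f using that by (simp add: vf_apply_def v_def)
  have v: "v \<in> vector_fields \<A> S"
    unfolding vector_fields_def tangent_def lin_on_def
    using c(2) Cinf_out[OF c(2)]
    by (auto simp: v_def Cinf_add Cinf_scale Cinf_mult c restr_def fun_eq_iff)
  have assoc: "associated_field \<A> \<Psi> S Y v"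
    unfolding associated_field_def using v
    by (simp add: va lp_smooth c YL smooth_scale_closed)
  define \<theta> where "\<theta> p = (if p \<in> S then restr CS (\<lambda>f. - Q f p) else 0)" for p
  have \<theta>a: "cvf_apply \<theta> f = - Q f" if "f \<in> CS" for f
    using that conormal_sectionD(4)[OF c(3)[OF that]] by (auto simp: cvf_apply_def \<theta>_def fun_eq_iff)
  have con: "- Q f p \<in> con p" if "f \<in> CS" "p \<in> S" for f p
    using conormal_sectionD(2)[OF c(3)[OF that(1)] that(2)] subspace_neg[OF subspace_annihilator] by (auto simp: conormal_def)
  have \<theta>: "\<theta> \<in> conormal_valued_fields \<A> S"
    unfolding conormal_valued_fields_def lin_on_def
  proof (intro CollectI conjI ballI allI impI)
    fix f assume f: "f \<in> CS"
    show "(\<lambda>p. \<theta> p f) \<in> CN" using \<theta>a[OF f] CN_neg[OF c(3)[OF f]] by (simp add: cvf_apply_def)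
    fix p assume p: "p \<in> S"
    show "\<theta> p f \<in> con p" using con f p by (simp add: \<theta>_def)
    show "\<theta> p (r *\<^sub>R f) = r *\<^sub>R \<theta> p f" for r using f p by (simp add: \<theta>_def Cinf_scale c)
    fix g assume g: "g \<in> CS"
    show "\<theta> p (f + g) = \<theta> p f + \<theta> p g" using f g p by (simp add: \<theta>_def Cinf_add c)
    show "\<theta> p (f * g) = f p *\<^sub>R \<theta> p g + g p *\<^sub>R \<theta> p f"
      using f g p by (simp add: \<theta>_def Cinf_mult c smooth_scale_def)
  qed (auto simp: \<theta>_def)
  have "Y \<in> PDer \<A> \<Psi> S"
    unfolding PDer_def lin_on_def
    using assoc by (auto simp: YL CN_add CN_scale c fib_closed) (auto simp: Y fibre_part_def)
  moreover have "DD f (Y \<eta>) - Y (DD f \<eta>) + DD (vf_apply v f) \<eta> = fib (cvf_apply \<theta> f) \<eta>"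
    if f: "f \<in> CS" and \<eta>: "\<eta> \<in> CN" for f \<eta>
  proof -
    have 1: "DD f (L \<eta>) - (a + b + DD f (L \<eta>)) + a = - b" for a b :: "'a covfield" by simp
    show ?thesis
      unfolding YL[OF \<eta>] YL[OF DD_closed[OF that]] va[OF f] \<theta>a[OF f] fib_minus_left[OF \<eta> c(3)[OF f]]
        c(16)[OF that] by (rule 1)
  qed
  moreover have "Y (KK f g) - KK (vf_apply v f) g - KK f (vf_apply v g) = - d\<D> \<A> \<Psi> S \<Sigma> \<theta> f g"
    if f: "f \<in> CS" and g: "g \<in> CS" for f g
  proof -
    have "d\<D> \<A> \<Psi> S \<Sigma> \<theta> f g = - DD f (Q g) + DD g (Q f) + Q (lp f g)"
      by (simp add: d\<D>_def \<theta>a f g lp_smooth DD_minus c)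
    moreover have "a = m - n + (q + s) - b \<Longrightarrow> a - m - q = - (- s + n + b)" for a b m n q s :: "'a covfield"
      by simp
    moreover have "L (KK f g) = KK (l f) g - DD g (Q f) + (KK f (l g) + DD f (Q g)) - Q (lp f g)"
      using c(15)[OF f g] by (metis add_diff_cancel_left')
    ultimately show ?thesis unfolding YL[OF KK_closed[OF f g]] va[OF f] va[OF g] by metis
  qed
  ultimately show "Y \<in> \<MM> \<A> \<Psi> S \<Sigma>"
    unfolding \<MM>_def using assoc \<theta> by blast
qed

text \<open>The two equations in the definition of \<open>\<MM>\<close> are the two bracket laws
  that involve Q, solved for \<theta> = -Q; the other laws say that Y lies in \<open>PDer\<close>
  over l and that \<theta> is a derivation. So each choice of l and \<theta> yields a derivation X
  over Y.\<close>

lemma fibre_part_image_supset: "\<MM> \<A> \<Psi> S \<Sigma> \<subseteq> fibre_part ` PoissP"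
proof
  fix Y assume "Y \<in> \<MM> \<A> \<Psi> S \<Sigma>"
  then obtain v \<theta> where Y: "Y \<in> PDer \<A> \<Psi> S" and v: "associated_field \<A> \<Psi> S Y v" and \<theta>: "\<theta> \<in> conormal_valued_fields \<A> S"
    and e: "\<And>f \<eta>. f \<in> CS \<Longrightarrow> \<eta> \<in> CN \<Longrightarrow> DD f (Y \<eta>) - Y (DD f \<eta>) + DD (vf_apply v f) \<eta> = fib (cvf_apply \<theta> f) \<eta>"
    "\<And>f g. f \<in> CS \<Longrightarrow> g \<in> CS \<Longrightarrow> Y (KK f g) - KK (vf_apply v f) g - KK f (vf_apply v g) = - d\<D> \<A> \<Psi> S \<Sigma> \<theta> f g"
    unfolding \<MM>_def using CN_zero Cinf_zero by blast
  define l where "l f = vf_apply v f" for f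
  define Q where "Q f = - cvf_apply \<theta> f" for f
  have vt: "v p \<in> tangent \<A> S p" if "p \<in> S" for p using v that by (simp add: associated_field_def vector_fields_def)
  have v0: "v p = 0" if "p \<notin> S" for p using v that by (simp add: associated_field_def vector_fields_def)
  have lp: "l f p = v p f" for f p by (simp add: l_def vf_apply_def)
  have l: "l f \<in> CS" if "f \<in> CS" for f
    using v that by (simp add: associated_field_def vector_fields_def l_def vf_apply_def)
  have Qp: "Q f p = - \<theta> p f" for f p by (simp add: Q_def cvf_apply_def)
  have \<theta>CN: "cvf_apply \<theta> f \<in> CN" if "f \<in> CS" for f
    using \<theta> that by (simp add: conormal_valued_fields_def cvf_apply_def)
  have Q: "Q f \<in> CN" if "f \<in> CS" for f
    using CN_neg[OF \<theta>CN[OF that]] by (simp add: Q_def)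
  have Y': "lin_on CN Y" "\<And>\<eta>. \<eta> \<in> CN \<Longrightarrow> Y \<eta> \<in> CN"
    "\<And>\<eta> \<xi>. \<eta> \<in> CN \<Longrightarrow> \<xi> \<in> CN \<Longrightarrow> Y (fib \<eta> \<xi>) = fib (Y \<eta>) \<xi> + fib \<eta> (Y \<xi>)"
    using Y by (auto simp: PDer_def)
  have \<theta>p: "lin_on CS (\<theta> p)" "\<And>f g. f \<in> CS \<Longrightarrow> g \<in> CS \<Longrightarrow> \<theta> p (f * g) = f p *\<^sub>R \<theta> p g + g p *\<^sub>R \<theta> p f" if "p \<in> S" for p
    using \<theta> that by (auto simp: conormal_valued_fields_def)
  have \<theta>0: "\<theta> p = 0" if "p \<notin> S" for p using \<theta> that by (simp add: conormal_valued_fields_def)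
  have X: "restr P (\<lambda>x. (l (fst x), Q (fst x) + Y (snd x))) \<in> PoissP"
  proof (rule Poiss_I[where l = l and Q = Q and L = Y])
    fix f assume f: "f \<in> CS"
    show "l f \<in> CS" by (rule l[OF f])
    show "Q f \<in> CN" by (rule Q[OF f])
    show "l (r *\<^sub>R f) = r *\<^sub>R l f" for r
    proof
      show "l (r *\<^sub>R f) p = (r *\<^sub>R l f) p" for p
        using tangent_scale[OF vt f] v0 by (cases "p \<in> S") (auto simp: lp)
    qed
    show "Q (r *\<^sub>R f) = r *\<^sub>R Q f" for r
    proof
      show "Q (r *\<^sub>R f) p = (r *\<^sub>R Q f) p" for p
        using lin_on_scale[OF \<theta>p(1) f] \<theta>0 by (cases "p \<in> S") (auto simp: Qp)
    qed
    show "Y (smooth_scale f \<eta>) = smooth_scale f (Y \<eta>) + smooth_scale (l f) \<eta>" if "\<eta> \<in> CN" for \<eta>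
      using v f that by (simp add: associated_field_def l_def)
    show "Y (DD f \<xi>) = DD (l f) \<xi> + fib (Q f) \<xi> + DD f (Y \<xi>)" if "\<xi> \<in> CN" for \<xi>
    proof -
      have "a - y + b = t \<Longrightarrow> y = b + - t + a" for a b t y :: "'a covfield"
        by (simp add: algebra_simps)
      then show ?thesis
        using e(1)[OF f that] fib_minus_left[OF that \<theta>CN[OF f]] unfolding Q_def l_def by metis
    qed
    fix g assume g: "g \<in> CS"
    show "l (f + g) = l f + l g"
    proof
      show "l (f + g) p = (l f + l g) p" for p
        using tangent_add[OF vt f g] v0 by (cases "p \<in> S") (auto simp: lp)
    qed
    show "l (f * g) = f * l g + g * l f"
    proof
      show "l (f * g) p = (f * l g + g * l f) p" for p
        using tangent_mult[OF vt f g] v0 by (cases "p \<in> S") (auto simp: lp)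
    qed
    show "Q (f + g) = Q f + Q g"
    proof
      show "Q (f + g) p = (Q f + Q g) p" for p
        using lin_on_add[OF \<theta>p(1) f g] \<theta>0 by (cases "p \<in> S") (auto simp: Qp)
    qed
    show "Q (f * g) = smooth_scale f (Q g) + smooth_scale g (Q f)"
    proof
      show "Q (f * g) p = (smooth_scale f (Q g) + smooth_scale g (Q f)) p" for p
        using \<theta>p(2)[OF _ f g, of p] \<theta>0[of p] by (cases "p \<in> S") (auto simp: Qp smooth_scale_def)
    qed
    show "l (lp f g) = lp (l f) g + lp f (l g)"
      using v f g by (simp add: associated_field_def l_def)
    show "Q (lp f g) + Y (KK f g) = KK (l f) g - DD g (Q f) + (KK f (l g) + DD f (Q g))"
    proof -
      have "y - m - q = - (s - n - b) \<Longrightarrow> - b + y = m - - n + (q + - s)" for y b m n q s :: "'a covfield"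
        by (simp add: algebra_simps)
      then show ?thesis
        using e(2)[OF f g] DD_minus[OF f \<theta>CN[OF g]] DD_minus[OF g \<theta>CN[OF f]]
        unfolding Q_def l_def d\<D>_def by metis
    qed
  next
    show "Y (\<eta> + \<xi>) = Y \<eta> + Y \<xi>" if "\<eta> \<in> CN" "\<xi> \<in> CN" for \<eta> \<xi> by (rule lin_on_add[OF Y'(1) that])
    show "Y (r *\<^sub>R \<eta>) = r *\<^sub>R Y \<eta>" if "\<eta> \<in> CN" for \<eta> r by (rule lin_on_scale[OF Y'(1) that])
    show "Y \<eta> \<in> CN" if "\<eta> \<in> CN" for \<eta> by (rule Y'(2)[OF that])
    show "Y (fib \<eta> \<xi>) = fib (Y \<eta>) \<xi> + fib \<eta> (Y \<xi>)" if "\<eta> \<in> CN" "\<xi> \<in> CN" for \<eta> \<xi> by (rule Y'(3)[OF that])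
  qed
  have "Q 0 = 0"
  proof
    show "Q 0 p = 0 p" for p
      using lin_on_zero[OF \<theta>p(1) Cinf_zero, of p] \<theta>0[of p] by (cases "p \<in> S") (auto simp: Qp)
  qed
  have "fibre_part (restr P (\<lambda>x. (l (fst x), Q (fst x) + Y (snd x)))) = Y"
  proof
    show "fibre_part (restr P (\<lambda>x. (l (fst x), Q (fst x) + Y (snd x)))) \<eta> = Y \<eta>" for \<eta>
      using lin_on_out[OF Y'(1), of \<eta>] \<open>Q 0 = 0\<close> by (cases "\<eta> \<in> CN") (simp_all add: fibre_part_def in_P_zero)
  qed
  then show "Y \<in> fibre_part ` PoissP" using X by (intro image_eqI[OF sym])
qed

text \<open>With L = 0 the Leibniz rule for L reads l(f) \<eta> = 0; evaluate it at p for a section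
  \<eta> that is nonzero there.\<close>

lemma Poiss_kernel:
  assumes k: "k < DIM('b)" and X: "X \<in> PoissP" and z: "fibre_part X = 0"
  shows "f \<in> CS \<Longrightarrow> fst (X (f, 0)) = 0" "\<eta> \<in> CN \<Longrightarrow> snd (X (0, \<eta>)) = 0"
proof -
  note c = Poiss_components[OF X]
  show L: "snd (X (0, \<eta>)) = 0" if "\<eta> \<in> CN" for \<eta>
    using z that by (auto simp: fibre_part_def fun_eq_iff restr_def split: if_splits)
  show "fst (X (f, 0)) = 0" if f: "f \<in> CS"
  proof
    fix p show "fst (X (f, 0)) p = 0 p"
    proof (cases "p \<in> S")
      case True
      obtain \<eta> where \<eta>: "\<eta> \<in> CN" "\<eta> p \<noteq> 0" by (rule conormal_nonzero[OF k True])
      have "smooth_scale (fst (X (f, 0))) \<eta> = 0"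
        using c(13)[OF f \<eta>(1)] L[OF smooth_scale_closed[OF f \<eta>(1)]] L[OF \<eta>(1)] by (simp add: smooth_scale_zero)
      then have "fst (X (f, 0)) p *\<^sub>R \<eta> p = 0" by (simp add: smooth_scale_def fun_eq_iff[of _ "0 :: 'a covfield"])
      then show ?thesis using \<eta>(2) unfolding scaleR_eq_0_iff by simp
    next
      case False
      then show ?thesis using Cinf_out[OF c(2)[OF f]] by simp
    qed
  qed
qed

lemma mixed_part_inj:
  assumes k: "k < DIM('b)" and X: "X \<in> PoissP" and z: "fibre_part X = 0" "mixed_part X = 0"
  shows "X = 0"
proof
  fix x
  show "X x = 0 x"
  proof (cases "x \<in> P")
    case True
    then obtain f \<eta> where x: "x = (f, \<eta>)" "f \<in> CS" "\<eta> \<in> CN" by (cases x) (auto simp: in_P)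
    have "mixed_part X [f] = 0" using z(2) by simp
    then have "snd (X (f, 0)) = 0" using x(2) cochain_args_1[of "[f]"] by (simp add: mixed_part_def)
    then show ?thesis
      using Poiss_components(1)[OF X x(2,3)] Poiss_kernel[OF k X z(1)] x by (simp add: zero_prod_def)
  next
    case False
    moreover have "lin_on P X" using X by (simp add: Poiss_def)
    ultimately show ?thesis using lin_on_out[of P X x] by simp
  qed
qed

text \<open>Once l and L vanish, the law for a function and a section says that Q takes values in
  the centre, and the law for two functions is the cocycle condition, as all terms with \<K> drop
  out.\<close>

lemma mixed_part_image_Poiss:
  assumes k: "k < DIM('b)"
  shows "mixed_part ` {X \<in> PoissP. fibre_part X = 0} =
    {Q \<in> cochains \<A> \<Psi> S 1. cochain_diff \<A> \<Psi> S \<Sigma> 1 Q = 0}"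
proof
  show "mixed_part ` {X \<in> PoissP. fibre_part X = 0} \<subseteq> {Q \<in> cochains \<A> \<Psi> S 1. cochain_diff \<A> \<Psi> S \<Sigma> 1 Q = 0}"
  proof clarify
    fix X assume X: "X \<in> PoissP" "fibre_part X = 0"
    define Q where "Q f = snd (X (f, 0))" for f
    note c = Poiss_components[OF X(1), folded Q_def]
    note ker = Poiss_kernel[OF k X]
    have mQ: "mixed_part X [f] = Q f" if "f \<in> CS" for f
      using that cochain_args_1[of "[f]"] by (simp add: mixed_part_def Q_def)
    have m0: "mixed_part X [f] = 0" if "f \<notin> CS" for f
      using that cochain_args_1[of "[f]"] by (simp add: mixed_part_def)
    have cent: "Q f \<in> centre" if f: "f \<in> CS" for f
      unfolding center_sections_def
    proof (intro CollectI conjI ballI)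
      show "Q f \<in> CN" by (rule c(3)[OF f])
      fix \<xi> assume \<xi>: "\<xi> \<in> CN"
      show "fib (Q f) \<xi> = 0"
        using c(16)[OF f \<xi>] ker(2)[OF DD_closed[OF f \<xi>]] ker(2)[OF \<xi>] ker(1)[OF f] f \<xi> by (simp add: DD_zero)
    qed
    have "mixed_part X \<in> cochains \<A> \<Psi> S 1"
      unfolding cochains_def
    proof (intro CollectI conjI allI impI ballI)
      fix fs assume "fs \<in> cochain_args \<A> S 1"
      then obtain f where f: "f \<in> CS" "fs = [f]" unfolding cochain_args_1 by blast
      show "mixed_part X fs \<in> centre" unfolding f(2) mQ[OF f(1)] by (rule cent[OF f(1)])
      fix i :: nat assume "i < 1"
      then have i: "i = 0" by simp
      show "lin_on CS (\<lambda>g. mixed_part X (fs[i := g]))"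
        unfolding lin_on_def f(2) i by (auto simp: mQ m0 Cinf_add Cinf_scale c)
      show "mixed_part X (fs[i := g * h]) = smooth_scale g (mixed_part X (fs[i := h])) + smooth_scale h (mixed_part X (fs[i := g]))"
        if "g \<in> CS" "h \<in> CS" for g h
        unfolding f(2) i using that by (simp add: mQ Cinf_mult c)
    qed (auto simp: mixed_part_def)
    moreover have "cochain_diff \<A> \<Psi> S \<Sigma> 1 (mixed_part X) = 0"
    proof
      fix fs show "cochain_diff \<A> \<Psi> S \<Sigma> 1 (mixed_part X) fs = 0 fs"
      proof (cases "fs \<in> cochain_args \<A> S (Suc 1)")
        case True
        then obtain f g where fg: "f \<in> CS" "g \<in> CS" "fs = [f, g]" unfolding cochain_args_2 by blast
        have "Q (lp f g) = DD f (Q g) - DD g (Q f)"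
          using c(15)[OF fg(1,2)] ker fg by (simp add: KK_closed KK_zero)
        then show ?thesis unfolding fg(3) cochain_diff_1[OF fg(1,2)] using fg by (simp add: mQ lp_smooth)
      qed (simp add: cochain_diff_def)
    qed
    ultimately show "mixed_part X \<in> cochains \<A> \<Psi> S 1 \<and> cochain_diff \<A> \<Psi> S \<Sigma> 1 (mixed_part X) = 0" by blast
  qed
  show "{Q \<in> cochains \<A> \<Psi> S 1. cochain_diff \<A> \<Psi> S \<Sigma> 1 Q = 0} \<subseteq> mixed_part ` {X \<in> PoissP. fibre_part X = 0}"
  proof clarify
    fix C assume C: "C \<in> cochains \<A> \<Psi> S 1" "cochain_diff \<A> \<Psi> S \<Sigma> 1 C = 0"
    define Q where "Q f = C [f]" for f
    have a1: "[f] \<in> cochain_args \<A> S 1" if "f \<in> CS" for f using that cochain_args_1 by blast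
    have C0: "C fs = 0" if "fs \<notin> cochain_args \<A> S 1" for fs using C(1) that by (simp add: cochains_def)
    have cent: "Q f \<in> centre" if "f \<in> CS" for f
      using C(1) a1[OF that] by (simp add: cochains_def Q_def)
    have lin: "lin_on CS Q"
    proof -
      have "\<forall>fs\<in>cochain_args \<A> S 1. \<forall>i<1. lin_on CS (\<lambda>g. C (fs[i := g]))"
        using C(1) unfolding cochains_def by (elim CollectE conjE)
      \<comment> \<open>Cochain conditions are stated by updating an entry of an admissible list;
        the list \<open>[0]\<close> is a placeholder whose only entry is overwritten.\<close>
      from this[rule_format, OF a1[OF Cinf_zero] zero_less_one] have "lin_on CS (\<lambda>g. C ([0][0 := g]))" .
      then show ?thesis by (simp add: Q_def[abs_def])
    qed
    have der: "Q (g * h) = smooth_scale g (Q h) + smooth_scale h (Q g)" if gh: "g \<in> CS" "h \<in> CS" for g h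
    proof -
      have "\<forall>fs\<in>cochain_args \<A> S 1. \<forall>i<1. \<forall>g\<in>CS. \<forall>h\<in>CS.
          C (fs[i := g * h]) = smooth_scale g (C (fs[i := h])) + smooth_scale h (C (fs[i := g]))"
        using C(1) unfolding cochains_def by (elim CollectE conjE)
      from this[rule_format, OF a1[OF Cinf_zero] zero_less_one gh] show ?thesis by (simp add: Q_def)
    qed
    have X: "restr P (\<lambda>x. ((\<lambda>_. 0) (fst x), Q (fst x) + (\<lambda>_. 0) (snd x))) \<in> PoissP" (is "?X \<in> _")
    proof (rule Poiss_I[where l = "\<lambda>_. 0" and Q = Q and L = "\<lambda>_. 0"])
      fix f assume f: "f \<in> CS"
      show "Q f \<in> CN" by (rule centerD(1)[OF cent[OF f]])
      show "Q (r *\<^sub>R f) = r *\<^sub>R Q f" for r by (rule lin_on_scale[OF lin f])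
      show "0 = DD 0 \<xi> + fib (Q f) \<xi> + DD f 0" if "\<xi> \<in> CN" for \<xi>
        using centerD(2)[OF cent[OF f] that] f that by (simp add: DD_zero)
      fix g assume g: "g \<in> CS"
      show "Q (f + g) = Q f + Q g" by (rule lin_on_add[OF lin f g])
      show "Q (f * g) = smooth_scale f (Q g) + smooth_scale g (Q f)" by (rule der[OF f g])
      show "0 = lp 0 g + lp f 0" using f g by (simp add: lp_zero)
      have "cochain_diff \<A> \<Psi> S \<Sigma> 1 C [f, g] = 0" using C(2) by simp
      then have "Q (lp f g) = DD f (Q g) - DD g (Q f)" unfolding cochain_diff_1[OF f g] Q_def by (simp add: algebra_simps)
      then show "Q (lp f g) + 0 = KK 0 g - DD g (Q f) + (KK f 0 + DD f (Q g))"
        using f g by (simp add: KK_zero)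
    qed (auto simp: Cinf_zero CN_zero smooth_scale_zero fib_zero)
    have "fibre_part ?X = 0"
      using lin_on_zero[OF lin Cinf_zero] by (auto simp: fibre_part_def restr_def fun_eq_iff)
    moreover have "mixed_part ?X = C"
    proof
      fix fs show "mixed_part ?X fs = C fs"
      proof (cases "fs \<in> cochain_args \<A> S 1")
        case True
        then obtain f where "f \<in> CS" "fs = [f]" unfolding cochain_args_1 by blast
        then show ?thesis using True by (simp add: mixed_part_def Q_def in_P_zero)
      qed (simp add: mixed_part_def C0)
    qed
    ultimately show "C \<in> mixed_part ` {X \<in> PoissP. fibre_part X = 0}"
      using X by (intro image_eqI[of _ _ ?X]) auto
  qed
qed

lemma mixed_part_Ham:
  assumes "f \<in> CS" "\<eta> \<in> CN" "g \<in> CS"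
  shows "mixed_part (restr P (Pbr (f, \<eta>))) [g] = KK f g - DD g \<eta>"
proof -
  have "Pbr (f, \<eta>) (g, 0) = Pbr (f, 0) (g, 0) + Pbr (0, \<eta>) (g, 0)"
    using Pbr_add_left[OF in_P_zero(1)[OF assms(3)] in_P_zero(1)[OF assms(1)] in_P_zero(2)[OF assms(2)]] by simp
  moreover have "[g] \<in> cochain_args \<A> S 1" using assms(3) cochain_args_1 by blast
  ultimately show ?thesis using assms by (simp add: mixed_part_def in_P_zero Pbr_comp)
qed

text \<open>If {f \<oplus> \<eta>, _} has no fibre part, then {f, _} = 0, so nondegeneracy removes f
  from \<D> and \<K>. It follows that \<eta> is central and that the mixed part g \<mapsto> -D_g
  \<eta> is the coboundary of -\<eta>.\<close>

lemma mixed_part_image_Ham: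
  assumes k: "k < DIM('b)"
  shows "mixed_part ` {X \<in> HamP. fibre_part X = 0} = cochain_diff \<A> \<Psi> S \<Sigma> 0 ` cochains \<A> \<Psi> S 0"
proof
  have eqI: "Y = cochain_diff \<A> \<Psi> S \<Sigma> 0 Q"
    if "Y \<in> range mixed_part" "\<And>g. g \<in> CS \<Longrightarrow> Y [g] = DD g (Q [])" for Y Q
  proof
    fix fs show "Y fs = cochain_diff \<A> \<Psi> S \<Sigma> 0 Q fs"
    proof (cases "fs \<in> cochain_args \<A> S 1")
      case True
      then obtain g where g: "g \<in> CS" "fs = [g]" unfolding cochain_args_1 by blast
      show ?thesis unfolding g(2) cochain_diff_0[OF g(1)] by (rule that(2)[OF g(1)])
    next
      case False
      then show ?thesis using that(1) by (auto simp: mixed_part_def cochain_diff_def)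
    qed
  qed
  show "mixed_part ` {X \<in> HamP. fibre_part X = 0} \<subseteq> cochain_diff \<A> \<Psi> S \<Sigma> 0 ` cochains \<A> \<Psi> S 0"
  proof clarify
    fix X assume X: "X \<in> HamP" "fibre_part X = 0"
    then obtain f \<eta> where f: "f \<in> CS" and \<eta>: "\<eta> \<in> CN" and X': "X = restr P (Pbr (f, \<eta>))"
      by (auto simp: Ham_def in_P)
    have XP: "X \<in> PoissP" using X(1) Ham_subset_Poiss by blast
    have "lp f g = 0" if g: "g \<in> CS" for g
      using Poiss_kernel(1)[OF k XP X(2) g] in_P_zero(1)[OF g] by (simp add: X' fst_Pbr)
    \<comment> \<open>The vanishing of the differential is all that is needed to replace f by 0
      inside \<D> and \<K>.\<close>
    then have d: "dS f = dS 0" using lp_nondegenerate[OF f] dSigma_zero by simp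
    have "fib \<eta> \<xi> = 0" if \<xi>: "\<xi> \<in> CN" for \<xi>
    proof -
      have "fibre_part X \<xi> = DD f \<xi> + fib \<eta> \<xi>" unfolding X' fibre_part_Ham[OF f \<eta>] using \<xi> by simp
      then show ?thesis using X(2) DD_zero(2)[OF \<xi>] by (simp add: d)
    qed
    then have \<eta>c: "- \<eta> \<in> centre" using \<eta> CN_neg by (auto simp: center_sections_def fib_minus_left)
    define Q where "Q fs = (if fs = [] then - \<eta> else 0)" for fs :: "('a \<Rightarrow> real) list"
    have "Q \<in> cochains \<A> \<Psi> S 0" using \<eta>c by (auto simp: cochains_def cochain_args_0 Q_def)
    moreover have "mixed_part X = cochain_diff \<A> \<Psi> S \<Sigma> 0 Q"
    proof (rule eqI)
      show "mixed_part X [g] = DD g (Q [])" if g: "g \<in> CS" for g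
        unfolding X' mixed_part_Ham[OF f \<eta> g] d using g \<eta> by (simp add: KK_zero Q_def DD_minus)
    qed simp
    ultimately show "mixed_part X \<in> cochain_diff \<A> \<Psi> S \<Sigma> 0 ` cochains \<A> \<Psi> S 0" by blast
  qed
  show "cochain_diff \<A> \<Psi> S \<Sigma> 0 ` cochains \<A> \<Psi> S 0 \<subseteq> mixed_part ` {X \<in> HamP. fibre_part X = 0}"
  proof clarify
    fix Q assume "Q \<in> cochains \<A> \<Psi> S 0"
    then have \<zeta>: "Q [] \<in> centre" by (simp add: cochains_def cochain_args_0)
    let ?\<eta> = "- Q []"
    have \<eta>: "?\<eta> \<in> CN" using CN_neg[OF centerD(1)[OF \<zeta>]] .
    let ?X = "restr P (Pbr (0, ?\<eta>))"
    have X: "?X \<in> HamP" using \<eta> in_P_zero(2) unfolding Ham_def by blast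
    have "fibre_part ?X = 0"
      unfolding fibre_part_Ham[OF Cinf_zero \<eta>]
      using centerD[OF \<zeta>] by (auto simp: restr_def fun_eq_iff DD_zero fib_minus_left)
    moreover have "mixed_part ?X = cochain_diff \<A> \<Psi> S \<Sigma> 0 Q"
    proof (rule eqI)
      show "mixed_part ?X [g] = DD g (Q [])" if g: "g \<in> CS" for g
        unfolding mixed_part_Ham[OF Cinf_zero \<eta> g] using g centerD(1)[OF \<zeta>] by (simp add: KK_zero DD_minus)
    qed simp
    ultimately show "cochain_diff \<A> \<Psi> S \<Sigma> 0 Q \<in> mixed_part ` {X \<in> HamP. fibre_part X = 0}"
      using X by (intro image_eqI[of _ _ ?X]) auto
  qed
qed

lemma H1_P_split:
  assumes k: "k < DIM('b)"
  shows "rvs_isomorphic (H1_P \<A> \<Psi> S \<Sigma>)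
    (dsum_rvs (H1_cochains \<A> \<Psi> S \<Sigma>)
      (quotient_rvs (\<MM> \<A> \<Psi> S \<Sigma>) {\<L> + \<L>' |\<L> \<L>'. \<L> \<in> \<C> \<A> \<Psi> S \<Sigma> \<and> \<L>' \<in> Inn \<A> \<Psi> S}))"
  unfolding H1_P_def H1_cochains_def
  by (rule quotient_rvs_split[OF linear_fibre_part linear_mixed_part subspace_Poiss subspace_Ham Ham_subset_Poiss
        equalityI[OF fibre_part_image_subset fibre_part_image_supset] fibre_part_image_Ham
        mixed_part_inj[OF k] mixed_part_image_Poiss[OF k] mixed_part_image_Ham[OF k]])

end


theorem theorem10p8:
  fixes \<A> :: "('m::{t2_space, second_countable_topology}, 'e::euclidean_space) atlas"
    and \<Psi> :: "'m \<Rightarrow> 'm covec \<Rightarrow> 'm covec \<Rightarrow> real"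
    and S :: "'m set" and k :: nat
    and \<Sigma> :: "'m \<Rightarrow> 'm tvec set"
  assumes "smooth_atlas \<A>"
    and "poisson_bivector \<A> \<Psi>"
    and "embedded_symplectic_leaf \<A> \<Psi> k S" and "k < DIM('e)"
    and "transversal \<A> S \<Sigma>"
    and "perfect_isotropy \<A> \<Psi> S"
  shows "rvs_isomorphic
           (H1_P \<A> \<Psi> S \<Sigma>)
           (dsum_rvs
              (H1_cochains \<A> \<Psi> S \<Sigma>)
              (quotient_rvs (\<MM> \<A> \<Psi> S \<Sigma>) {\<L> + \<L>' |\<L> \<L>'. \<L> \<in> \<C> \<A> \<Psi> S \<Sigma> \<and> \<L>' \<in> Inn \<A> \<Psi> S}))"
proof -
  interpret transversal_leaf \<A> \<Psi> S k \<Sigma>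
    by unfold_locales (fact assms)+
  show ?thesis
    by (rule H1_P_split[OF assms(4)])
qed

end
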